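(* Let $R$ be a unital ring and let $G=\langle t\rangle$ or $G=D_\infty$. If $\alpha$ is a $\frac{1}{30}$-automorphism in $\mathcal{O}^G(\mathbb{R})$, then the class $[\alpha]\in K_1(\mathcal{O}^G(\mathbb{R}))$ is trivial.
   Context: Groups and actions. $\langle t\rangle$ is the infinite cyclic group acting on $\mathbb{R}$ with $t$ acting by $x\mapsto x+1$. $D_\infty=\langle r,s\mid s^2=1,\ rs=sr^{-1}\rangle$ acts on $\mathbb{R}$ with $r$ acting by $x\mapsto x+1$ and $s$ by $x\mapsto -x$. Let $p:\overline{X}\to\mathbb{R}$ be the following free $G$-space with $G$-map: if $G=\langle t\rangle$, $\overline{X}=\mathbb{R}$ and $p=\mathrm{id}$; if $G=D_\infty$, $\overline{X}=\mathbb{Z}/2\times\mathbb{R}$ with the diagonal action, where $D_\infty$ acts on $\mathbb{Z}/2\cong D_\infty/\langle r\rangle$ by left translation, and $p$ is the projection. Geometric modules. For a space $Y$, a geometric $R$-module over $Y$ is a family $A=(A_y)_{y\in Y}$ of finitely generated free $R$-modules whose support $\{y: A_y\neq 0\}$ is locally finite in $Y$ (each point of $Y$ has an open neighborhood meeting it in a finite set). A morphism $\varphi:A\to B$ is a family of $R$-module maps $\varphi_x^y:A_x\to B_y$ such that for every $y$ the set $\{x:\varphi_x^y\ne0\}$ is finite and for every $x$ the set $\{y:\varphi_x^y\neq 0\}$ is finite; composition is matrix multiplication; $\operatorname{supp}(\varphi)=\{(x,y):\varphi_x^y\neq0\}$. If $G$ acts on $Y$, $A$ is $G$-invariant if $A_{gy}=A_y$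 for all $g,y$, and $\varphi$ is $G$-invariant if $\varphi_{gx}^{gy}=\varphi_x^y$ for all $g,x,y$. Control. Let $X$ be a $G$-space, and let $G$ act trivially on $[1,\infty]$. $\mathcal{E}^X_{Gcc}$ is the collection of subsets $E\subset (X\times[1,\infty))\times(X\times[1,\infty))$ such that: (1) for every $x\in X$ and every $G_x$-invariant open neighborhood $U$ of $(x,\infty)$ in $X\times[1,\infty]$ there is a $G_x$-invariant open neighborhood $V\subset U$ of $(x,\infty)$ with $((X\times[1,\infty]-U)\times V)\cap E=\emptyset$ ($G_x$ is the stabilizer of $x$); (2) there is $\delta<\infty$ with $|t-t'|\le\delta$ for all $((x,t),(x',t'))\in E$; (3) $E$ is symmetric and invariant under the diagonal $G$-action. $\mathcal{O}^G(\mathbb{R})$ is the additive category whose objects are the $G$-invariant geometric $R$-modules over $\overline{X}\times[1,\infty)$ whose support is contained in $GK\times[1,\infty)$ for some compact $K\subset\overline{X}$, and whose morphisms are the $G$-invariant morphisms $\varphi$ for which there is $E\in\mathcal{E}^{\mathbb{R}}_{Gcc}$ with $((p(\bar x),t),(p(\bar y),s))\in E$ for all $((\bar x,t),(\bar y,s))\in\operatorname{supp}(\varphi)$. Size. For $\epsilon>0$, a morphism $\varphi$ of $\mathcal{O}^G(\mathbb{R})$ is $\epsilon$-controlled if $|p(\bar x)-p(\bar y)|<\epsilon$ for all $((\bar x,t),(\bar y,s))\in\operatorname{supp}(\varphi)$. An $\epsilon$-automorphism is an automorphism $\varphi$ such that $\varphi$ and $\varphi^{-1}$ are both $\epsilon$-controlled.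 $K_1$ of an additive category is its algebraic $K_1$-group. *)

theory Defs
  imports
    "HOL-Analysis.Analysis"
    "HOL-Algebra.Module"
    "HOL-Algebra.Group_Action"
    "HOL-Algebra.Elementary_Groups"
    "HOL-Algebra.Free_Abelian_Groups"
begin

section \<open>Finitely generated free modules over a unital ring\<close>

text \<open>The library locale \<^locale>\<open>module\<close> requires a commutative ring of scalars; this is the
  same list of axioms over an arbitrary ring with unit.\<close>

locale left_module = R: ring R + M: abelian_group M
  for R :: "('r, 'k) ring_scheme" (structure) and M :: "('r, 'm, 'l) module_scheme" (structure) +
  assumes smult_closed:
      "\<lbrakk>a \<in> carrier R; x \<in> carrier M\<rbrakk> \<Longrightarrow> a \<odot>\<^bsub>M\<^esub> x \<in> carrier M"
    and smult_l_distr: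
      "\<lbrakk>a \<in> carrier R; b \<in> carrier R; x \<in> carrier M\<rbrakk> \<Longrightarrow>
        (a \<oplus>\<^bsub>R\<^esub> b) \<odot>\<^bsub>M\<^esub> x = a \<odot>\<^bsub>M\<^esub> x \<oplus>\<^bsub>M\<^esub> b \<odot>\<^bsub>M\<^esub> x"
    and smult_r_distr:
      "\<lbrakk>a \<in> carrier R; x \<in> carrier M; y \<in> carrier M\<rbrakk> \<Longrightarrow>
        a \<odot>\<^bsub>M\<^esub> (x \<oplus>\<^bsub>M\<^esub> y) = a \<odot>\<^bsub>M\<^esub> x \<oplus>\<^bsub>M\<^esub> a \<odot>\<^bsub>M\<^esub> y"
    and smult_assoc1:
      "\<lbrakk>a \<in> carrier R; b \<in> carrier R; x \<in> carrier M\<rbrakk> \<Longrightarrow>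
        (a \<otimes>\<^bsub>R\<^esub> b) \<odot>\<^bsub>M\<^esub> x = a \<odot>\<^bsub>M\<^esub> (b \<odot>\<^bsub>M\<^esub> x)"
    and smult_one:
      "x \<in> carrier M \<Longrightarrow> \<one>\<^bsub>R\<^esub> \<odot>\<^bsub>M\<^esub> x = x"

definition is_basis :: "('r, 'k) ring_scheme \<Rightarrow> ('r, 'm, 'l) module_scheme \<Rightarrow> 'm set \<Rightarrow> bool" where
  "is_basis R M B \<longleftrightarrow> finite B \<and> B \<subseteq> carrier M \<and>
     (\<forall>v\<in>carrier M. \<exists>!c. c \<in> B \<rightarrow>\<^sub>E carrier R \<and> v = (\<Oplus>\<^bsub>M\<^esub>b\<in>B. c b \<odot>\<^bsub>M\<^esub> b))"

definition fg_free :: "('r, 'k) ring_scheme \<Rightarrow> ('r, 'm, 'l) module_scheme \<Rightarrow> bool" where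
  "fg_free R M \<longleftrightarrow> left_module R M \<and> (\<exists>B. is_basis R M B)"

text \<open>Module maps are taken extensional (undefined off the carrier of the source), so that
  equality in HOL is equality of maps.\<close>

definition lin_maps ::
  "('r, 'k) ring_scheme \<Rightarrow> ('r, 'm, 'l) module_scheme \<Rightarrow> ('r, 'm, 'l) module_scheme \<Rightarrow> ('m \<Rightarrow> 'm) set" where
  "lin_maps R M N = {f \<in> carrier M \<rightarrow>\<^sub>E carrier N.
     (\<forall>v\<in>carrier M. \<forall>w\<in>carrier M. f (v \<oplus>\<^bsub>M\<^esub> w) = f v \<oplus>\<^bsub>N\<^esub> f w) \<and>
     (\<forall>a\<in>carrier R. \<forall>v\<in>carrier M. f (a \<odot>\<^bsub>M\<^esub> v) = a \<odot>\<^bsub>N\<^esub> f v)}"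

definition zero_map :: "('r, 'm, 'l) module_scheme \<Rightarrow> ('r, 'm, 'l) module_scheme \<Rightarrow> 'm \<Rightarrow> 'm" where
  "zero_map M N = (\<lambda>v\<in>carrier M. \<zero>\<^bsub>N\<^esub>)"

section \<open>Geometric modules\<close>

text \<open>The space is an abstract topology \<open>Y\<close>; families are extensional on \<open>topspace Y\<close>.
  A geometric module has type \<open>'y \<Rightarrow> ('r, 'm) module\<close>, where \<open>'m\<close> plays the role of
  a universe containing the underlying sets of the modules. The category has copies of all
  finitely generated free modules, hence direct sums, as soon as \<open>'m\<close> admits an injection from
  the lists over the ring, i.e. from the disjoint union of the sets \<open>R\<^sup>n\<close>; this has to be assumed
  wherever \<open>'m\<close> is arbitrary. The entry \<open>\<phi> x y\<close> of a morphism
  is the component from the module at \<open>x\<close> to the module at \<open>y\<close>.\<close>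

definition mod_supp :: "'y topology \<Rightarrow> ('y \<Rightarrow> ('r, 'm) module) \<Rightarrow> 'y set" where
  "mod_supp Y A = {y \<in> topspace Y. carrier (A y) \<noteq> {\<zero>\<^bsub>A y\<^esub>}}"

definition geom_module ::
  "('r, 'k) ring_scheme \<Rightarrow> 'y topology \<Rightarrow> ('y \<Rightarrow> ('r, 'm) module) \<Rightarrow> bool" where
  "geom_module R Y A \<longleftrightarrow>
     A \<in> extensional (topspace Y) \<and>
     (\<forall>y\<in>topspace Y. fg_free R (A y)) \<and>
     (\<forall>y\<in>topspace Y. \<exists>U. openin Y U \<and> y \<in> U \<and> finite (U \<inter> mod_supp Y A))"

definition mor_supp ::
  "'y topology \<Rightarrow> ('y \<Rightarrow> ('r, 'm) module) \<Rightarrow> ('y \<Rightarrow> ('r, 'm) module) \<Rightarrow>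
    ('y \<Rightarrow> 'y \<Rightarrow> 'm \<Rightarrow> 'm) \<Rightarrow> ('y \<times> 'y) set" where
  "mor_supp Y A B \<phi> = {(x, y) \<in> topspace Y \<times> topspace Y. \<phi> x y \<noteq> zero_map (A x) (B y)}"

definition geom_mor ::
  "('r, 'k) ring_scheme \<Rightarrow> 'y topology \<Rightarrow> ('y \<Rightarrow> ('r, 'm) module) \<Rightarrow> ('y \<Rightarrow> ('r, 'm) module) \<Rightarrow>
    ('y \<Rightarrow> 'y \<Rightarrow> 'm \<Rightarrow> 'm) set" where
  "geom_mor R Y A B =
     {\<phi> \<in> (\<Pi>\<^sub>E x\<in>topspace Y. \<Pi>\<^sub>E y\<in>topspace Y. lin_maps R (A x) (B y)).
       (\<forall>y\<in>topspace Y. finite {x. (x, y) \<in> mor_supp Y A B \<phi>}) \<and>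
       (\<forall>x\<in>topspace Y. finite {y. (x, y) \<in> mor_supp Y A B \<phi>})}"

definition mor_id ::
  "'y topology \<Rightarrow> ('y \<Rightarrow> ('r, 'm) module) \<Rightarrow> 'y \<Rightarrow> 'y \<Rightarrow> 'm \<Rightarrow> 'm" where
  "mor_id Y A = (\<lambda>x\<in>topspace Y. \<lambda>y\<in>topspace Y.
     if x = y then (\<lambda>v\<in>carrier (A x). v) else zero_map (A x) (A y))"

text \<open>\<open>mor_comp Y A B C \<psi> \<phi>\<close> is the composite of \<open>\<phi> : A \<rightarrow> B\<close> followed by \<open>\<psi> : B \<rightarrow> C\<close>. The sum
  defining its entry at \<open>(x, z)\<close> is over the finitely many \<open>y\<close> with \<open>\<phi> x y \<noteq> 0\<close>.\<close>

definition mor_comp ::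
  "'y topology \<Rightarrow> ('y \<Rightarrow> ('r, 'm) module) \<Rightarrow> ('y \<Rightarrow> ('r, 'm) module) \<Rightarrow> ('y \<Rightarrow> ('r, 'm) module) \<Rightarrow>
    ('y \<Rightarrow> 'y \<Rightarrow> 'm \<Rightarrow> 'm) \<Rightarrow> ('y \<Rightarrow> 'y \<Rightarrow> 'm \<Rightarrow> 'm) \<Rightarrow> 'y \<Rightarrow> 'y \<Rightarrow> 'm \<Rightarrow> 'm" where
  "mor_comp Y A B C \<psi> \<phi> = (\<lambda>x\<in>topspace Y. \<lambda>z\<in>topspace Y. \<lambda>v\<in>carrier (A x).
     \<Oplus>\<^bsub>C z\<^esub>y\<in>{y. (x, y) \<in> mor_supp Y A B \<phi>}. \<psi> y z (\<phi> x y v))"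

definition mor_add ::
  "'y topology \<Rightarrow> ('y \<Rightarrow> ('r, 'm) module) \<Rightarrow> ('y \<Rightarrow> ('r, 'm) module) \<Rightarrow>
    ('y \<Rightarrow> 'y \<Rightarrow> 'm \<Rightarrow> 'm) \<Rightarrow> ('y \<Rightarrow> 'y \<Rightarrow> 'm \<Rightarrow> 'm) \<Rightarrow> 'y \<Rightarrow> 'y \<Rightarrow> 'm \<Rightarrow> 'm" where
  "mor_add Y A B \<phi> \<psi> = (\<lambda>x\<in>topspace Y. \<lambda>y\<in>topspace Y. \<lambda>v\<in>carrier (A x).
     \<phi> x y v \<oplus>\<^bsub>B y\<^esub> \<psi> x y v)"

definition inv_module ::
  "('g, 'h) monoid_scheme \<Rightarrow> ('g \<Rightarrow> 'y \<Rightarrow> 'y) \<Rightarrow> 'y topology \<Rightarrow> ('y \<Rightarrow> ('r, 'm) module) \<Rightarrow> bool" where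
  "inv_module G act Y A \<longleftrightarrow> (\<forall>g\<in>carrier G. \<forall>y\<in>topspace Y. A (act g y) = A y)"

definition inv_mor ::
  "('g, 'h) monoid_scheme \<Rightarrow> ('g \<Rightarrow> 'y \<Rightarrow> 'y) \<Rightarrow> 'y topology \<Rightarrow> ('y \<Rightarrow> 'y \<Rightarrow> 'm \<Rightarrow> 'm) \<Rightarrow> bool" where
  "inv_mor G act Y \<phi> \<longleftrightarrow>
     (\<forall>g\<in>carrier G. \<forall>x\<in>topspace Y. \<forall>y\<in>topspace Y. \<phi> (act g x) (act g y) = \<phi> x y)"

section \<open>Equivariant continuous control\<close>

text \<open>A \<open>G\<close>-space is a type \<open>'x::topological_space\<close> with an action \<open>act\<close> of \<open>G\<close> on the whole type.
  The interval \<open>[1, \<infinity>]\<close> is \<open>{1..} :: ereal set\<close>, so \<open>[1, \<infinity>)\<close> is \<open>{1..} :: real set\<close>, embedded by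
  \<^const>\<open>ereal\<close>. The action on the interval coordinate is trivial.\<close>

definition act_cone :: "('g \<Rightarrow> 'x \<Rightarrow> 'x) \<Rightarrow> 'g \<Rightarrow> 'x \<times> 't \<Rightarrow> 'x \<times> 't" where
  "act_cone act g z = (act g (fst z), snd z)"

definition cone_top :: "('x::topological_space \<times> real) topology" where
  "cone_top = top_of_set (UNIV \<times> {1..})"

definition cone_top_inf :: "('x::topological_space \<times> ereal) topology" where
  "cone_top_inf = top_of_set (UNIV \<times> {1..})"

definition inv_nhd ::
  "('g, 'h) monoid_scheme \<Rightarrow> ('g \<Rightarrow> 'x::topological_space \<Rightarrow> 'x) \<Rightarrow> 'x \<Rightarrow> ('x \<times> ereal) set \<Rightarrow> bool" where
  "inv_nhd G act x U \<longleftrightarrow> openin cone_top_inf U \<and> (x, \<infinity>) \<in> U \<and>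
     (\<forall>g\<in>stabilizer G act x. act_cone act g ` U = U)"

definition E_Gcc ::
  "('g, 'h) monoid_scheme \<Rightarrow> ('g \<Rightarrow> 'x::topological_space \<Rightarrow> 'x) \<Rightarrow>
    (('x \<times> real) \<times> ('x \<times> real)) set set" where
  "E_Gcc G act = {E. E \<subseteq> (UNIV \<times> {1..}) \<times> (UNIV \<times> {1..}) \<and>
     (\<forall>x U. inv_nhd G act x U \<longrightarrow>
        (\<exists>V. V \<subseteq> U \<and> inv_nhd G act x V \<and>
           ((topspace cone_top_inf - U) \<times> V)
             \<inter> map_prod (map_prod id ereal) (map_prod id ereal) ` E = {})) \<and>
     (\<exists>\<delta>. \<forall>((x, t), (x', t'))\<in>E. \<bar>t - t'\<bar> \<le> \<delta>) \<and>
     sym E \<and>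
     (\<forall>g\<in>carrier G. \<forall>(a, b)\<in>E. (act_cone act g a, act_cone act g b) \<in> E)}"

section \<open>Algebraic $K_1$ of an additive category\<close>

text \<open>The data of a category with addition on its morphism sets; \<open>Comp A B C g f\<close> is
  \<open>g \<circ> f\<close> for \<open>f : A \<rightarrow> B\<close> and \<open>g : B \<rightarrow> C\<close>.\<close>

record ('o, 'f) add_cat =
  Obj :: "'o set"
  Hom :: "'o \<Rightarrow> 'o \<Rightarrow> 'f set"
  Id :: "'o \<Rightarrow> 'f"
  Comp :: "'o \<Rightarrow> 'o \<Rightarrow> 'o \<Rightarrow> 'f \<Rightarrow> 'f \<Rightarrow> 'f"
  Add :: "'o \<Rightarrow> 'o \<Rightarrow> 'f \<Rightarrow> 'f \<Rightarrow> 'f"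

definition inverse_mors :: "('o, 'f) add_cat \<Rightarrow> 'o \<Rightarrow> 'f \<Rightarrow> 'f \<Rightarrow> bool" where
  "inverse_mors \<C> A \<alpha> \<beta> \<longleftrightarrow> A \<in> Obj \<C> \<and> \<alpha> \<in> Hom \<C> A A \<and> \<beta> \<in> Hom \<C> A A \<and>
     Comp \<C> A A A \<alpha> \<beta> = Id \<C> A \<and> Comp \<C> A A A \<beta> \<alpha> = Id \<C> A"

definition Auts :: "('o, 'f) add_cat \<Rightarrow> ('o \<times> 'f) set" where
  "Auts \<C> = {(A, \<alpha>). \<exists>\<beta>. inverse_mors \<C> A \<alpha> \<beta>}"

text \<open>\<open>A \<rightarrow> B \<rightarrow> C\<close> (by \<open>i\<close>, \<open>q\<close>) is a split exact sequence: there are a retraction \<open>r\<close> of \<open>i\<close> and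
  a section \<open>s\<close> of \<open>q\<close> with \<open>ir + sq = 1\<close>. The relations \<open>qi = 0\<close> and \<open>rs = 0\<close> follow.\<close>

definition split_exact :: "('o, 'f) add_cat \<Rightarrow> 'o \<Rightarrow> 'o \<Rightarrow> 'o \<Rightarrow> 'f \<Rightarrow> 'f \<Rightarrow> bool" where
  "split_exact \<C> A B C i q \<longleftrightarrow> i \<in> Hom \<C> A B \<and> q \<in> Hom \<C> B C \<and>
     (\<exists>r\<in>Hom \<C> B A. \<exists>s\<in>Hom \<C> C B.
        Comp \<C> A B A r i = Id \<C> A \<and> Comp \<C> C B C q s = Id \<C> C \<and>
        Add \<C> B B (Comp \<C> B A B i r) (Comp \<C> B C B s q) = Id \<C> B)"

text \<open>$K_1$ by generators and relations: the abelian group generated by the automorphisms, with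
  \<open>[\<alpha>\<beta>] = [\<alpha>] + [\<beta>]\<close> for automorphisms of one object, and \<open>[\<beta>] = [\<alpha>] + [\<gamma>]\<close> for an automorphism
  \<open>(\<alpha>, \<beta>, \<gamma>)\<close> of a split exact sequence. (The case \<open>C = 0\<close> of the latter is invariance under
  conjugation by isomorphisms.)\<close>

definition K1_rels :: "('o, 'f) add_cat \<Rightarrow> (('o \<times> 'f) \<Rightarrow>\<^sub>0 int) set" where
  "K1_rels \<C> =
     {frag_of (A, Comp \<C> A A A \<alpha> \<beta>) - frag_of (A, \<alpha>) - frag_of (A, \<beta>) | A \<alpha> \<beta>.
        (A, \<alpha>) \<in> Auts \<C> \<and> (A, \<beta>) \<in> Auts \<C>} \<union>
     {frag_of (B, \<beta>) - frag_of (A, \<alpha>) - frag_of (C, \<gamma>) | A B C \<alpha> \<beta> \<gamma>.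
        (A, \<alpha>) \<in> Auts \<C> \<and> (B, \<beta>) \<in> Auts \<C> \<and> (C, \<gamma>) \<in> Auts \<C> \<and>
        (\<exists>i q. split_exact \<C> A B C i q \<and>
           Comp \<C> A B B \<beta> i = Comp \<C> A A B i \<alpha> \<and>
           Comp \<C> B B C q \<beta> = Comp \<C> B C C \<gamma> q)}"

definition K1_rel_subgroup :: "('o, 'f) add_cat \<Rightarrow> (('o \<times> 'f) \<Rightarrow>\<^sub>0 int) set" where
  "K1_rel_subgroup \<C> = generate (free_Abelian_group (Auts \<C>)) (K1_rels \<C>)"

definition K1 :: "('o, 'f) add_cat \<Rightarrow> (('o \<times> 'f) \<Rightarrow>\<^sub>0 int) set monoid" where
  "K1 \<C> = free_Abelian_group (Auts \<C>) Mod K1_rel_subgroup \<C>"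

definition K1_class :: "('o, 'f) add_cat \<Rightarrow> 'o \<Rightarrow> 'f \<Rightarrow> (('o \<times> 'f) \<Rightarrow>\<^sub>0 int) set" where
  "K1_class \<C> A \<alpha> = K1_rel_subgroup \<C> #>\<^bsub>free_Abelian_group (Auts \<C>)\<^esub> frag_of (A, \<alpha>)"

section \<open>The category $\mathcal{O}^G(\mathbb{R})$\<close>

text \<open>A group with its action on the line, and a \<open>G\<close>-space over the line.\<close>

record ('g, 'x) line_space =
  grp :: "'g monoid"
  act_line :: "'g \<Rightarrow> real \<Rightarrow> real"
  act_bar :: "'g \<Rightarrow> 'x \<Rightarrow> 'x"
  proj :: "'x \<Rightarrow> real"

definition O_objs ::
  "('r, 'k) ring_scheme \<Rightarrow> ('g, 'x::topological_space) line_space \<Rightarrow>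
    ('x \<times> real \<Rightarrow> ('r, 'm) module) set" where
  "O_objs R D = {A. geom_module R cone_top A \<and>
     inv_module (grp D) (act_cone (act_bar D)) cone_top A \<and>
     (\<exists>K. compact K \<and>
        mod_supp cone_top A \<subseteq> (\<Union>g\<in>carrier (grp D). act_bar D g ` K) \<times> {1..})}"

definition O_homs ::
  "('r, 'k) ring_scheme \<Rightarrow> ('g, 'x::topological_space) line_space \<Rightarrow>
    ('x \<times> real \<Rightarrow> ('r, 'm) module) \<Rightarrow> ('x \<times> real \<Rightarrow> ('r, 'm) module) \<Rightarrow>
    ('x \<times> real \<Rightarrow> 'x \<times> real \<Rightarrow> 'm \<Rightarrow> 'm) set" where
  "O_homs R D A B = {\<phi> \<in> geom_mor R cone_top A B.
     inv_mor (grp D) (act_cone (act_bar D)) cone_top \<phi> \<and>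
     (\<exists>E\<in>E_Gcc (grp D) (act_line D).
        \<forall>((x, t), (y, s))\<in>mor_supp cone_top A B \<phi>. ((proj D x, t), (proj D y, s)) \<in> E)}"

definition O_cat ::
  "('r, 'k) ring_scheme \<Rightarrow> ('g, 'x::topological_space) line_space \<Rightarrow>
    ('x \<times> real \<Rightarrow> ('r, 'm) module, 'x \<times> real \<Rightarrow> 'x \<times> real \<Rightarrow> 'm \<Rightarrow> 'm) add_cat" where
  "O_cat R D = \<lparr>Obj = O_objs R D, Hom = O_homs R D, Id = mor_id cone_top,
     Comp = mor_comp cone_top, Add = mor_add cone_top\<rparr>"

definition controlled ::
  "('g, 'x::topological_space) line_space \<Rightarrow> real \<Rightarrow>
    ('x \<times> real \<Rightarrow> ('r, 'm) module) \<Rightarrow> ('x \<times> real \<Rightarrow> ('r, 'm) module) \<Rightarrow>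
    ('x \<times> real \<Rightarrow> 'x \<times> real \<Rightarrow> 'm \<Rightarrow> 'm) \<Rightarrow> bool" where
  "controlled D \<epsilon> A B \<phi> \<longleftrightarrow>
     (\<forall>((x, t), (y, s))\<in>mor_supp cone_top A B \<phi>. \<bar>proj D x - proj D y\<bar> < \<epsilon>)"

definition eps_automorphism ::
  "('r, 'k) ring_scheme \<Rightarrow> ('g, 'x::topological_space) line_space \<Rightarrow> real \<Rightarrow>
    ('x \<times> real \<Rightarrow> ('r, 'm) module) \<Rightarrow> ('x \<times> real \<Rightarrow> 'x \<times> real \<Rightarrow> 'm \<Rightarrow> 'm) \<Rightarrow> bool" where
  "eps_automorphism R D \<epsilon> A \<alpha> \<longleftrightarrow>
     (\<exists>\<beta>. inverse_mors (O_cat R D) A \<alpha> \<beta> \<and> controlled D \<epsilon> A A \<alpha> \<and> controlled D \<epsilon> A A \<beta>)"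

section \<open>The two groups\<close>

definition cyclic_line :: "(int, real) line_space" where
  "cyclic_line = \<lparr>grp = integer_group, act_line = (\<lambda>n x. x + of_int n),
     act_bar = (\<lambda>n x. x + of_int n), proj = id\<rparr>"

text \<open>The pair \<open>(n, e)\<close> stands for the normal form \<open>r\<^sup>n s\<^sup>e\<close>, with \<open>True\<close> for \<open>e = 1\<close>. That this is
  the group presented by \<open>\<langle>r, s | s\<^sup>2 = 1, rs = sr\<^sup>-\<^sup>1\<rangle>\<close> is proved below.\<close>

definition dihedral_group :: "(int \<times> bool) monoid" where
  "dihedral_group = \<lparr>carrier = UNIV,
     monoid.mult = (\<lambda>(n, e) (m, f). (n + (if e then - m else m), e \<noteq> f)), one = (0, False)\<rparr>"

definition dih_r :: "int \<times> bool" where "dih_r = (1, False)"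
definition dih_s :: "int \<times> bool" where "dih_s = (0, True)"

definition dihedral_act :: "int \<times> bool \<Rightarrow> real \<Rightarrow> real" where
  "dihedral_act = (\<lambda>(n, e) x. of_int n + (if e then - x else x))"

text \<open>In \<open>\<int>/2 \<times> \<real>\<close> the factor \<open>\<int>/2\<close> is the discrete space \<^typ>\<open>bool\<close>; the element \<open>b\<close> is the coset
  of \<open>s\<^sup>b\<close> in $D_\infty/\langle r\rangle$, so \<open>r\<^sup>n s\<^sup>e\<close> acts on it by adding \<open>e\<close> mod 2.\<close>

definition dihedral_line :: "(int \<times> bool, bool \<times> real) line_space" where
  "dihedral_line = \<lparr>grp = dihedral_group, act_line = dihedral_act,
     act_bar = (\<lambda>g (b, x). (snd g \<noteq> b, dihedral_act g x)), proj = snd\<rparr>"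

lemma carrier_dihedral_group [simp]: "carrier dihedral_group = UNIV"
  by (simp add: dihedral_group_def)

lemma one_dihedral_group: "\<one>\<^bsub>dihedral_group\<^esub> = (0, False)"
  by (simp add: dihedral_group_def)

lemma mult_dihedral_group:
  "(n, e) \<otimes>\<^bsub>dihedral_group\<^esub> (m, f) = (n + (if e then - m else m), e \<noteq> f)"
  by (simp add: dihedral_group_def)

lemma group_dihedral_group: "group dihedral_group"
proof (rule groupI)
  fix x assume "x \<in> carrier dihedral_group"
  obtain n e where x: "x = (n, e)" by (cases x)
  have "(if e then n else - n, e) \<otimes>\<^bsub>dihedral_group\<^esub> x = \<one>\<^bsub>dihedral_group\<^esub>"
    by (auto simp: x dihedral_group_def)
  then show "\<exists>y\<in>carrier dihedral_group. y \<otimes>\<^bsub>dihedral_group\<^esub> x = \<one>\<^bsub>dihedral_group\<^esub>"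
    by auto
qed (auto simp: dihedral_group_def)

lemma dihedral_relations:
  "dih_s \<otimes>\<^bsub>dihedral_group\<^esub> dih_s = \<one>\<^bsub>dihedral_group\<^esub>"
  "dih_r \<otimes>\<^bsub>dihedral_group\<^esub> dih_s = dih_s \<otimes>\<^bsub>dihedral_group\<^esub> inv\<^bsub>dihedral_group\<^esub> dih_r"
proof -
  interpret group dihedral_group by (rule group_dihedral_group)
  show "dih_s \<otimes>\<^bsub>dihedral_group\<^esub> dih_s = \<one>\<^bsub>dihedral_group\<^esub>"
    by (simp add: dihedral_group_def dih_s_def)
  have "inv\<^bsub>dihedral_group\<^esub> dih_r = (-1, False)"
    by (rule inv_equality) (auto simp: dihedral_group_def dih_r_def)
  then show "dih_r \<otimes>\<^bsub>dihedral_group\<^esub> dih_s = dih_s \<otimes>\<^bsub>dihedral_group\<^esub> inv\<^bsub>dihedral_group\<^esub> dih_r"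
    by (simp add: dihedral_group_def dih_r_def dih_s_def)
qed

lemma dihedral_int_pow: "dih_r [^]\<^bsub>dihedral_group\<^esub> (n::int) = (n, False)"
proof -
  interpret group dihedral_group by (rule group_dihedral_group)
  have nat: "dih_r [^]\<^bsub>dihedral_group\<^esub> k = (int k, False)" for k :: nat
    by (induction k) (auto simp: dihedral_group_def dih_r_def nat_pow_def)
  have inv: "inv\<^bsub>dihedral_group\<^esub> (int k, False) = (- int k, False)" for k
    by (rule inv_equality) (auto simp: dihedral_group_def)
  show ?thesis
    by (cases n rule: int_cases2) (simp_all add: int_pow_int int_pow_neg nat inv)
qed

lemma dihedral_presentation:
  assumes "group H" and a: "a \<in> carrier H" and b: "b \<in> carrier H"
    and bb: "b \<otimes>\<^bsub>H\<^esub> b = \<one>\<^bsub>H\<^esub>" and ab: "a \<otimes>\<^bsub>H\<^esub> b = b \<otimes>\<^bsub>H\<^esub> inv\<^bsub>H\<^esub> a"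
  shows "\<exists>!h. h \<in> hom dihedral_group H \<and> h dih_r = a \<and> h dih_s = b"
proof -
  interpret H: group H by fact
  interpret D: group dihedral_group by (rule group_dihedral_group)
  define h where "h = (\<lambda>(n::int, e). a [^]\<^bsub>H\<^esub> n \<otimes>\<^bsub>H\<^esub> (if e then b else \<one>\<^bsub>H\<^esub>))"
  have ainv: "inv\<^bsub>H\<^esub> a = b \<otimes>\<^bsub>H\<^esub> a \<otimes>\<^bsub>H\<^esub> b"
    using a b ab bb by (metis H.inv_closed H.l_one H.m_assoc H.m_closed)
  have ba1: "b \<otimes>\<^bsub>H\<^esub> a = inv\<^bsub>H\<^esub> a \<otimes>\<^bsub>H\<^esub> b"
    using a b bb ainv by (metis H.m_assoc H.m_closed H.r_one)
  have ban: "b \<otimes>\<^bsub>H\<^esub> a [^]\<^bsub>H\<^esub> k = inv\<^bsub>H\<^esub> (a [^]\<^bsub>H\<^esub> k) \<otimes>\<^bsub>H\<^esub> b" for k :: nat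
  proof (induction k)
    case 0 then show ?case using b by simp
  next
    case (Suc k)
    have "b \<otimes>\<^bsub>H\<^esub> a [^]\<^bsub>H\<^esub> Suc k = inv\<^bsub>H\<^esub> (a [^]\<^bsub>H\<^esub> k) \<otimes>\<^bsub>H\<^esub> (b \<otimes>\<^bsub>H\<^esub> a)"
      using Suc a b by (simp flip: H.m_assoc)
    also have "\<dots> = inv\<^bsub>H\<^esub> (a \<otimes>\<^bsub>H\<^esub> a [^]\<^bsub>H\<^esub> k) \<otimes>\<^bsub>H\<^esub> b"
      using a b by (simp add: ba1 H.inv_mult_group H.m_assoc)
    also have "a \<otimes>\<^bsub>H\<^esub> a [^]\<^bsub>H\<^esub> k = a [^]\<^bsub>H\<^esub> Suc k"
      using a by (rule H.nat_pow_Suc2[symmetric])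
    finally show ?case .
  qed
  have ban': "b \<otimes>\<^bsub>H\<^esub> inv\<^bsub>H\<^esub> (a [^]\<^bsub>H\<^esub> k) = a [^]\<^bsub>H\<^esub> k \<otimes>\<^bsub>H\<^esub> b" for k :: nat
  proof -
    have "a [^]\<^bsub>H\<^esub> k \<otimes>\<^bsub>H\<^esub> b = a [^]\<^bsub>H\<^esub> k \<otimes>\<^bsub>H\<^esub> (b \<otimes>\<^bsub>H\<^esub> a [^]\<^bsub>H\<^esub> k) \<otimes>\<^bsub>H\<^esub> inv\<^bsub>H\<^esub> (a [^]\<^bsub>H\<^esub> k)"
      using a b by (simp add: H.m_assoc)
    also have "\<dots> = b \<otimes>\<^bsub>H\<^esub> inv\<^bsub>H\<^esub> (a [^]\<^bsub>H\<^esub> k)"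
      using a b by (simp add: ban flip: H.m_assoc)
    finally show ?thesis by simp
  qed
  have bam: "b \<otimes>\<^bsub>H\<^esub> a [^]\<^bsub>H\<^esub> m = a [^]\<^bsub>H\<^esub> (- m) \<otimes>\<^bsub>H\<^esub> b" for m :: int
    using a b by (cases m rule: int_cases2) (simp_all add: int_pow_int H.int_pow_neg ban ban')
  have hom: "h \<in> hom dihedral_group H"
  proof (rule homI)
    fix x y :: "int \<times> bool"
    obtain n e m f where x: "x = (n, e)" and y: "y = (m, f)" by (cases x, cases y)
    have ret: "a [^]\<^bsub>H\<^esub> n \<otimes>\<^bsub>H\<^esub> b \<otimes>\<^bsub>H\<^esub> (a [^]\<^bsub>H\<^esub> m \<otimes>\<^bsub>H\<^esub> c) = a [^]\<^bsub>H\<^esub> (n - m) \<otimes>\<^bsub>H\<^esub> (b \<otimes>\<^bsub>H\<^esub> c)"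
      if c: "c \<in> carrier H" for c
    proof -
      have "a [^]\<^bsub>H\<^esub> n \<otimes>\<^bsub>H\<^esub> b \<otimes>\<^bsub>H\<^esub> (a [^]\<^bsub>H\<^esub> m \<otimes>\<^bsub>H\<^esub> c) = a [^]\<^bsub>H\<^esub> n \<otimes>\<^bsub>H\<^esub> (b \<otimes>\<^bsub>H\<^esub> a [^]\<^bsub>H\<^esub> m) \<otimes>\<^bsub>H\<^esub> c"
        using a b c by (simp add: H.m_assoc)
      also have "\<dots> = (a [^]\<^bsub>H\<^esub> n \<otimes>\<^bsub>H\<^esub> a [^]\<^bsub>H\<^esub> (- m)) \<otimes>\<^bsub>H\<^esub> (b \<otimes>\<^bsub>H\<^esub> c)"
        unfolding bam using a b c by (simp add: H.m_assoc)
      also have "a [^]\<^bsub>H\<^esub> n \<otimes>\<^bsub>H\<^esub> a [^]\<^bsub>H\<^esub> (- m) = a [^]\<^bsub>H\<^esub> (n - m)"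
        using a H.int_pow_mult[of a n "- m"] by simp
      finally show ?thesis .
    qed
    show "h (x \<otimes>\<^bsub>dihedral_group\<^esub> y) = h x \<otimes>\<^bsub>H\<^esub> h y"
      using a b bb ret[of b] ret[of "\<one>\<^bsub>H\<^esub>"]
      by (cases e; cases f) (simp_all add: x y h_def dihedral_group_def H.int_pow_mult H.m_assoc)
  qed (use a b in \<open>auto simp: h_def\<close>)
  have uniq: "k = h" if k: "k \<in> hom dihedral_group H" "k dih_r = a" "k dih_s = b" for k
  proof
    fix x :: "int \<times> bool"
    interpret k: group_hom dihedral_group H k
      using k(1) by unfold_locales
    obtain n e where x: "x = (n, e)" by (cases x)
    have kn: "k (n, False) = a [^]\<^bsub>H\<^esub> n"
      using k.hom_int_pow[of dih_r n] k(2) by (simp add: dihedral_int_pow)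
    have "k (n, True) = k ((n, False) \<otimes>\<^bsub>dihedral_group\<^esub> dih_s)"
      by (simp add: dihedral_group_def dih_s_def)
    also have "\<dots> = a [^]\<^bsub>H\<^esub> n \<otimes>\<^bsub>H\<^esub> b"
      using k.hom_mult[of "(n, False)" dih_s] k(3) kn by simp
    finally show "k x = h x"
      using kn a by (cases e) (simp_all add: x h_def)
  qed
  show ?thesis
  proof (rule ex1I)
    show "h \<in> hom dihedral_group H \<and> h dih_r = a \<and> h dih_s = b"
      using hom a b H.int_pow_1 by (simp add: h_def dih_r_def dih_s_def)
  qed (use uniq in blast)
qed

lemma group_action_UNIV_I:
  assumes "group G"
    and one: "\<And>x. act \<one>\<^bsub>G\<^esub> x = x"
    and mult: "\<And>g h x. g \<in> carrier G \<Longrightarrow> h \<in> carrier G \<Longrightarrow> act (g \<otimes>\<^bsub>G\<^esub> h) x = act g (act h x)"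
  shows "group_action G UNIV act"
proof -
  interpret group G by fact
  have bij: "act g \<in> Bij UNIV" if g: "g \<in> carrier G" for g
  proof -
    have "act g (act (inv\<^bsub>G\<^esub> g) x) = x" "act (inv\<^bsub>G\<^esub> g) (act g x) = x" for x
      using mult[of g "inv\<^bsub>G\<^esub> g" x] mult[of "inv\<^bsub>G\<^esub> g" g x] g one by simp_all
    then have "bij (act g)"
      by (intro o_bij[of "act (inv\<^bsub>G\<^esub> g)"]) auto
    then show ?thesis by (simp add: Bij_def)
  qed
  have "act \<in> hom G (BijGroup UNIV)"
    by (rule homI) (auto simp: BijGroup_def bij mult compose_def)
  then show ?thesis
    by (intro group_action.intro group_hom.intro group_hom_axioms.intro \<open>group G\<close> group_BijGroup)
qed

lemma cyclic_line_actions: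
  "group_action (grp cyclic_line) UNIV (act_line cyclic_line)"
  "group_action (grp cyclic_line) UNIV (act_bar cyclic_line)"
  by (rule group_action_UNIV_I; simp add: cyclic_line_def)+

lemma dihedral_line_actions:
  "group_action (grp dihedral_line) UNIV (act_line dihedral_line)"
  "group_action (grp dihedral_line) UNIV (act_bar dihedral_line)"
  by (rule group_action_UNIV_I; force simp: dihedral_line_def group_dihedral_group
        one_dihedral_group mult_dihedral_group dihedral_act_def)+

lemma dihedral_line_free:
  "act_bar dihedral_line g x = x \<Longrightarrow> g = \<one>\<^bsub>grp dihedral_line\<^esub>"
  by (cases g; cases x)
     (auto simp: dihedral_line_def dihedral_group_def dihedral_act_def split: if_splits)

lemma dihedral_line_equivariant:
  "proj dihedral_line (act_bar dihedral_line g x) = act_line dihedral_line g (proj dihedral_line x)"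
  by (simp add: dihedral_line_def split: prod.split)

end

theory Submission
  imports Defs
begin

text \<open>
  Morphisms act as operators on finitely supported sections, so that automorphisms are bijections and
  no matrix calculus is needed. The object \<open>A\<close> is stabilised by copies that are pushed up the cone
  and contracted towards the centres of the cells of the line; along such copies an automorphism
  that does not leave the cells is killed by an Eilenberg swindle. There are two families of cells,
  those bounded by \<open>\<int> + 1/2\<close> and those bounded by \<open>\<int>\<close>, and the theorem follows once the stabilised
  \<open>\<alpha>\<close> is a product of an automorphism respecting the first and one respecting the second. The first
  factor \<open>u\<close> is \<open>diag (\<alpha>, \<alpha>\<^sup>-\<^sup>1, \<alpha>, \<dots>) \<circ> diag (1, \<alpha>, \<alpha>\<^sup>-\<^sup>1, \<dots>)\<close> truncated to the points within \<open>3/10\<close>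
  of an integer. The truncation costs nothing in invertibility because \<open>diag (\<alpha>, \<alpha>\<^sup>-\<^sup>1)\<close> is the
  commutator of \<open>diag (\<alpha>, 1)\<close> with a swap, and the swap can be restricted to a region. As \<open>u\<close> moves
  points by at most \<open>4/30\<close> and is the identity at distance more than \<open>1/3\<close> from the integers, it does not
  cross \<open>\<int> + 1/2\<close>; within \<open>1/5\<close> of the integers it equals \<open>\<alpha>\<close>, so \<open>u\<^sup>-\<^sup>1\<alpha>\<close>, which moves points by at
  most \<open>5/30\<close>, does not cross \<open>\<int>\<close>.
\<close>

section \<open>Finitely supported sections and local operators\<close>

text \<open>The obstacle is control at infinity. An operator repeated along copies of
  \<open>A\<close> is a morphism only if its displacement over the line tends to 0 as the copies go
  up, so the copies must be contracted; but a contraction tears points apart across the boundary of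
  a cell, and \<alpha> may cross it. Hence the copies carry two indices: along the inner ones
  \<alpha> is split, along the outer ones the two factors are killed. Along the inner copies a
  single \<open>diag\<close> of \<alpha> need not be a morphism; only the truncated product is. So
  operators are first recorded with a mere relation bounding how they spread, and control enters
  when the product is known to be trivial over the boundary. The swindle is a product of two
  commutators, so no infinite sum is formed: it is enough that K1 is abelian. For control \<epsilon>
  the cutoffs cost 5 \<epsilon> + 3 \<epsilon> + \<epsilon> + 4 \<epsilon>: the displacement of the
  second factor, the room for the three diagonal factors that a swap follows, the margin around the
  swap region, the displacement of the first factor. The sum must stay below 1/2, as 13/30
  does.\<close>

type_synonym ('i, 'm) operator = "('i \<Rightarrow> 'm) \<Rightarrow> 'i \<Rightarrow> 'm"

definition sec :: "('i \<Rightarrow> ('r, 'm) module) \<Rightarrow> ('i \<Rightarrow> 'm) set" where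
  "sec N = {s. (\<forall>i. s i \<in> carrier (N i)) \<and> finite {i. s i \<noteq> \<zero>\<^bsub>N i\<^esub>}}"

definition supp :: "('i \<Rightarrow> ('r, 'm) module) \<Rightarrow> ('i \<Rightarrow> 'm) \<Rightarrow> 'i set" where
  "supp N s = {i. s i \<noteq> \<zero>\<^bsub>N i\<^esub>}"

definition sadd :: "('i \<Rightarrow> ('r, 'm) module) \<Rightarrow> ('i \<Rightarrow> 'm) \<Rightarrow> ('i \<Rightarrow> 'm) \<Rightarrow> 'i \<Rightarrow> 'm" where
  "sadd N s t = (\<lambda>i. s i \<oplus>\<^bsub>N i\<^esub> t i)"

definition smul :: "('i \<Rightarrow> ('r, 'm) module) \<Rightarrow> 'r \<Rightarrow> ('i \<Rightarrow> 'm) \<Rightarrow> 'i \<Rightarrow> 'm" where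
  "smul N a s = (\<lambda>i. a \<odot>\<^bsub>N i\<^esub> s i)"

definition restr :: "('i \<Rightarrow> ('r, 'm) module) \<Rightarrow> 'i set \<Rightarrow> ('i \<Rightarrow> 'm) \<Rightarrow> 'i \<Rightarrow> 'm" where
  "restr N Z s = (\<lambda>i. if i \<in> Z then s i else \<zero>\<^bsub>N i\<^esub>)"

definition modfam :: "('r, 'k) ring_scheme \<Rightarrow> ('i \<Rightarrow> ('r, 'm) module) \<Rightarrow> bool" where
  "modfam R N \<longleftrightarrow> (\<forall>i. left_module R (N i))"

definition linop :: "('r, 'k) ring_scheme \<Rightarrow> ('i \<Rightarrow> ('r, 'm) module) \<Rightarrow> ('i, 'm) operator \<Rightarrow> bool" where
  "linop R N T \<longleftrightarrow> T \<in> sec N \<rightarrow> sec N \<and>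
     (\<forall>s\<in>sec N. \<forall>t\<in>sec N. T (sadd N s t) = sadd N (T s) (T t)) \<and>
     (\<forall>a\<in>carrier R. \<forall>s\<in>sec N. T (smul N a s) = smul N a (T s))"

text \<open>\<open>E\<close> is an upper bound for the support of the matrix of \<open>T\<close>,
  not the support itself; composing operators then merely composes relations, with no entries to
  compute.\<close>

definition loc :: "('i \<Rightarrow> ('r, 'm) module) \<Rightarrow> ('i, 'm) operator \<Rightarrow> ('i \<times> 'i) set \<Rightarrow> bool" where
  "loc N T E \<longleftrightarrow> (\<forall>s\<in>sec N. supp N (T s) \<subseteq> E `` supp N s)"

definition invfam :: "('i \<Rightarrow> ('r, 'm) module) \<Rightarrow> ('i \<Rightarrow> 'i) set \<Rightarrow> bool" where
  "invfam N H \<longleftrightarrow> (\<forall>\<rho>\<in>H. bij \<rho> \<and> (\<forall>i. N (\<rho> i) = N i))"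

definition eqv :: "('i \<Rightarrow> ('r, 'm) module) \<Rightarrow> ('i \<Rightarrow> 'i) set \<Rightarrow> ('i, 'm) operator \<Rightarrow> bool" where
  "eqv N H T \<longleftrightarrow> (\<forall>\<rho>\<in>H. \<forall>s\<in>sec N. T (s \<circ> \<rho>) = T s \<circ> \<rho>)"

definition local_op :: "('r, 'k) ring_scheme \<Rightarrow> ('i \<Rightarrow> ('r, 'm) module) \<Rightarrow> ('i \<Rightarrow> 'i) set \<Rightarrow>
    ('i, 'm) operator \<Rightarrow> ('i \<times> 'i) set \<Rightarrow> bool" where
  "local_op R N H T E \<longleftrightarrow> linop R N T \<and> eqv N H T \<and> loc N T E"

text \<open>Identities between operators are demanded on \<open>sec N\<close> only; elsewhere an
  operator is an arbitrary function.\<close>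

definition inverse_ops :: "('i \<Rightarrow> ('r, 'm) module) \<Rightarrow> ('i, 'm) operator \<Rightarrow> ('i, 'm) operator \<Rightarrow> bool" where
  "inverse_ops N T T' \<longleftrightarrow> (\<forall>s\<in>sec N. T (T' s) = s \<and> T' (T s) = s)"

lemma sec_carrier: "s \<in> sec N \<Longrightarrow> s i \<in> carrier (N i)"
  by (auto simp: sec_def)

lemma finite_supp: "s \<in> sec N \<Longrightarrow> finite (supp N s)"
  by (auto simp: sec_def supp_def)

lemma secI: "(\<And>i. s i \<in> carrier (N i)) \<Longrightarrow> finite F \<Longrightarrow> supp N s \<subseteq> F \<Longrightarrow> s \<in> sec N"
  by (auto simp: sec_def supp_def intro: finite_subset)

lemma modfamD: "modfam R N \<Longrightarrow> left_module R (N i)"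
  by (auto simp: modfam_def)

lemma left_moduleD:
  assumes "left_module R M"
  shows "ring R" "abelian_group M"
  using assms by (auto simp: left_module_def)

lemma (in left_module) smult_zero: "a \<in> carrier R \<Longrightarrow> a \<odot>\<^bsub>M\<^esub> \<zero>\<^bsub>M\<^esub> = \<zero>\<^bsub>M\<^esub>"
proof -
  assume a: "a \<in> carrier R"
  have "a \<odot>\<^bsub>M\<^esub> \<zero>\<^bsub>M\<^esub> \<oplus>\<^bsub>M\<^esub> a \<odot>\<^bsub>M\<^esub> \<zero>\<^bsub>M\<^esub> = a \<odot>\<^bsub>M\<^esub> \<zero>\<^bsub>M\<^esub>"
    using smult_r_distr[OF a, of "\<zero>\<^bsub>M\<^esub>" "\<zero>\<^bsub>M\<^esub>"] by simp
  then show ?thesis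
    using smult_closed[OF a, of "\<zero>\<^bsub>M\<^esub>"] by (metis M.add.r_cancel_one M.zero_closed)
qed

lemma modfam_abelian_group: "modfam R N \<Longrightarrow> abelian_group (N i)"
  by (meson modfamD left_moduleD)

lemma modfam_ops [simp]:
  assumes "modfam R N"
  shows "\<zero>\<^bsub>N i\<^esub> \<in> carrier (N i)"
    and "v \<in> carrier (N i) \<Longrightarrow> w \<in> carrier (N i) \<Longrightarrow> v \<oplus>\<^bsub>N i\<^esub> w \<in> carrier (N i)"
    and "v \<in> carrier (N i) \<Longrightarrow> v \<oplus>\<^bsub>N i\<^esub> \<zero>\<^bsub>N i\<^esub> = v"
    and "v \<in> carrier (N i) \<Longrightarrow> \<zero>\<^bsub>N i\<^esub> \<oplus>\<^bsub>N i\<^esub> v = v"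
    and "a \<in> carrier R \<Longrightarrow> v \<in> carrier (N i) \<Longrightarrow> a \<odot>\<^bsub>N i\<^esub> v \<in> carrier (N i)"
    and "a \<in> carrier R \<Longrightarrow> a \<odot>\<^bsub>N i\<^esub> \<zero>\<^bsub>N i\<^esub> = \<zero>\<^bsub>N i\<^esub>"
proof -
  interpret L: left_module R "N i" using assms by (rule modfamD)
  show "\<zero>\<^bsub>N i\<^esub> \<in> carrier (N i)"
    and "v \<in> carrier (N i) \<Longrightarrow> w \<in> carrier (N i) \<Longrightarrow> v \<oplus>\<^bsub>N i\<^esub> w \<in> carrier (N i)"
    and "v \<in> carrier (N i) \<Longrightarrow> v \<oplus>\<^bsub>N i\<^esub> \<zero>\<^bsub>N i\<^esub> = v"
    and "v \<in> carrier (N i) \<Longrightarrow> \<zero>\<^bsub>N i\<^esub> \<oplus>\<^bsub>N i\<^esub> v = v"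
    and "a \<in> carrier R \<Longrightarrow> v \<in> carrier (N i) \<Longrightarrow> a \<odot>\<^bsub>N i\<^esub> v \<in> carrier (N i)"
    and "a \<in> carrier R \<Longrightarrow> a \<odot>\<^bsub>N i\<^esub> \<zero>\<^bsub>N i\<^esub> = \<zero>\<^bsub>N i\<^esub>"
    by (simp_all add: L.smult_closed L.smult_zero)
qed

lemma sec_zero: "modfam R N \<Longrightarrow> (\<lambda>i. \<zero>\<^bsub>N i\<^esub>) \<in> sec N"
  by (auto simp: sec_def)

lemma sec_sadd: "modfam R N \<Longrightarrow> s \<in> sec N \<Longrightarrow> t \<in> sec N \<Longrightarrow> sadd N s t \<in> sec N"
  by (rule secI[of _ _ "supp N s \<union> supp N t"])
     (auto simp: sadd_def supp_def sec_carrier finite_supp[unfolded supp_def])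

lemma sec_smul: "modfam R N \<Longrightarrow> a \<in> carrier R \<Longrightarrow> s \<in> sec N \<Longrightarrow> smul N a s \<in> sec N"
  by (rule secI[of _ _ "supp N s"])
     (auto simp: smul_def supp_def sec_carrier finite_supp[unfolded supp_def])

lemma sec_restr: "modfam R N \<Longrightarrow> s \<in> sec N \<Longrightarrow> restr N Z s \<in> sec N"
  by (rule secI[of _ _ "supp N s"])
     (auto simp: restr_def supp_def sec_carrier finite_supp[unfolded supp_def])

lemma supp_restr: "supp N (restr N Z s) = Z \<inter> supp N s"
  by (auto simp: supp_def restr_def)

lemma restr_id: "supp N s \<subseteq> Z \<Longrightarrow> restr N Z s = s"
  by (auto simp: supp_def restr_def fun_eq_iff subset_iff; metis)

lemma restr_cong: "(\<And>i. i \<in> Z \<Longrightarrow> s i = t i) \<Longrightarrow> restr N Z s = restr N Z t"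
  by (auto simp: restr_def fun_eq_iff)

lemma sadd_restr:
  assumes "modfam R N" "s \<in> sec N" "Z \<inter> Z' = {}"
  shows "sadd N (restr N Z s) (restr N Z' s) = restr N (Z \<union> Z') s"
  using assms by (auto simp: sadd_def restr_def fun_eq_iff sec_carrier)

lemma sec_comp: "invfam N H \<Longrightarrow> \<rho> \<in> H \<Longrightarrow> s \<in> sec N \<Longrightarrow> s \<circ> \<rho> \<in> sec N"
proof (rule secI[of _ _ "\<rho> -` supp N s"])
  assume *: "invfam N H" "\<rho> \<in> H" "s \<in> sec N"
  then have N: "N (\<rho> i) = N i" and b: "bij \<rho>" for i by (auto simp: invfam_def)
  show "(s \<circ> \<rho>) i \<in> carrier (N i)" for i using sec_carrier[OF *(3), of "\<rho> i"] N by simp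
  show "finite (\<rho> -` supp N s)"
    using b finite_supp[OF *(3)] by (intro finite_vimageI) (auto simp: bij_def)
  show "supp N (s \<circ> \<rho>) \<subseteq> \<rho> -` supp N s" by (auto simp: supp_def N)
qed

lemma linopD:
  assumes "linop R N T"
  shows "s \<in> sec N \<Longrightarrow> T s \<in> sec N"
    and "s \<in> sec N \<Longrightarrow> t \<in> sec N \<Longrightarrow> T (sadd N s t) = sadd N (T s) (T t)"
    and "a \<in> carrier R \<Longrightarrow> s \<in> sec N \<Longrightarrow> T (smul N a s) = smul N a (T s)"
  using assms by (auto simp: linop_def)

lemma linop_zero:
  assumes "modfam R N" "linop R N T"
  shows "T (\<lambda>i. \<zero>\<^bsub>N i\<^esub>) = (\<lambda>i. \<zero>\<^bsub>N i\<^esub>)"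
proof
  fix i
  let ?z = "\<lambda>i. \<zero>\<^bsub>N i\<^esub>"
  interpret abelian_group "N i" using assms(1) by (rule modfam_abelian_group)
  have "sadd N ?z ?z = ?z" by (auto simp: sadd_def modfam_ops[OF assms(1)])
  then have "T ?z i = T ?z i \<oplus>\<^bsub>N i\<^esub> T ?z i"
    using linopD(2)[OF assms(2) sec_zero sec_zero, OF assms(1) assms(1)]
    by (metis sadd_def)
  then show "T ?z i = \<zero>\<^bsub>N i\<^esub>"
    using linopD(1)[OF assms(2) sec_zero[OF assms(1)], THEN sec_carrier, of i]
    by (metis add.r_cancel_one zero_closed)
qed

lemma linop_comp: "linop R N T \<Longrightarrow> linop R N S \<Longrightarrow> linop R N (\<lambda>s. S (T s))"
  by (auto simp: linop_def Pi_iff)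

lemma loc_comp: "linop R N T \<Longrightarrow> loc N T E \<Longrightarrow> loc N S E' \<Longrightarrow> loc N (\<lambda>s. S (T s)) (E O E')"
  unfolding loc_def using linopD(1)[of R N T] by (fastforce simp: relcomp_unfold Image_def)

lemma local_opD:
  assumes "local_op R N H T E"
  shows "linop R N T" "eqv N H T" "loc N T E"
  using assms by (auto simp: local_op_def)

lemma local_op_sec: "local_op R N H T E \<Longrightarrow> s \<in> sec N \<Longrightarrow> T s \<in> sec N"
  by (auto simp: local_op_def linop_def)

lemma local_op_supp: "local_op R N H T E \<Longrightarrow> s \<in> sec N \<Longrightarrow> supp N (T s) \<subseteq> E `` supp N s"
  by (auto simp: local_op_def loc_def)

lemma local_op_comp:
  "local_op R N H T E \<Longrightarrow> local_op R N H S E' \<Longrightarrow> local_op R N H (\<lambda>s. S (T s)) (E O E')"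
  unfolding local_op_def using linop_comp[of R N T S] loc_comp[of R N T E S E']
  by (auto simp: eqv_def linopD(1))

lemma local_op_mono: "local_op R N H T E \<Longrightarrow> E \<subseteq> E' \<Longrightarrow> local_op R N H T E'"
  unfolding local_op_def loc_def by blast

lemma local_op_id: "local_op R N H (\<lambda>s. s) Relation.Id"
  by (auto simp: local_op_def linop_def eqv_def loc_def)

text \<open>A section splits into its parts over \<open>Z\<close> and off \<open>Z\<close>; the
  first stays in place and only the second spreads along \<open>E\<close>. This sharpens the crude
  bound of a long product that is known to be the identity over \<open>Z\<close>.\<close>

lemma local_op_fix:
  assumes N: "modfam R N" and T: "local_op R N H T E"
    and fx: "\<And>s. s \<in> sec N \<Longrightarrow> supp N s \<subseteq> Z \<Longrightarrow> T s = s"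
  shows "local_op R N H T {(i, j). i = j \<or> i \<notin> Z \<and> (i, j) \<in> E}"
proof -
  have "j \<in> {(i, j). i = j \<or> i \<notin> Z \<and> (i, j) \<in> E} `` supp N s"
    if s: "s \<in> sec N" and j: "j \<in> supp N (T s)" for s j
  proof -
    let ?a = "restr N Z s" and ?b = "restr N (-Z) s"
    have ab: "?a \<in> sec N" "?b \<in> sec N" using N s by (auto intro: sec_restr)
    have "s = sadd N ?a ?b"
      using sadd_restr[OF N s, of Z "-Z"] by (simp add: restr_id)
    then have "T s = sadd N (T ?a) (T ?b)"
      using linopD(2)[OF local_opD(1)[OF T] ab] by simp
    also have "T ?a = ?a" using ab by (auto intro: fx simp: supp_restr)
    finally have *: "T s j = ?a j \<oplus>\<^bsub>N j\<^esub> T ?b j" by (simp add: sadd_def)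
    have "j \<in> supp N ?a \<or> j \<in> supp N (T ?b)"
      using j N by (auto simp: supp_def *)
    then show ?thesis
      using local_op_supp[OF T ab(2)] by (auto simp: supp_restr)
  qed
  then have "loc N T {(i, j). i = j \<or> i \<notin> Z \<and> (i, j) \<in> E}"
    unfolding loc_def by blast
  then show ?thesis using T by (simp add: local_op_def)
qed

lemma local_op_restrict:
  assumes T: "local_op R N H T E" and I: "\<And>s. s \<in> sec N \<Longrightarrow> supp N s \<subseteq> I"
  shows "local_op R N H T (E \<inter> I \<times> I)"
proof -
  have "supp N (T s) \<subseteq> (E \<inter> I \<times> I) `` supp N s" if s: "s \<in> sec N" for s
    using local_op_supp[OF T s] I[OF s] I[OF local_op_sec[OF T s]] by fast
  then show ?thesis using T by (auto simp: local_op_def loc_def)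
qed

lemma inverse_ops_sym: "inverse_ops N T T' \<Longrightarrow> inverse_ops N T' T"
  by (auto simp: inverse_ops_def)

lemma inverse_ops_comp:
  assumes "linop R N S" "linop R N T'" "inverse_ops N T T'" "inverse_ops N S S'"
  shows "inverse_ops N (\<lambda>s. T (S s)) (\<lambda>s. S' (T' s))"
  using assms by (auto simp: inverse_ops_def linopD(1))

section \<open>Operators on copies\<close>

definition liftN :: "('i \<Rightarrow> ('r, 'm) module) \<Rightarrow> 'k \<times> 'i \<Rightarrow> ('r, 'm) module" where
  "liftN N p = N (snd p)"

definition liftH :: "('i \<Rightarrow> 'i) set \<Rightarrow> ('k \<times> 'i \<Rightarrow> 'k \<times> 'i) set" where
  "liftH H = map_prod id ` H"

definition diag :: "'k set \<Rightarrow> ('i, 'm) operator \<Rightarrow> ('k \<times> 'i \<Rightarrow> 'm) \<Rightarrow> 'k \<times> 'i \<Rightarrow> 'm" where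
  "diag S \<theta> s = (\<lambda>(k, i). if k \<in> S then \<theta> (\<lambda>i. s (k, i)) i else s (k, i))"

definition swap_on :: "('k \<Rightarrow> 'k) \<Rightarrow> 'i set \<Rightarrow> ('k \<times> 'i \<Rightarrow> 'm) \<Rightarrow> 'k \<times> 'i \<Rightarrow> 'm" where
  "swap_on \<sigma> F s = (\<lambda>(k, i). if i \<in> F then s (\<sigma> k, i) else s (k, i))"

lemma liftN_pair [simp]: "liftN N (k, i) = N i"
  by (simp add: liftN_def)

lemma modfam_liftN: "modfam R N \<Longrightarrow> modfam R (liftN N)"
  by (simp add: modfam_def liftN_def)

lemma sec_slice: "s \<in> sec (liftN N) \<Longrightarrow> (\<lambda>i. s (k, i)) \<in> sec N"
proof (rule secI[of _ _ "snd ` supp (liftN N) s"])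
  assume s: "s \<in> sec (liftN N)"
  show "s (k, i) \<in> carrier (N i)" for i using sec_carrier[OF s, of "(k, i)"] by simp
  show "finite (snd ` supp (liftN N) s)" using finite_supp[OF s] by simp
  show "supp N (\<lambda>i. s (k, i)) \<subseteq> snd ` supp (liftN N) s"
  proof
    fix i assume "i \<in> supp N (\<lambda>i. s (k, i))"
    then have "(k, i) \<in> supp (liftN N) s" by (simp add: supp_def)
    then show "i \<in> snd ` supp (liftN N) s" by force
  qed
qed

lemma sec_liftNI:
  assumes "\<And>k. (\<lambda>i. s (k, i)) \<in> sec N" "finite K" "\<And>k i. k \<notin> K \<Longrightarrow> s (k, i) = \<zero>\<^bsub>N i\<^esub>"
  shows "s \<in> sec (liftN N)"
proof (rule secI[of _ _ "Sigma K (\<lambda>k. supp N (\<lambda>i. s (k, i)))"])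
  show "s p \<in> carrier (liftN N p)" for p
    using sec_carrier[OF assms(1)[of "fst p"], of "snd p"] by (simp add: liftN_def)
  show "finite (SIGMA k:K. supp N (\<lambda>i. s (k, i)))"
    using assms by (intro finite_SigmaI) (auto simp: finite_supp)
  show "supp (liftN N) s \<subseteq> (SIGMA k:K. supp N (\<lambda>i. s (k, i)))"
    using assms(3) by (auto simp: supp_def) blast
qed

lemma not_fst_supp: "k \<notin> fst ` supp (liftN N) s \<Longrightarrow> s (k, i) = \<zero>\<^bsub>N i\<^esub>"
proof (rule ccontr)
  assume "k \<notin> fst ` supp (liftN N) s" "s (k, i) \<noteq> \<zero>\<^bsub>N i\<^esub>"
  then have "(k, i) \<in> supp (liftN N) s" by (simp add: supp_def)
  then have "fst (k, i) \<in> fst ` supp (liftN N) s" by (rule imageI)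
  then show False using \<open>k \<notin> _\<close> by simp
qed

lemma diag_slice: "(\<lambda>i. diag S \<theta> s (k, i)) = (if k \<in> S then \<theta> (\<lambda>i. s (k, i)) else (\<lambda>i. s (k, i)))"
  by (auto simp: diag_def)

text \<open>\<open>S\<close> may be infinite: a section meets finitely many copies, and on the
  others \<theta> is applied to the zero section.\<close>

lemma sec_diag:
  assumes N: "modfam R N" and \<theta>: "linop R N \<theta>" and s: "s \<in> sec (liftN N)"
  shows "diag S \<theta> s \<in> sec (liftN N)"
proof (rule sec_liftNI[of _ _ "fst ` supp (liftN N) s"])
  show "(\<lambda>i. diag S \<theta> s (k, i)) \<in> sec N" for k
    using sec_slice[OF s] linopD(1)[OF \<theta>] by (simp add: diag_slice)
  show "finite (fst ` supp (liftN N) s)" using finite_supp[OF s] by simp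
  fix k i assume "k \<notin> fst ` supp (liftN N) s"
  then have *: "s (k, i) = \<zero>\<^bsub>N i\<^esub>" for i by (rule not_fst_supp)
  then show "diag S \<theta> s (k, i) = \<zero>\<^bsub>N i\<^esub>"
    using linop_zero[OF N \<theta>] by (simp add: diag_def)
qed

lemma local_op_diag:
  fixes N :: "'i \<Rightarrow> ('r, 'm) module" and S :: "'j set"
  assumes N: "modfam R N" and \<theta>: "local_op R N H \<theta> E"
  shows "local_op R (liftN N) (liftH H) (diag S \<theta>) {((k, i), (k', j)). k' = k \<and> (k \<in> S \<and> (i, j) \<in> E \<or> i = j)}"
    (is "local_op _ _ _ _ ?E")
  unfolding local_op_def
proof (intro conjI)
  note lin = local_opD(1)[OF \<theta>]
  show "linop R (liftN N) (diag S \<theta>)"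
    unfolding linop_def
  proof (intro conjI ballI Pi_I)
    fix s t assume s: "s \<in> sec (liftN N :: 'j \<times> 'i \<Rightarrow> ('r, 'm) module)" and t: "t \<in> sec (liftN N :: 'j \<times> 'i \<Rightarrow> ('r, 'm) module)"
    have "\<theta> (\<lambda>i. sadd (liftN N) s t (k, i)) = sadd N (\<theta> (\<lambda>i. s (k, i))) (\<theta> (\<lambda>i. t (k, i)))" for k
      using linopD(2)[OF lin sec_slice[OF s, of k] sec_slice[OF t, of k]] by (simp add: sadd_def)
    then show "diag S \<theta> (sadd (liftN N) s t) = sadd (liftN N) (diag S \<theta> s) (diag S \<theta> t)"
      by (auto simp: diag_def fun_eq_iff sadd_def)
  next
    fix a s assume s: "s \<in> sec (liftN N :: 'j \<times> 'i \<Rightarrow> ('r, 'm) module)" and a: "a \<in> carrier R"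
    have "\<theta> (\<lambda>i. smul (liftN N) a s (k, i)) = smul N a (\<theta> (\<lambda>i. s (k, i)))" for k
      using linopD(3)[OF lin a sec_slice[OF s, of k]] by (simp add: smul_def)
    then show "diag S \<theta> (smul (liftN N) a s) = smul (liftN N) a (diag S \<theta> s)"
      by (auto simp: diag_def fun_eq_iff smul_def)
  qed (use sec_diag[OF N lin] in auto)
  show "eqv (liftN N) (liftH H) (diag S \<theta>)"
    unfolding eqv_def liftH_def
  proof (intro ballI, elim imageE, hypsubst)
    fix s \<rho> assume s: "s \<in> sec (liftN N :: 'j \<times> 'i \<Rightarrow> ('r, 'm) module)" and \<rho>: "\<rho> \<in> H"
    have "\<theta> (\<lambda>i. s (k, \<rho> i)) = (\<lambda>i. \<theta> (\<lambda>i. s (k, i)) (\<rho> i))" for k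
      using local_opD(2)[OF \<theta>] \<rho> sec_slice[OF s, of k] by (auto simp: eqv_def o_def)
    then show "diag S \<theta> (s \<circ> map_prod id \<rho>) = diag S \<theta> s \<circ> map_prod id \<rho>"
      by (auto simp: diag_def fun_eq_iff)
  qed
  show "loc (liftN N) (diag S \<theta>) ?E"
    unfolding loc_def
  proof (intro ballI subsetI, clarify)
    fix s and k :: 'j and j
    assume s: "s \<in> sec (liftN N :: 'j \<times> 'i \<Rightarrow> ('r, 'm) module)" and *: "(k, j) \<in> supp (liftN N) (diag S \<theta> s)"
    show "(k, j) \<in> ?E `` supp (liftN N) s"
    proof (cases "k \<in> S")
      case True
      then have "j \<in> supp N (\<theta> (\<lambda>i. s (k, i)))" using * by (simp add: supp_def diag_def)
      then obtain i where "(i, j) \<in> E" "i \<in> supp N (\<lambda>i. s (k, i))"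
        using local_op_supp[OF \<theta> sec_slice[OF s, of k]] by blast
      then show ?thesis using True by (force simp: supp_def)
    next
      case False
      then show ?thesis using * by (force simp: supp_def diag_def)
    qed
  qed
qed

lemma sec_swap_on:
  assumes \<sigma>: "\<And>k. \<sigma> (\<sigma> k) = k" and s: "s \<in> sec (liftN N)"
  shows "swap_on \<sigma> F s \<in> sec (liftN N)"
proof (rule secI[of _ _ "supp (liftN N) s \<union> map_prod \<sigma> id ` supp (liftN N) s"])
  show "swap_on \<sigma> F s p \<in> carrier (liftN N p)" for p
    using sec_carrier[OF s, of "(\<sigma> (fst p), snd p)"] sec_carrier[OF s, of p]
    by (auto simp: swap_on_def liftN_def split: prod.splits)
  show "finite (supp (liftN N) s \<union> map_prod \<sigma> id ` supp (liftN N) s)"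
    using finite_supp[OF s] by simp
  show "supp (liftN N) (swap_on \<sigma> F s) \<subseteq> supp (liftN N) s \<union> map_prod \<sigma> id ` supp (liftN N) s"
  proof clarify
    fix k i assume *: "(k, i) \<in> supp (liftN N) (swap_on \<sigma> F s)"
      "(k, i) \<notin> map_prod \<sigma> id ` supp (liftN N) s"
    then have "(\<sigma> k, i) \<notin> supp (liftN N) s"
      by (metis \<sigma> id_apply imageI map_prod_simp)
    then show "(k, i) \<in> supp (liftN N) s" using *(1) by (auto simp: supp_def swap_on_def split: if_splits)
  qed
qed

lemma local_op_swap_on:
  assumes \<sigma>: "\<And>k. \<sigma> (\<sigma> k) = k" and F: "\<forall>\<rho>\<in>H. \<forall>i. \<rho> i \<in> F \<longleftrightarrow> i \<in> F"
  shows "local_op R (liftN N) (liftH H) (swap_on \<sigma> F) {((k, i), (k', j)). i = j \<and> (k' = k \<or> k' = \<sigma> k)}"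
    (is "local_op _ _ _ _ ?E")
  unfolding local_op_def
proof (intro conjI)
  show "linop R (liftN N) (swap_on \<sigma> F)"
    unfolding linop_def using sec_swap_on[OF \<sigma>]
    by (auto simp: swap_on_def sadd_def smul_def fun_eq_iff)
  show "eqv (liftN N) (liftH H) (swap_on \<sigma> F)"
    unfolding eqv_def liftH_def using F by (auto simp: swap_on_def fun_eq_iff)
  show "loc (liftN N) (swap_on \<sigma> F) ?E"
    unfolding loc_def
  proof (intro ballI subsetI, clarify)
    fix s k j assume "(k, j) \<in> supp (liftN N) (swap_on \<sigma> F s)"
    then have "(k, j) \<in> supp (liftN N) s \<or> (\<sigma> k, j) \<in> supp (liftN N) s"
      by (auto simp: supp_def swap_on_def split: if_splits)
    then show "(k, j) \<in> ?E `` supp (liftN N) s"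
      by (elim disjE; intro ImageI) (auto simp: \<sigma>)
  qed
qed

lemma swap_on_swap_on: "(\<And>k. \<sigma> (\<sigma> k) = k) \<Longrightarrow> swap_on \<sigma> F (swap_on \<sigma> F s) = s"
  by (auto simp: swap_on_def fun_eq_iff)

lemma inverse_ops_swap_on: "(\<And>k. \<sigma> (\<sigma> k) = k) \<Longrightarrow> inverse_ops N (swap_on \<sigma> F) (swap_on \<sigma> F)"
  by (simp add: inverse_ops_def swap_on_swap_on)

lemma inverse_ops_diag:
  fixes N :: "'i \<Rightarrow> ('r, 'm) module" and S :: "'j set"
  assumes "inverse_ops N \<theta> \<theta>'"
  shows "inverse_ops (liftN N) (diag S \<theta>) (diag S \<theta>')"
proof -
  have "diag S \<theta> (diag S \<theta>' s) = s \<and> diag S \<theta>' (diag S \<theta> s) = s"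
    if "s \<in> sec (liftN N)" for s :: "'j \<times> 'i \<Rightarrow> 'm"
    using sec_slice[OF that] assms by (auto simp: inverse_ops_def fun_eq_iff diag_def)
  then show ?thesis by (auto simp: inverse_ops_def)
qed

lemma swap_on_inside: "supp (liftN N) s \<subseteq> UNIV \<times> F \<Longrightarrow> swap_on \<sigma> F s = swap_on \<sigma> UNIV s"
proof -
  assume "supp (liftN N) s \<subseteq> UNIV \<times> F"
  then have "s (k, i) = \<zero>\<^bsub>N i\<^esub>" if "i \<notin> F" for k i using that by (force simp: supp_def)
  then show ?thesis by (auto simp: swap_on_def fun_eq_iff)
qed

lemma swap_on_outside:
  assumes "supp (liftN N) s \<subseteq> UNIV \<times> Z" "Z \<inter> F = {}"
  shows "swap_on \<sigma> F s = s"
proof -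
  have "s (k, i) = \<zero>\<^bsub>N i\<^esub>" if "i \<in> F" for k i using assms that by (force simp: supp_def)
  then show ?thesis by (auto simp: swap_on_def fun_eq_iff)
qed

text \<open>When \<open>\<theta>'\<close> is inverse to \<open>\<theta>\<close>, this is the commutator of \<open>diag S \<theta>\<close> and the swap. Over the interior
  of \<open>F\<close> it is \<open>\<theta>\<close> on the copies in \<open>S\<close> and \<open>\<theta>'\<close> on the copies in \<open>\<sigma> -` S\<close>; away from \<open>F\<close> it is the
  identity.\<close>

definition swap_comm :: "'k set \<Rightarrow> ('k \<Rightarrow> 'k) \<Rightarrow> 'i set \<Rightarrow> ('i, 'm) operator \<Rightarrow> ('i, 'm) operator \<Rightarrow>
    ('k \<times> 'i \<Rightarrow> 'm) \<Rightarrow> 'k \<times> 'i \<Rightarrow> 'm" where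
  "swap_comm S \<sigma> F \<theta> \<theta>' s = diag S \<theta> (swap_on \<sigma> F (diag S \<theta>' (swap_on \<sigma> F s)))"

text \<open>Conjugating a diagonal operator by the full swap permutes the copies on which it
  acts.\<close>

lemma swap_comm_UNIV:
  assumes "\<And>k. \<sigma> (\<sigma> k) = k"
  shows "swap_comm S \<sigma> UNIV \<theta> \<theta>' s = diag S \<theta> (diag (\<sigma> -` S) \<theta>' s)"
  using assms by (simp add: swap_comm_def swap_on_def diag_def cong: if_cong)

section \<open>How far the truncated commutators reach\<close>

definition spread :: "int \<Rightarrow> nat \<Rightarrow> ('i \<times> 'i) set \<Rightarrow> ((int \<times> 'i) \<times> (int \<times> 'i)) set" where
  "spread d e E = {((k, i), (k', j)). \<bar>k - k'\<bar> \<le> d \<and> (i, j) \<in> E ^^ e}"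

text \<open>Copies and steps of \<open>E\<close> are counted separately, because the first change
  the height and the second the position over the line.\<close>

lemma spread_comp: "spread d e E O spread d' e' E \<subseteq> spread (d + d') (e + e') E"
proof clarify
  fix k i k' i' k'' i''
  assume "((k, i), (k', i')) \<in> spread d e E" "((k', i'), (k'', i'')) \<in> spread d' e' E"
  then show "((k, i), (k'', i'')) \<in> spread (d + d') (e + e') E"
    unfolding spread_def relpow_add by auto
qed

lemma local_op_spread_comp:
  "local_op R N H T (spread d e E) \<Longrightarrow> local_op R N H S (spread d' e' E) \<Longrightarrow>
    local_op R N H (\<lambda>s. S (T s)) (spread (d + d') (e + e') E)"
  by (rule local_op_mono[OF local_op_comp spread_comp])

text \<open>Reflexivity makes the enlargement of a set by \<open>E\<close> contain the set, and lets
  one step of \<open>E\<close> also cover the copies that \<open>diag\<close> leaves alone.\<close>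

locale local_iso =
  fixes R :: "('r, 'k) ring_scheme" and N :: "'i \<Rightarrow> ('r, 'm) module" and H \<theta> \<theta>' E
  assumes N: "modfam R N" and op: "local_op R N H \<theta> E" and op': "local_op R N H \<theta>' E"
    and inv: "inverse_ops N \<theta> \<theta>'" and refl: "Relation.Id \<subseteq> E"
begin

lemma swap: "local_iso R N H \<theta>' \<theta> E"
  using N op op' inv refl by (auto simp: local_iso_def inverse_ops_sym)

lemma local_op_diag_spread: "local_op R (liftN N) (liftH H) (diag S \<theta>) (spread 0 1 E)"
  by (rule local_op_mono[OF local_op_diag[OF N op]]) (use refl in \<open>auto simp: spread_def\<close>)

lemma diag_diag: "s \<in> sec (liftN N) \<Longrightarrow> diag S \<theta> (diag S \<theta>' s) = s"
  using inverse_ops_diag[OF inv] by (auto simp: inverse_ops_def)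

lemma supp_diag:
  fixes s :: "int \<times> 'i \<Rightarrow> 'm"
  assumes "s \<in> sec (liftN N)" "supp (liftN N) s \<subseteq> UNIV \<times> Z"
  shows "supp (liftN N) (diag S \<theta> s) \<subseteq> UNIV \<times> E `` Z"
  using local_op_supp[OF local_op_diag_spread assms(1), of S] assms(2) by (force simp: spread_def)

lemma supp_swap_on:
  assumes "\<And>k. \<sigma> (\<sigma> k) = k" "supp (liftN N) s \<subseteq> UNIV \<times> Z"
  shows "supp (liftN N) (swap_on \<sigma> F s) \<subseteq> UNIV \<times> Z"
  using assms(2) by (force simp: supp_def swap_on_def split: if_splits)

context
  fixes S :: "int set" and \<sigma> :: "int \<Rightarrow> int" and F :: "'i set"
  assumes \<sigma>: "\<And>k. \<sigma> (\<sigma> k) = k"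
begin

text \<open>Neither swap meets the section, not even after \<theta>' has enlarged its support, so
  the two diagonal factors cancel.\<close>

lemma swap_comm_outside:
  assumes s: "s \<in> sec (liftN N)" "supp (liftN N) s \<subseteq> UNIV \<times> Z" and Z: "E `` Z \<inter> F = {}"
  shows "swap_comm S \<sigma> F \<theta> \<theta>' s = s"
proof -
  have 0: "Z \<inter> F = {}" using Z refl by auto
  have 1: "swap_on \<sigma> F s = s" by (rule swap_on_outside[OF s(2) 0])
  have 2: "swap_on \<sigma> F (diag S \<theta>' s) = diag S \<theta>' s"
    by (rule swap_on_outside[OF local_iso.supp_diag[OF swap s] Z])
  show ?thesis using s(1) by (simp add: swap_comm_def 1 2 diag_diag)
qed

text \<open>Both swaps act on sections supported over \<open>F\<close>, where they cannot be told
  from the full swap. The last diagonal factor is followed by no swap, so one enlargement is all the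
  room required.\<close>

lemma swap_comm_inside:
  assumes s: "s \<in> sec (liftN N)" "supp (liftN N) s \<subseteq> UNIV \<times> Z" and Z: "E `` Z \<subseteq> F"
  shows "swap_comm S \<sigma> F \<theta> \<theta>' s = swap_comm S \<sigma> UNIV \<theta> \<theta>' s"
proof -
  have 0: "Z \<subseteq> F" using Z refl by auto
  have 1: "swap_on \<sigma> F s = swap_on \<sigma> UNIV s" using s(2) 0 by (intro swap_on_inside) auto
  have "supp (liftN N) (diag S \<theta>' (swap_on \<sigma> UNIV s)) \<subseteq> UNIV \<times> E `` Z"
    by (rule local_iso.supp_diag[OF swap sec_swap_on[OF \<sigma> s(1)] supp_swap_on[OF \<sigma> s(2)]])
  then have "swap_on \<sigma> F (diag S \<theta>' (swap_on \<sigma> UNIV s)) = swap_on \<sigma> UNIV (diag S \<theta>' (swap_on \<sigma> UNIV s))"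
    using Z by (intro swap_on_inside) auto
  then show ?thesis by (simp add: swap_comm_def 1)
qed

lemma supp_swap_comm:
  assumes s: "s \<in> sec (liftN N)" "supp (liftN N) s \<subseteq> UNIV \<times> Z"
  shows "supp (liftN N) (swap_comm S \<sigma> F \<theta> \<theta>' s) \<subseteq> UNIV \<times> E `` E `` Z"
  unfolding swap_comm_def
  by (intro supp_diag supp_swap_on local_iso.supp_diag[OF swap] sec_swap_on s \<sigma> sec_diag[OF N]
        local_opD(1)[OF op'])

text \<open>The inverse is the product of the inverse factors in the opposite order, again two swaps
  and two diagonal operators; therefore it obeys the same bound.\<close>

lemma swap_comm_local:
  assumes near: "\<And>k. \<bar>k - \<sigma> k\<bar> \<le> 1" and F: "\<forall>\<rho>\<in>H. \<forall>i. \<rho> i \<in> F \<longleftrightarrow> i \<in> F"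
  shows "local_op R (liftN N) (liftH H) (swap_comm S \<sigma> F \<theta> \<theta>') (spread 2 2 E)" (is ?A)
    and "local_op R (liftN N) (liftH H) (\<lambda>s. swap_on \<sigma> F (diag S \<theta> (swap_on \<sigma> F (diag S \<theta>' s)))) (spread 2 2 E)" (is ?B)
    and "inverse_ops (liftN N) (swap_comm S \<sigma> F \<theta> \<theta>') (\<lambda>s. swap_on \<sigma> F (diag S \<theta> (swap_on \<sigma> F (diag S \<theta>' s))))" (is ?C)
proof -
  have P: "local_op R (liftN N) (liftH H) (swap_on \<sigma> F) (spread 1 0 E)"
    by (rule local_op_mono[OF local_op_swap_on[OF \<sigma> F]]) (use near in \<open>auto simp: spread_def\<close>)
  note D = local_op_diag_spread[of S] and D' = local_iso.local_op_diag_spread[OF swap, of S]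
  \<comment> \<open>The summands list the factors from the innermost outwards: a swap costs one
    copy, a diagonal operator one step of \<open>E\<close>.\<close>
  have "local_op R (liftN N) (liftH H) (swap_comm S \<sigma> F \<theta> \<theta>') (spread (1+0+1+0) (0+1+0+1) E)"
    unfolding swap_comm_def by (intro local_op_spread_comp P D D')
  then show ?A by (simp add: numeral_2_eq_2)
  have "local_op R (liftN N) (liftH H) (\<lambda>s. swap_on \<sigma> F (diag S \<theta> (swap_on \<sigma> F (diag S \<theta>' s)))) (spread (0+1+0+1) (1+0+1+0) E)"
    by (intro local_op_spread_comp P D D')
  then show ?B by (simp add: numeral_2_eq_2)
  show ?C
    unfolding inverse_ops_def
  proof (intro ballI conjI)
    fix s assume s: "s \<in> sec (liftN N :: int \<times> _ \<Rightarrow> _)"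
    note [simp] = swap_on_swap_on[OF \<sigma>] diag_diag local_iso.diag_diag[OF swap]
      sec_swap_on[OF \<sigma>] sec_diag[OF N local_opD(1)[OF op]] sec_diag[OF N local_opD(1)[OF op']]
    show "swap_comm S \<sigma> F \<theta> \<theta>' (swap_on \<sigma> F (diag S \<theta> (swap_on \<sigma> F (diag S \<theta>' s)))) = s"
      and "swap_on \<sigma> F (diag S \<theta> (swap_on \<sigma> F (diag S \<theta>' (swap_comm S \<sigma> F \<theta> \<theta>' s)))) = s"
      using s by (simp_all add: swap_comm_def)
  qed
qed

end
end

section \<open>The swindle\<close>

text \<open>The sign \<open>c\<close> selects a half-line of copies. Here 0 is paired with
  \<open>c\<close>, then \<open>2 * c\<close> with \<open>3 * c\<close>, and so on;
  \<open>swap2\<close> pairs \<open>c\<close> with \<open>2 * c\<close> and so on, and fixes 0, the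
  copy on which the swindle leaves a trace.\<close>

definition swap1 :: "int \<Rightarrow> int \<Rightarrow> int" where
  "swap1 c m = (if c * m < 0 then m else if even m then m + c else m - c)"

definition swap2 :: "int \<Rightarrow> int \<Rightarrow> int" where
  "swap2 c m = (if c * m \<le> 0 then m else if odd m then m + c else m - c)"

definition evens :: "int \<Rightarrow> int set" where "evens c = {m. 0 \<le> c * m \<and> even m}"
definition odds :: "int \<Rightarrow> int set" where "odds c = {m. 0 \<le> c * m \<and> odd m}"

definition swindle :: "int \<Rightarrow> 'i set \<Rightarrow> ('i, 'm) operator \<Rightarrow> ('i, 'm) operator \<Rightarrow>
    (int \<times> 'i \<Rightarrow> 'm) \<Rightarrow> int \<times> 'i \<Rightarrow> 'm" where
  "swindle c F \<theta> \<theta>' s =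
     swap_comm (evens c) (swap1 c) F \<theta> \<theta>' (swap_comm (odds c) (swap2 c) F \<theta> \<theta>' s)"

lemma swap12:
  assumes "c = 1 \<or> c = -1"
  shows "swap1 c (swap1 c m) = m" "swap2 c (swap2 c m) = m"
    "\<bar>m - swap1 c m\<bar> \<le> 1" "\<bar>m - swap2 c m\<bar> \<le> 1"
    "swap1 c -` evens c = odds c" "swap2 c -` odds c = evens c - {0}"
  using assms by (auto simp: swap1_def swap2_def evens_def odds_def; presburger)+

context local_iso
begin

text \<open>The Eilenberg swindle in multiplicative form: the two pairings are shifted against each
  other by one copy, so \<theta> and \<theta>' cancel on every copy except 0, which has no partner
  in the second pairing.\<close>

lemma swindle_UNIV:
  assumes c: "c = 1 \<or> c = -1" and s: "s \<in> sec (liftN N)"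
  shows "swindle c UNIV \<theta> \<theta>' s = diag {0} \<theta> s"
proof -
  have t: "diag (evens c - {0}) \<theta>' s \<in> sec (liftN N)"
    by (rule sec_diag[OF N local_opD(1)[OF op'] s])
  have "swindle c UNIV \<theta> \<theta>' s =
      diag (evens c) \<theta> (diag (odds c) \<theta>' (diag (odds c) \<theta> (diag (evens c - {0}) \<theta>' s)))"
    by (simp add: swindle_def swap_comm_UNIV swap12[OF c])
  also have "\<dots> = diag (evens c) \<theta> (diag (evens c - {0}) \<theta>' s)"
    using local_iso.diag_diag[OF swap t] by simp
  also have "\<dots> = diag {0} \<theta> s"
    using sec_slice[OF s] inv by (auto simp: diag_def fun_eq_iff inverse_ops_def evens_def)
  finally show ?thesis .
qed

lemma swindle_outside:
  assumes c: "c = 1 \<or> c = -1" and s: "s \<in> sec (liftN N)" "supp (liftN N) s \<subseteq> UNIV \<times> Z"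
    and Z: "E `` Z \<inter> F = {}"
  shows "swindle c F \<theta> \<theta>' s = s"
  by (simp add: swindle_def swap_comm_outside[OF swap12(1)[OF c] s Z] swap_comm_outside[OF swap12(2)[OF c] s Z])

text \<open>Of the four diagonal factors, three are followed by a swap that has to find the section
  inside \<open>F\<close>; hence three enlargements.\<close>

lemma swindle_inside:
  assumes c: "c = 1 \<or> c = -1" and s: "s \<in> sec (liftN N)" "supp (liftN N) s \<subseteq> UNIV \<times> Z"
    and Z: "E `` E `` E `` Z \<subseteq> F"
  shows "swindle c F \<theta> \<theta>' s = diag {0} \<theta> s"
proof -
  have Z1: "E `` Z \<subseteq> F" using Z refl by (blast intro: subsetD)
  have "swap_comm (odds c) (swap2 c) F \<theta> \<theta>' s = swap_comm (odds c) (swap2 c) UNIV \<theta> \<theta>' s"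
    by (rule swap_comm_inside[OF swap12(2)[OF c] s Z1])
  moreover have "swap_comm (odds c) (swap2 c) UNIV \<theta> \<theta>' s \<in> sec (liftN N)"
    by (rule local_op_sec[OF swap_comm_local(1)[OF swap12(2)[OF c] swap12(4)[OF c]] s(1)]) simp
  moreover have "supp (liftN N) (swap_comm (odds c) (swap2 c) UNIV \<theta> \<theta>' s) \<subseteq> UNIV \<times> E `` E `` Z"
    by (rule supp_swap_comm[OF swap12(2)[OF c] s])
  ultimately have "swindle c F \<theta> \<theta>' s = swindle c UNIV \<theta> \<theta>' s"
    using swap_comm_inside[OF swap12(1)[OF c] _ _ Z] by (simp add: swindle_def)
  then show ?thesis by (simp add: swindle_UNIV[OF c s(1)])
qed

lemma swindle_local:
  assumes c: "c = 1 \<or> c = -1" and F: "\<forall>\<rho>\<in>H. \<forall>i. \<rho> i \<in> F \<longleftrightarrow> i \<in> F"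
  obtains u' where "local_op R (liftN N) (liftH H) (swindle c F \<theta> \<theta>') (spread 4 4 E)"
    "local_op R (liftN N) (liftH H) u' (spread 4 4 E)"
    "inverse_ops (liftN N) (swindle c F \<theta> \<theta>') u'"
proof -
  note 1 = swap_comm_local[OF swap12(1)[OF c] swap12(3)[OF c] F, of "evens c"]
  note 2 = swap_comm_local[OF swap12(2)[OF c] swap12(4)[OF c] F, of "odds c"]
  show ?thesis
    by (rule that[OF _ _ inverse_ops_comp[OF local_opD(1)[OF 2(1)] local_opD(1)[OF 1(2)] 1(3) 2(3), folded swindle_def]])
       (use local_op_spread_comp[OF 2(1) 1(1), folded swindle_def] local_op_spread_comp[OF 1(2) 2(2)] in simp_all)
qed

end

section \<open>Control over the line\<close>

text \<open>By cocompactness the pointwise neighbourhood condition of \<open>E_Gcc\<close> becomes a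
  uniform one, while symmetry and invariance can be arranged afterwards. Only the height of the
  first point is tested, since the second differs from it by at most \<delta>.\<close>

definition ctrl :: "((real \<times> real) \<times> (real \<times> real)) set \<Rightarrow> bool" where
  "ctrl Q \<longleftrightarrow> (\<exists>\<delta>. \<forall>((x, t), (x', t'))\<in>Q. \<bar>t - t'\<bar> \<le> \<delta>) \<and>
     (\<forall>\<epsilon>>0. \<exists>T. \<forall>((x, t), (x', t'))\<in>Q. T \<le> t \<longrightarrow> \<bar>x - x'\<bar> < \<epsilon>)"

lemma ctrlI:
  assumes "\<And>x t x' t'. ((x, t), (x', t')) \<in> Q \<Longrightarrow> \<bar>t - t'\<bar> \<le> \<delta>"
    and "\<And>\<epsilon>. \<epsilon> > 0 \<Longrightarrow> \<exists>T. \<forall>x t x' t'. ((x, t), (x', t')) \<in> Q \<longrightarrow> T \<le> t \<longrightarrow> \<bar>x - x'\<bar> < \<epsilon>"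
  shows "ctrl Q"
proof -
  have "\<forall>((x, t), (x', t'))\<in>Q. \<bar>t - t'\<bar> \<le> \<delta>" using assms(1) by auto
  moreover have "\<exists>T. \<forall>((x, t), (x', t'))\<in>Q. T \<le> t \<longrightarrow> \<bar>x - x'\<bar> < \<epsilon>" if e: "\<epsilon> > 0" for \<epsilon>
  proof -
    obtain T where "\<forall>x t x' t'. ((x, t), (x', t')) \<in> Q \<longrightarrow> T \<le> t \<longrightarrow> \<bar>x - x'\<bar> < \<epsilon>"
      using assms(2)[OF e] by blast
    then have "\<forall>((x, t), (x', t'))\<in>Q. T \<le> t \<longrightarrow> \<bar>x - x'\<bar> < \<epsilon>" by auto
    then show ?thesis ..
  qed
  ultimately show ?thesis unfolding ctrl_def by blast
qed

lemma ctrlE: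
  assumes "ctrl Q"
  obtains \<delta> where "0 \<le> \<delta>" "\<forall>x t x' t'. ((x, t), (x', t')) \<in> Q \<longrightarrow> \<bar>t - t'\<bar> \<le> \<delta>"
proof -
  obtain \<delta> where "\<forall>((x, t), (x', t'))\<in>Q. \<bar>t - t'\<bar> \<le> \<delta>" using assms by (auto simp: ctrl_def)
  then have "\<bar>t - t'\<bar> \<le> max 0 \<delta>" if "((x, t), (x', t')) \<in> Q" for x t x' t' using that by fastforce
  then show ?thesis using that[of "max 0 \<delta>"] by auto
qed

lemma ctrlD:
  assumes "ctrl Q" "\<epsilon> > 0"
  obtains T where "\<forall>x t x' t'. ((x, t), (x', t')) \<in> Q \<longrightarrow> T \<le> t \<longrightarrow> \<bar>x - x'\<bar> < \<epsilon>"
proof -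
  obtain T where "\<forall>((x, t), (x', t'))\<in>Q. T \<le> t \<longrightarrow> \<bar>x - x'\<bar> < \<epsilon>" using assms unfolding ctrl_def by blast
  then show ?thesis using that[of T] by fastforce
qed

lemma ctrl_subset: "ctrl Q \<Longrightarrow> Q' \<subseteq> Q \<Longrightarrow> ctrl Q'"
  unfolding ctrl_def by (meson subsetD)

lemma ctrl_Id: "ctrl Relation.Id"
  by (rule ctrlI[of _ 0]) auto

lemma ctrl_Un:
  assumes "ctrl P" "ctrl Q"
  shows "ctrl (P \<union> Q)"
proof -
  obtain d where d0: "\<forall>x t x' t'. ((x, t), (x', t')) \<in> P \<longrightarrow> \<bar>t - t'\<bar> \<le> d"
    by (rule ctrlE[OF assms(1)]) blast
  note d = d0[rule_format]
  obtain e where e0: "\<forall>x t x' t'. ((x, t), (x', t')) \<in> Q \<longrightarrow> \<bar>t - t'\<bar> \<le> e"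
    by (rule ctrlE[OF assms(2)]) blast
  note e = e0[rule_format]
  show ?thesis
  proof (rule ctrlI)
    show "\<bar>t - t'\<bar> \<le> max d e" if "((x, t), (x', t')) \<in> P \<union> Q" for x t x' t'
      using that d e by fastforce
    fix \<epsilon> :: real assume "\<epsilon> > 0"
    obtain S where "\<forall>x t x' t'. ((x, t), (x', t')) \<in> P \<longrightarrow> S \<le> t \<longrightarrow> \<bar>x - x'\<bar> < \<epsilon>"
      by (rule ctrlD[OF assms(1) \<open>\<epsilon> > 0\<close>]) blast
    note S = this[rule_format]
    obtain T where "\<forall>x t x' t'. ((x, t), (x', t')) \<in> Q \<longrightarrow> T \<le> t \<longrightarrow> \<bar>x - x'\<bar> < \<epsilon>"
      by (rule ctrlD[OF assms(2) \<open>\<epsilon> > 0\<close>]) blast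
    note T = this[rule_format]
    show "\<exists>T. \<forall>x t x' t'. ((x, t), (x', t')) \<in> P \<union> Q \<longrightarrow> T \<le> t \<longrightarrow> \<bar>x - x'\<bar> < \<epsilon>"
      by (rule exI[of _ "max S T"]) (use S T in auto)
  qed
qed

lemma ctrl_comp:
  assumes "ctrl P" "ctrl Q"
  shows "ctrl (P O Q)"
proof -
  obtain d where d0: "\<forall>x t x' t'. ((x, t), (x', t')) \<in> P \<longrightarrow> \<bar>t - t'\<bar> \<le> d"
    by (rule ctrlE[OF assms(1)]) blast
  note d = d0[rule_format]
  obtain e where e0: "\<forall>x t x' t'. ((x, t), (x', t')) \<in> Q \<longrightarrow> \<bar>t - t'\<bar> \<le> e"
    by (rule ctrlE[OF assms(2)]) blast
  note e = e0[rule_format]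
  show ?thesis
  proof (rule ctrlI)
    show "\<bar>t - t'\<bar> \<le> d + e" if pq: "((x, t), (x', t')) \<in> P O Q" for x t x' t'
    proof -
      obtain z where z: "((x, t), z) \<in> P" "(z, (x', t')) \<in> Q"
        using pq by (blast elim: relcompEpair)
      obtain y s where "z = (y, s)" by fastforce
      then have "((x, t), (y, s)) \<in> P" "((y, s), (x', t')) \<in> Q" using z by simp_all
      then show ?thesis using d e by (smt (verit))
    qed
    fix \<epsilon> :: real assume "\<epsilon> > 0"
    then have e2: "\<epsilon> / 2 > 0" by simp
    obtain S where "\<forall>x t x' t'. ((x, t), (x', t')) \<in> P \<longrightarrow> S \<le> t \<longrightarrow> \<bar>x - x'\<bar> < \<epsilon> / 2"
      by (rule ctrlD[OF assms(1) e2]) blast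
    note S = this[rule_format]
    obtain T where "\<forall>x t x' t'. ((x, t), (x', t')) \<in> Q \<longrightarrow> T \<le> t \<longrightarrow> \<bar>x - x'\<bar> < \<epsilon> / 2"
      by (rule ctrlD[OF assms(2) e2]) blast
    note T = this[rule_format]
    \<comment> \<open>The intermediate point may lie lower by \<open>d\<close>, so the threshold for
      \<open>Q\<close> is raised by \<open>d\<close>.\<close>
    have "\<bar>x - x'\<bar> < \<epsilon>" if pq: "((x, t), (x', t')) \<in> P O Q" and t: "max S (T + d) \<le> t" for x t x' t'
    proof -
      obtain z where z: "((x, t), z) \<in> P" "(z, (x', t')) \<in> Q"
        using pq by (blast elim: relcompEpair)
      obtain y s where "z = (y, s)" by fastforce
      then have *: "((x, t), (y, s)) \<in> P" "((y, s), (x', t')) \<in> Q" using z by simp_all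
      have "T \<le> s" using d[OF *(1)] t by auto
      then have "\<bar>x - y\<bar> < \<epsilon> / 2" "\<bar>y - x'\<bar> < \<epsilon> / 2" using S[OF *(1)] T[OF *(2)] t by auto
      then show ?thesis by linarith
    qed
    then show "\<exists>T. \<forall>x t x' t'. ((x, t), (x', t')) \<in> P O Q \<longrightarrow> T \<le> t \<longrightarrow> \<bar>x - x'\<bar> < \<epsilon>" by blast
  qed
qed

lemma ctrl_converse:
  assumes "ctrl Q"
  shows "ctrl (Q\<inverse>)"
proof -
  obtain d where d0: "\<forall>x t x' t'. ((x, t), (x', t')) \<in> Q \<longrightarrow> \<bar>t - t'\<bar> \<le> d"
    by (rule ctrlE[OF assms(1)]) blast
  note d = d0[rule_format]
  show ?thesis
  proof (rule ctrlI)
    show "\<bar>t - t'\<bar> \<le> d" if "((x, t), (x', t')) \<in> Q\<inverse>" for x t x' t'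
      using that d[of x' t' x t] by auto
    fix \<epsilon> :: real assume "\<epsilon> > 0"
    obtain T where "\<forall>x t x' t'. ((x, t), (x', t')) \<in> Q \<longrightarrow> T \<le> t \<longrightarrow> \<bar>x - x'\<bar> < \<epsilon>"
      by (rule ctrlD[OF assms \<open>\<epsilon> > 0\<close>]) blast
    note T = this[rule_format]
    have "\<bar>x - x'\<bar> < \<epsilon>" if "((x, t), (x', t')) \<in> Q\<inverse>" "T + d \<le> t" for x t x' t'
    proof -
      have *: "((x', t'), (x, t)) \<in> Q" using that by auto
      have "T \<le> t'" using d[OF *] that(2) by linarith
      then show ?thesis using T[OF *] by linarith
    qed
    then show "\<exists>T. \<forall>x t x' t'. ((x, t), (x', t')) \<in> Q\<inverse> \<longrightarrow> T \<le> t \<longrightarrow> \<bar>x - x'\<bar> < \<epsilon>" by blast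
  qed
qed

section \<open>The conditions on supports in terms of distances on the line\<close>

lemma stabilizer_iff: "g \<in> stabilizer G act x \<longleftrightarrow> g \<in> carrier G \<and> act g x = x"
  by (simp add: stabilizer_def)

definition cone_line :: "('g, 'x) line_space \<Rightarrow> 'x \<times> real \<Rightarrow> real \<times> real" where
  "cone_line D y = (proj D (fst y), snd y)"

text \<open>What the two groups have in common. The point \<open>setp x r\<close> lies over
  \<open>r\<close> in the sheet of \<open>x\<close>; through it maps of the line, such as the
  contractions, act on the space above the line.\<close>

locale line_data =
  fixes D :: "('g, 'x::topological_space) line_space" and setp :: "'x \<Rightarrow> real \<Rightarrow> 'x"
  assumes action: "group_action (grp D) UNIV (act_bar D)"
    and act_line: "g \<in> carrier (grp D) \<Longrightarrow>
      \<exists>n::int. (\<forall>x. act_line D g x = of_int n + x) \<or> (\<forall>x. act_line D g x = of_int n - x)"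
    and translation: "\<exists>g\<in>carrier (grp D). \<forall>x. act_line D g x = x + of_int n"
    and proj_act: "proj D (act_bar D g x) = act_line D g (proj D x)"
    and proj_setp [simp]: "proj D (setp x r) = r"
    and setp_proj [simp]: "setp x (proj D x) = x"
    and setp_setp [simp]: "setp (setp x r) r' = setp x r'"
    and act_setp: "act_bar D g (setp x r) = setp (act_bar D g x) (act_line D g r)"
    and continuous_proj: "continuous_on UNIV (proj D)"
    and compact_proj: "compact (proj D -` {a..b})"
begin

lemma act_line_isometry: "g \<in> carrier (grp D) \<Longrightarrow> \<bar>act_line D g x - act_line D g y\<bar> = \<bar>x - y\<bar>"
  using act_line[of g] by fastforce

lemma act_line_ball:
  assumes "g \<in> stabilizer (grp D) (act_line D) x"
  shows "act_cone (act_line D) g ` (ball x r \<times> B) = ball x r \<times> B"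
proof -
  have g: "g \<in> carrier (grp D)" "act_line D g x = x" using assms by (auto simp: stabilizer_iff)
  obtain n :: int where n: "(\<forall>x. act_line D g x = of_int n + x) \<or> (\<forall>x. act_line D g x = of_int n - x)"
    using act_line[OF g(1)] by blast
  \<comment> \<open>A translation with a fixed point is trivial, and a reflection is an
    involution.\<close>
  have inv: "act_line D g (act_line D g y) = y" for y
    using n g(2) by auto
  have sub: "act_line D g y \<in> ball x r" if "y \<in> ball x r" for y
    using act_line_isometry[OF g(1), of x y] that g(2) by (simp add: dist_real_def)
  show ?thesis
  proof (intro equalityI subsetI)
    fix p assume "p \<in> act_cone (act_line D) g ` (ball x r \<times> B)"
    then show "p \<in> ball x r \<times> B" using sub by (auto simp: act_cone_def simp del: mem_ball)
  next
    fix p assume p: "p \<in> ball x r \<times> B"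
    show "p \<in> act_cone (act_line D) g ` (ball x r \<times> B)"
    proof (rule image_eqI)
      show "p = act_cone (act_line D) g (act_line D g (fst p), snd p)"
        by (simp add: act_cone_def inv)
      show "(act_line D g (fst p), snd p) \<in> ball x r \<times> B"
        using sub[of "fst p"] p by (simp add: mem_Times_iff del: mem_ball)
    qed
  qed
qed

lemma inv_nhd_ball:
  assumes "r > 0" "1 \<le> a"
  shows "inv_nhd (grp D) (act_line D) x (ball x r \<times> {ereal a<..})"
    and "inv_nhd (grp D) (act_line D) x (ball x r \<times> {1..})"
proof -
  have 1: "ball x r \<times> {ereal a<..} = (UNIV \<times> {1..}) \<inter> (ball x r \<times> {ereal a<..})"
    using assms(2) by (auto simp: one_ereal_def intro: order_trans[of "ereal 1" "ereal a"] less_imp_le)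
  have 2: "ball x r \<times> {1..} = (UNIV \<times> {1..}) \<inter> (ball x r \<times> (UNIV :: ereal set))" by auto
  have "openin cone_top_inf (ball x r \<times> {ereal a<..})"
    unfolding cone_top_inf_def by (subst 1) (intro openin_open_Int open_Times open_ball open_greaterThan)
  then show "inv_nhd (grp D) (act_line D) x (ball x r \<times> {ereal a<..})"
    unfolding inv_nhd_def using act_line_ball assms by (intro conjI ballI) simp_all
  have "openin cone_top_inf (ball x r \<times> ({1..} :: ereal set))"
    unfolding cone_top_inf_def by (subst 2) (intro openin_open_Int open_Times open_ball open_UNIV)
  then show "inv_nhd (grp D) (act_line D) x (ball x r \<times> {1..})"
    unfolding inv_nhd_def using act_line_ball assms by (intro conjI ballI) simp_all
qed

lemma inv_nhd_contains_ball:
  assumes "inv_nhd (grp D) (act_line D) x U"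
  obtains r a where "r > 0" "1 \<le> a" "ball x r \<times> {ereal a<..} \<subseteq> U"
proof -
  have "openin cone_top_inf U" and xU: "(x, \<infinity>) \<in> U" using assms by (auto simp: inv_nhd_def)
  then obtain W where W: "open W" "U = (UNIV \<times> {1..}) \<inter> W"
    by (auto simp: cone_top_inf_def openin_open)
  obtain A B where AB: "open A" "open B" "(x, \<infinity>) \<in> A \<times> B" "A \<times> B \<subseteq> W"
    using open_prod_elim[OF W(1), of "(x, \<infinity>)"] xU W(2) by blast
  obtain r where r: "r > 0" "ball x r \<subseteq> A" using AB open_contains_ball by (metis mem_Sigma_iff)
  obtain a where a: "{ereal a<..} \<subseteq> B" using AB open_PInfty by (metis mem_Sigma_iff)
  have "ball x r \<times> {ereal (max 1 a)<..} \<subseteq> U"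
  proof clarify
    fix y s assume y: "y \<in> ball x r" and "ereal (max 1 a) < s"
    then have "1 \<le> s" "ereal a < s"
      by (metis ereal_less_eq(3) max.cobounded1 one_ereal_def order_le_less_trans less_imp_le)
         (metis \<open>ereal (max 1 a) < s\<close> ereal_less_eq(3) max.cobounded2 order_le_less_trans)
    then have "(y, s) \<in> A \<times> B" using r a y by blast
    then show "(y, s) \<in> U" using AB(4) W(2) \<open>1 \<le> s\<close> by auto
  qed
  then show ?thesis using that[of r "max 1 a"] r(1) by auto
qed

text \<open>The neighbourhood condition gives a radius and a height at every point; compactness of
  the unit interval makes them uniform there, and integer translations carry the bound to the whole
  line.\<close>

lemma E_Gcc_ctrl:
  assumes "E \<in> E_Gcc (grp D) (act_line D)"
  shows "ctrl E"
proof -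
  have sub: "E \<subseteq> (UNIV \<times> {1..}) \<times> (UNIV \<times> {1..})"
    and nh: "\<And>x U. inv_nhd (grp D) (act_line D) x U \<Longrightarrow>
        \<exists>V. V \<subseteq> U \<and> inv_nhd (grp D) (act_line D) x V \<and>
           ((topspace cone_top_inf - U) \<times> V) \<inter> map_prod (map_prod id ereal) (map_prod id ereal) ` E = {}"
    and \<delta>: "\<exists>\<delta>. \<forall>((x, t), (x', t'))\<in>E. \<bar>t - t'\<bar> \<le> \<delta>"
    and sy: "sym E"
    and inv: "\<And>g a b. g \<in> carrier (grp D) \<Longrightarrow> (a, b) \<in> E \<Longrightarrow>
        (act_cone (act_line D) g a, act_cone (act_line D) g b) \<in> E"
    using assms unfolding E_Gcc_def by blast+
  have "\<exists>T. \<forall>((x, t), (x', t'))\<in>E. T \<le> t \<longrightarrow> \<bar>x - x'\<bar> < \<epsilon>" if "\<epsilon> > 0" for \<epsilon>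
  proof -
    have "\<exists>r T. 0 < r \<and> (\<forall>a s b t. ((a, s), (b, t)) \<in> E \<longrightarrow> b \<in> ball x r \<longrightarrow> T < t \<longrightarrow> \<bar>a - b\<bar> < \<epsilon>)" for x
    proof -
      have e: "\<epsilon> / 2 > 0" using that by simp
      obtain V where V: "inv_nhd (grp D) (act_line D) x V"
        "((topspace cone_top_inf - ball x (\<epsilon> / 2) \<times> {1..}) \<times> V) \<inter>
           map_prod (map_prod id ereal) (map_prod id ereal) ` E = {}"
        using nh[OF inv_nhd_ball(2)[OF e order_refl]] by blast
      obtain r T where rT: "r > 0" "1 \<le> T" "ball x r \<times> {ereal T<..} \<subseteq> V"
        using inv_nhd_contains_ball[OF V(1)] by blast
      have "\<bar>a - b\<bar> < \<epsilon>" if "((a, s), (b, t)) \<in> E" "b \<in> ball x (min r (\<epsilon> / 2))" "T < t" for a s b t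
      proof -
        have 1: "(b, ereal t) \<in> V" using rT that by auto
        have 2: "((a, ereal s), (b, ereal t)) \<in> map_prod (map_prod id ereal) (map_prod id ereal) ` E"
          using that(1) by force
        have 3: "(a, ereal s) \<in> topspace cone_top_inf"
          using sub that(1) by (auto simp: cone_top_inf_def one_ereal_def)
        have "a \<in> ball x (\<epsilon> / 2)"
        proof (rule ccontr)
          assume "a \<notin> ball x (\<epsilon> / 2)"
          then have "((a, ereal s), (b, ereal t)) \<in> ((topspace cone_top_inf - ball x (\<epsilon> / 2) \<times> {1..}) \<times> V) \<inter>
              map_prod (map_prod id ereal) (map_prod id ereal) ` E"
            by (intro IntI SigmaI DiffI 1 2 3) (simp del: mem_ball)
          then show False unfolding V(2) by simp
        qed
        then have "\<bar>x - a\<bar> < \<epsilon> / 2" "\<bar>x - b\<bar> < \<epsilon> / 2" using that(2) by (auto simp: dist_real_def)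
        then show ?thesis by linarith
      qed
      then show ?thesis using rT(1) e by (intro exI[of _ "min r (\<epsilon> / 2)"] exI[of _ T]) auto
    qed
    then obtain r T where rT: "\<And>x. 0 < r x"
      "\<And>x a s b t. ((a, s), (b, t)) \<in> E \<Longrightarrow> b \<in> ball x (r x) \<Longrightarrow> T x < t \<Longrightarrow> \<bar>a - b\<bar> < \<epsilon>" by metis
    have "{0..1} \<subseteq> (\<Union>x\<in>{0..1}. ball x (r x))" using rT(1) by force
    then obtain C where C: "C \<subseteq> {0..1}" "finite C" "{0..1} \<subseteq> (\<Union>x\<in>C. ball x (r x))"
      using compactE_image[of "{0..1::real}" "{0..1}" "\<lambda>x. ball x (r x)"] by auto
    \<comment> \<open>The added 1 makes the comparison with \<open>T x\<close> strict. Symmetry of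
      \<open>E\<close> moves the high point to the second place, the one that the neighbourhood
      condition speaks of.\<close>
    have "\<bar>b - a\<bar> < \<epsilon>" if ba: "((b, t), (a, s)) \<in> E" and t: "Max (T ` C) + 1 \<le> t" for a s b t
    proof -
      obtain g where g: "g \<in> carrier (grp D)" "\<And>x. act_line D g x = x + of_int (- \<lfloor>b\<rfloor>)"
        using translation by blast
      define b' where "b' = act_line D g b"
      have "b' \<in> {0..1}" unfolding b'_def g(2) by (simp; linarith)
      then obtain x where x: "x \<in> C" "b' \<in> ball x (r x)" using C by blast
      have "T x \<le> Max (T ` C)" using x C by simp
      then have "\<bar>act_line D g a - b'\<bar> < \<epsilon>"
        using rT(2)[of "act_line D g a" s b' t x] x symD[OF sy inv[OF g(1) ba]] t
        by (simp add: act_cone_def b'_def)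
      then show ?thesis
        using act_line_isometry[OF g(1), of a b] by (simp add: b'_def)
    qed
    then show ?thesis by blast
  qed
  then show ?thesis using \<delta> by (simp add: ctrl_def)
qed

text \<open>Take all pairs obeying the bounds that \<open>Q\<close> and its converse obey. These
  bounds see a pair only through its heights and its distance over the line, so the resulting
  relation is symmetric and invariant by itself.\<close>

lemma ctrl_E_Gcc:
  assumes "ctrl Q" and sub: "Q \<subseteq> (UNIV \<times> {1..}) \<times> (UNIV \<times> {1..})"
  shows "\<exists>E\<in>E_Gcc (grp D) (act_line D). Q \<subseteq> E"
proof -
  let ?Q = "Q \<union> Q\<inverse>"
  have "ctrl ?Q" using assms(1) by (intro ctrl_Un ctrl_converse)
  then obtain \<delta> where \<delta>0: "0 \<le> \<delta>" "\<forall>x t x' t'. ((x, t), (x', t')) \<in> ?Q \<longrightarrow> \<bar>t - t'\<bar> \<le> \<delta>"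
    by (rule ctrlE) blast
  note \<delta> = \<delta>0[rule_format]
  have "\<exists>T. \<forall>x t x' t'. ((x, t), (x', t')) \<in> ?Q \<longrightarrow> T \<le> t \<longrightarrow> \<bar>x - x'\<bar> < 1 / (real n + 1)" for n
  proof -
    have "0 < 1 / (real n + 1)" by simp
    then show ?thesis by (rule ctrlD[OF \<open>ctrl ?Q\<close>]) blast
  qed
  then obtain \<tau> where \<tau>: "\<And>n x t x' t'. ((x, t), (x', t')) \<in> ?Q \<Longrightarrow> \<tau> n \<le> t \<Longrightarrow> \<bar>x - x'\<bar> < 1 / (real n + 1)"
    by metis
  define E where "E = {((x, t), (x', t')). 1 \<le> t \<and> 1 \<le> t' \<and> \<bar>t - t'\<bar> \<le> \<delta> \<and>
      (\<forall>n. \<tau> n \<le> t \<or> \<tau> n \<le> t' \<longrightarrow> \<bar>x - x'\<bar> < 1 / (real n + 1))}"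
  have QE: "Q \<subseteq> E"
  proof clarify
    fix x t x' t' assume q: "((x, t), (x', t')) \<in> Q"
    then have q': "((x', t'), (x, t)) \<in> ?Q" by auto
    show "((x, t), (x', t')) \<in> E"
      using q sub \<delta>(2)[of x t x' t'] \<tau>[of x t x' t'] \<tau>[OF q'] by (auto simp: E_def abs_minus_commute)
  qed
  have "E \<in> E_Gcc (grp D) (act_line D)"
    unfolding E_Gcc_def
  proof (intro CollectI conjI allI impI)
    show "E \<subseteq> (UNIV \<times> {1..}) \<times> UNIV \<times> {1..}" by (auto simp: E_def)
    show "\<exists>\<delta>. \<forall>((x, t), (x', t'))\<in>E. \<bar>t - t'\<bar> \<le> \<delta>"
      by (rule exI[of _ \<delta>]) (auto simp: E_def)
    show "sym E" by (rule symI) (auto simp: E_def abs_minus_commute)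
    show "\<forall>g\<in>carrier (grp D). \<forall>(a, b)\<in>E. (act_cone (act_line D) g a, act_cone (act_line D) g b) \<in> E"
      by (auto simp: E_def act_cone_def act_line_isometry)
    fix x U assume U: "inv_nhd (grp D) (act_line D) x U"
    obtain r a where ra: "r > 0" "1 \<le> a" "ball x r \<times> {ereal a<..} \<subseteq> U"
      using inv_nhd_contains_ball[OF U] by blast
    obtain n where n: "1 / (real n + 1) < r / 2"
      using ra(1) reals_Archimedean[of "r / 2"] by (auto simp: inverse_eq_divide add.commute)
    \<comment> \<open>Above \<open>a + \<delta>\<close> the partner of a point is still above
      \<open>a\<close>; above \<open>\<tau> n\<close> it is closer than
      \<open>r / 2\<close>.\<close>
    define b where "b = max (a + \<delta>) (\<tau> n)"
    have b: "1 \<le> b" "a \<le> b" using ra \<delta>(1) by (auto simp: b_def)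
    let ?V = "ball x (r / 2) \<times> {ereal b<..}"
    show "\<exists>V\<subseteq>U. inv_nhd (grp D) (act_line D) x V \<and>
        (topspace cone_top_inf - U) \<times> V \<inter> map_prod (map_prod id ereal) (map_prod id ereal) ` E = {}"
    proof (intro exI conjI)
      have "?V \<subseteq> ball x r \<times> {ereal a<..}" using ra(1) b by (auto intro: order_le_less_trans[of "ereal a" "ereal b"])
      then show "?V \<subseteq> U" using ra(3) by blast
      show "inv_nhd (grp D) (act_line D) x ?V" using inv_nhd_ball(1)[of "r / 2" b x] ra b by simp
      have no: False if p: "((y, s), (z, t)) \<in> E" "(z, ereal t) \<in> ?V" "(y, ereal s) \<notin> U" for y s z t
      proof -
        have t: "b < t" using p(2) by simp
        have "\<bar>y - z\<bar> < 1 / (real n + 1)" using p(1) t by (simp add: E_def b_def)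
        moreover have "\<bar>x - z\<bar> < r / 2" using p(2) by (auto simp: dist_real_def)
        ultimately have "\<bar>x - y\<bar> < r" using n by linarith
        then have "y \<in> ball x r" by (simp add: dist_real_def)
        moreover have "a < s" using p(1) t by (auto simp: E_def b_def)
        ultimately have "(y, ereal s) \<in> ball x r \<times> {ereal a<..}" by simp
        then show False using ra(3) p(3) by blast
      qed
      then show "(topspace cone_top_inf - U) \<times> ?V \<inter> map_prod (map_prod id ereal) (map_prod id ereal) ` E = {}"
      proof (intro equals0I)
        fix w assume "w \<in> (topspace cone_top_inf - U) \<times> ?V \<inter> map_prod (map_prod id ereal) (map_prod id ereal) ` E"
        then obtain y s z t where "w = ((y, ereal s), (z, ereal t))" "((y, s), (z, t)) \<in> E" "w \<in> (- U) \<times> ?V" by auto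
        then show False using no[of y s z t] by blast
      qed
    qed
  qed
  then show ?thesis using QE by blast
qed

end

section \<open>Contraction of cells\<close>

text \<open>The centre of a cell is the point of attraction, but boundary points stay where they
  are. The map is therefore injective and discontinuous at the boundary for \<open>c < 1\<close>,
  and only pairs within one cell remain close.\<close>

definition contract :: "real \<Rightarrow> real \<Rightarrow> real \<Rightarrow> real" where
  "contract a c x = (if x - a \<in> \<int> then x
     else let z = a + of_int \<lfloor>x - a\<rfloor> + 1/2 in z + c * (x - z))"

text \<open>Cells are open, and a boundary point shares a cell with no point, not even with itself;
  this is why later statements add the alternative of equal points.\<close>

definition same_cell :: "real \<Rightarrow> real \<Rightarrow> real \<Rightarrow> bool" where
  "same_cell a x y \<longleftrightarrow> x - a \<notin> \<int> \<and> y - a \<notin> \<int> \<and> \<lfloor>x - a\<rfloor> = \<lfloor>y - a\<rfloor>"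

lemma same_cellI:
  assumes "of_int k < x - a" "x - a < of_int k + 1" "of_int k < y - a" "y - a < of_int k + 1"
  shows "same_cell a x y"
proof -
  have *: "\<lfloor>z\<rfloor> = k \<and> z \<notin> \<int>" if "of_int k < z" "z < of_int k + 1" for z :: real
  proof -
    have f: "\<lfloor>z\<rfloor> = k" using that by linarith
    then show ?thesis using that by (auto elim!: Ints_cases)
  qed
  show ?thesis using *[OF assms(1,2)] *[OF assms(3,4)] by (simp add: same_cell_def)
qed

lemma noncell_floor:
  assumes "x \<notin> \<int>" obtains f :: real where "x = of_int \<lfloor>x\<rfloor> + f" "0 < f" "f < 1"
proof -
  have "x \<noteq> of_int \<lfloor>x\<rfloor>" using assms by (metis Ints_of_int)
  moreover have "of_int \<lfloor>x\<rfloor> \<le> x" "x < of_int \<lfloor>x\<rfloor> + 1" by linarith+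
  ultimately show ?thesis by (intro that[of "x - of_int \<lfloor>x\<rfloor>"]) linarith+
qed

lemma contract_one [simp]: "contract a 1 x = x"
  by (simp add: contract_def Let_def)

lemma contract_eq:
  assumes "x - a = of_int k + f" "0 < f" "f < 1"
  shows "contract a c x = a + of_int k + 1/2 + c * (f - 1/2)"
proof -
  have fl: "\<lfloor>x - a\<rfloor> = k" using assms by linarith
  then have "x - a \<notin> \<int>" using assms by (auto elim!: Ints_cases)
  moreover have "x - (a + of_int k + 1/2) = f - 1/2" using assms(1) by (simp add: algebra_simps)
  ultimately show ?thesis unfolding contract_def Let_def fl by simp
qed

lemma contract_cell:
  assumes "0 < c" "c \<le> 1" "x - a \<notin> \<int>"
  shows "same_cell a x (contract a c x)"
proof -
  obtain f where f: "x - a = of_int \<lfloor>x - a\<rfloor> + f" "0 < f" "f < 1" by (rule noncell_floor[OF assms(3)])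
  have "0 < c * f" "c * f < c" using assms(1) f by auto
  then have "of_int \<lfloor>x - a\<rfloor> < contract a c x - a" "contract a c x - a < of_int \<lfloor>x - a\<rfloor> + 1"
    using assms(2) by (simp_all add: contract_eq[OF f] algebra_simps)
  then show ?thesis using f by (intro same_cellI[of "\<lfloor>x - a\<rfloor>"]) auto
qed

text \<open>Every cell is mapped into itself by an injective affine map. This will let a position
  together with a copy number determine the point it came from.\<close>

lemma contract_inj:
  assumes "0 < c" "c \<le> 1" and eq: "contract a c x = contract a c y"
  shows "x = y"
proof (cases "x - a \<in> \<int>")
  case True
  then have "contract a c x = x" by (simp add: contract_def)
  moreover have "y - a \<in> \<int>" using contract_cell[OF assms(1,2), of y a] True eq calculation by (auto simp: same_cell_def)
  ultimately show ?thesis using eq by (simp add: contract_def)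
next
  case False
  have y: "y - a \<notin> \<int>"
    using contract_cell[OF assms(1,2) False] eq by (auto simp: same_cell_def contract_def split: if_splits)
  have "\<lfloor>x - a\<rfloor> = \<lfloor>y - a\<rfloor>"
    using contract_cell[OF assms(1,2) False] contract_cell[OF assms(1,2) y] eq by (simp add: same_cell_def)
  then show ?thesis using eq False y assms(1) by (simp add: contract_def Let_def)
qed

text \<open>A bound independent of the factor keeps the stabilised object locally finite over the
  line.\<close>

lemma contract_displacement:
  assumes "0 \<le> c" "c \<le> 1"
  shows "\<bar>contract a c x - x\<bar> \<le> 1"
proof (cases "x - a \<in> \<int>")
  case False
  obtain f where f: "x - a = of_int \<lfloor>x - a\<rfloor> + f" "0 < f" "f < 1" by (rule noncell_floor[OF False])
  have "c * (f - 1/2) - (f - 1/2) = (1 - c) * (1/2 - f)" by (simp add: field_simps)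
  then have "contract a c x - x = (1 - c) * (1/2 - f)" using f(1) contract_eq[OF f, of c] by linarith
  moreover have "\<bar>(1 - c) * (1/2 - f)\<bar> \<le> 1 * 1"
    unfolding abs_mult using assms f by (intro mult_mono) auto
  ultimately show ?thesis by simp
qed (simp add: contract_def)

lemma contract_translate: "contract a c (of_int n + x) = of_int n + contract a c x"
proof (cases "x - a \<in> \<int>")
  case True
  then have "of_int n + x - a \<in> \<int>" by (metis Ints_add Ints_of_int add_diff_eq)
  then show ?thesis using True by (simp add: contract_def)
next
  case False
  obtain f where f: "x - a = of_int \<lfloor>x - a\<rfloor> + f" "0 < f" "f < 1" by (rule noncell_floor[OF False])
  have "of_int n + x - a = of_int (n + \<lfloor>x - a\<rfloor>) + f" using f(1) by simp
  from contract_eq[OF this f(2,3)] show ?thesis by (simp add: contract_eq[OF f])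
qed

text \<open>A reflection about an integer or half-integer preserves the grid of boundary points only
  if twice \<open>a\<close> is an integer; both families of cells, with \<open>a\<close> equal to 0
  and to 1/2, qualify.\<close>

lemma contract_reflect:
  assumes "2 * a = of_int m"
  shows "contract a c (of_int n - x) = of_int n - contract a c x"
proof (cases "x - a \<in> \<int>")
  case True
  then obtain k where "x - a = of_int k" by (auto elim: Ints_cases)
  then have "of_int n - x - a = of_int (n - k - m)" using assms by simp
  then have "of_int n - x - a \<in> \<int>" by (metis Ints_of_int)
  then show ?thesis using True by (simp add: contract_def)
next
  case False
  obtain f where f: "x - a = of_int \<lfloor>x - a\<rfloor> + f" "0 < f" "f < 1" by (rule noncell_floor[OF False])
  \<comment> \<open>Reflection turns the fractional part \<open>f\<close> into \<open>1 - f\<close>,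
    which costs the integer part 1.\<close>
  have "of_int n - x - a = of_int (n - \<lfloor>x - a\<rfloor> - 1 - m) + (1 - f)" using f(1) assms by simp
  then have "contract a c (of_int n - x) =
      a + of_int (n - \<lfloor>x - a\<rfloor> - 1 - m) + 1/2 + c * ((1 - f) - 1/2)"
    using f(2,3) by (intro contract_eq) auto
  then show ?thesis
    using assms by (simp add: contract_eq[OF f] algebra_simps)
qed

text \<open>The point approaches its nearest integer without reaching it, so it stays on the same
  side. Hence an operator that respects the cells between integers still does after the inner copies
  have been contracted to the integers.\<close>

lemma contract_half_cell:
  assumes "0 < c" "c \<le> 1" "x \<notin> \<int>"
  shows "same_cell 0 x (contract (1/2) c x)"
proof (cases "x - 1/2 \<in> \<int>")
  case True
  then show ?thesis using assms by (simp add: contract_def same_cell_def)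
next
  case False
  let ?k = "\<lfloor>x - 1/2\<rfloor>"
  obtain f where f: "x - 1/2 = of_int ?k + f" "0 < f" "f < 1" by (rule noncell_floor[OF False])
  have x: "x = of_int (?k + 1) + (f - 1/2)" using f(1) by simp
  have ne: "f \<noteq> 1/2"
  proof
    assume "f = 1/2"
    then have "x = of_int (?k + 1)" using f(1) by simp
    then show False using assms(3) by (metis Ints_of_int)
  qed
  have C: "contract (1/2) c x = of_int (?k + 1) + c * (f - 1/2)" by (simp add: contract_eq[OF f])
  show ?thesis
  proof (cases "f < 1/2")
    case True
    have "c * (f - 1/2) < 0" using True assms(1) by (simp add: mult_pos_neg)
    moreover have "c * (1/2 - f) \<le> 1 * (1/2 - f)" using True assms(2) by (intro mult_right_mono) auto
    then have "-1 < c * (f - 1/2)" using f by (simp add: algebra_simps)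
    ultimately show ?thesis using True f x C by (intro same_cellI[of ?k]) auto
  next
    case False
    then have 0: "0 < c * (f - 1/2)" using ne assms(1) by simp
    have "c * (f - 1/2) \<le> 1 * (f - 1/2)" using False assms(2) by (intro mult_right_mono) auto
    also have "\<dots> < 1" using f(3) by simp
    finally show ?thesis using False ne f x C 0 by (intro same_cellI[of "?k + 1"]) auto
  qed
qed

text \<open>The points are moved along the rays of the Euclidean cone over a cell: the horizontal distance to
  the centre is divided by \<open>(t + n) / t\<close>. At height \<open>h = t + n\<close> a bounded part of \<open>Q\<close> is seen scaled by
  \<open>t / h\<close>, and the scaling factors of the two ends differ by \<open>O(1 / h)\<close>.\<close>

lemma ctrl_contract:
  assumes Q: "ctrl Q" and pos: "Q \<subseteq> (UNIV \<times> {1..}) \<times> (UNIV \<times> {1..})"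
  shows "ctrl {((contract a (t / (t + n)) x, t + n), (contract a (t' / (t' + n')) x', t' + n')) | x t x' t' n n'.
    ((x, t), (x', t')) \<in> Q \<and> 0 \<le> n \<and> 0 \<le> n' \<and> \<bar>n - n'\<bar> \<le> d \<and> (same_cell a x x' \<or> x = x')}" (is "ctrl ?C")
proof -
  obtain \<delta> where \<delta>0: "0 \<le> \<delta>" "\<forall>x t x' t'. ((x, t), (x', t')) \<in> Q \<longrightarrow> \<bar>t - t'\<bar> \<le> \<delta>"
    by (rule ctrlE[OF Q]) blast
  note \<delta> = \<delta>0[rule_format]
  have ht: "1 \<le> t \<and> 1 \<le> t'" if "((x, t), (x', t')) \<in> Q" for x t x' t' using pos that by auto
  show ?thesis
  proof (rule ctrlI)
    show "\<bar>t - t'\<bar> \<le> \<delta> + d" if "((x, t), (x', t')) \<in> ?C" for x t x' t'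
      using that \<delta>(2) by fastforce
    fix \<epsilon> :: real assume "\<epsilon> > 0"
    then have e2: "\<epsilon> / 2 > 0" by simp
    obtain T0 where "\<forall>x t x' t'. ((x, t), (x', t')) \<in> Q \<longrightarrow> T0 \<le> t \<longrightarrow> \<bar>x - x'\<bar> < \<epsilon> / 2"
      by (rule ctrlD[OF Q e2]) blast
    note T0 = this[rule_format]
    define T where "T = max T0 1"
    \<comment> \<open>The first entry makes the scaling factor of points below \<open>T\<close> at
      most \<epsilon>/2. The second keeps the height of the other end, lower by at most
      \<open>\<delta> + \<bar>d\<bar>\<close>, above what the difference of the two factors
      requires.\<close>
    define H where "H = max (2 * T / \<epsilon>) (\<delta> + \<bar>d\<bar> + (\<delta> + \<bar>d\<bar>) * 2 / \<epsilon>) + 1"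
    have main: "\<bar>contract a (t / (t + n)) x - contract a (t' / (t' + n')) x'\<bar> < \<epsilon>"
      if q: "((x, t), (x', t')) \<in> Q" and n: "0 \<le> n" "0 \<le> n'" "\<bar>n - n'\<bar> \<le> d" and s: "same_cell a x x'"
        and h: "H \<le> t + n" for x t x' t' n n'
    proof -
      let ?c = "t / (t + n)" and ?c' = "t' / (t' + n')"
      have t: "1 \<le> t" "1 \<le> t'" "\<bar>t - t'\<bar> \<le> \<delta>" using ht[OF q] \<delta>(2)[OF q] by auto
      have c: "0 < ?c" "?c \<le> 1" "0 < ?c'" "?c' \<le> 1" using t n by auto
      have xa: "x - a \<notin> \<int>" "x' - a \<notin> \<int>" and fl: "\<lfloor>x' - a\<rfloor> = \<lfloor>x - a\<rfloor>" using s by (auto simp: same_cell_def)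
      obtain f where f: "x - a = of_int \<lfloor>x - a\<rfloor> + f" "0 < f" "f < 1" by (rule noncell_floor[OF xa(1)])
      obtain f' where f': "x' - a = of_int \<lfloor>x - a\<rfloor> + f'" "0 < f'" "f' < 1"
        using noncell_floor[OF xa(2)] fl by metis
      \<comment> \<open>A displacement scaled by one factor, plus the change of factor times the
        offset of the second point from the centre.\<close>
      have "contract a ?c x - contract a ?c' x' = ?c * (f - f') + (?c - ?c') * (f' - 1/2)"
      proof -
        have "u * (f - 1/2) - u' * (f' - 1/2) = u * (f - f') + (u - u') * (f' - 1/2)" for u u'
          by (simp add: field_simps)
        from this[of ?c ?c'] show ?thesis unfolding contract_eq[OF f] contract_eq[OF f'] by linarith
      qed
      also have "\<bar>\<dots>\<bar> \<le> ?c * \<bar>f - f'\<bar> + \<bar>?c - ?c'\<bar> * \<bar>f' - 1/2\<bar>"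
      proof -
        have "\<bar>u * v + w * z\<bar> \<le> u * \<bar>v\<bar> + \<bar>w\<bar> * \<bar>z\<bar>" if "0 < u" for u v w z :: real
          using abs_triangle_ineq[of "u * v" "w * z"] that by (simp add: abs_mult)
        then show ?thesis using c(1) .
      qed
      also have "?c * \<bar>f - f'\<bar> \<le> \<epsilon> / 2"
      \<comment> \<open>Either the original height is already large enough for \<open>Q\<close>, or
        it is small compared with the new height and the contraction does the work.\<close>
      proof (cases "T \<le> t")
        case True
        have "\<bar>f - f'\<bar> = \<bar>x - x'\<bar>" using f(1) f'(1) by simp
        also have "\<dots> < \<epsilon> / 2" using T0[OF q] True by (simp add: T_def)
        finally have "?c * \<bar>f - f'\<bar> \<le> 1 * (\<epsilon> / 2)" using c by (intro mult_mono) auto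
        then show ?thesis by simp
      next
        case False
        have "2 * T / \<epsilon> \<le> t + n" using h by (simp add: H_def)
        then have "T / (t + n) \<le> \<epsilon> / 2" using \<open>\<epsilon> > 0\<close> t n by (simp add: field_simps)
        moreover have "?c \<le> T / (t + n)" using False t n by (intro divide_right_mono) auto
        moreover have "?c * \<bar>f - f'\<bar> \<le> ?c * 1" using c f f' by (intro mult_left_mono) auto
        ultimately show ?thesis by linarith
      qed
      also have "\<bar>?c - ?c'\<bar> * \<bar>f' - 1/2\<bar> \<le> \<bar>?c - ?c'\<bar> * 1" using f' by (intro mult_left_mono) auto
      also have "\<bar>?c - ?c'\<bar> < \<epsilon> / 2"
      proof -
        have p: "0 < t + n" "0 < t' + n'" using t n by auto
        have "?c - ?c' = (t * (n' - n) + n * (t - t')) / ((t + n) * (t' + n'))"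
          using p by (simp add: field_simps)
        then have "\<bar>?c - ?c'\<bar> = \<bar>t * (n' - n) + n * (t - t')\<bar> / ((t + n) * (t' + n'))"
          using p by (simp add: abs_mult)
        also have "\<bar>t * (n' - n) + n * (t - t')\<bar> \<le> t * \<bar>d\<bar> + n * \<delta>"
        proof -
          have "\<bar>t * (n' - n)\<bar> \<le> t * \<bar>d\<bar>" "\<bar>n * (t - t')\<bar> \<le> n * \<delta>"
            using t n by (auto simp: abs_mult intro!: mult_left_mono)
          then show ?thesis by linarith
        qed
        also have "t * \<bar>d\<bar> + n * \<delta> \<le> (t + n) * (\<delta> + \<bar>d\<bar>)"
          using t n \<delta>(1) by (simp add: algebra_simps)
        also have "(t + n) * (\<delta> + \<bar>d\<bar>) / ((t + n) * (t' + n')) = (\<delta> + \<bar>d\<bar>) / (t' + n')"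
          using p by simp
        also have "\<dots> < \<epsilon> / 2"
        proof -
          have "(\<delta> + \<bar>d\<bar>) * 2 / \<epsilon> < t' + n'" using h n t by (simp add: H_def)
          then show ?thesis using \<open>\<epsilon> > 0\<close> p by (simp add: field_simps)
        qed
        finally show ?thesis using p by (simp add: divide_right_mono)
      qed
      finally show ?thesis by simp
    qed
    have cell: "contract a u x = x" if "x - a \<in> \<int>" for u x using that by (simp add: contract_def)
    have "\<bar>y - y'\<bar> < \<epsilon>" if yy: "((y, h), (y', h')) \<in> ?C" "H \<le> h" for y h y' h'
    proof -
      obtain x t x' t' n n' where *: "y = contract a (t / (t + n)) x" "h = t + n" "y' = contract a (t' / (t' + n')) x'"
        "((x, t), (x', t')) \<in> Q" "0 \<le> n" "0 \<le> n'" "\<bar>n - n'\<bar> \<le> d" "same_cell a x x' \<or> x = x'"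
        using yy(1) by blast
      show ?thesis
      proof (cases "same_cell a x x'")
        case True
        then show ?thesis using main[OF *(4-7) True] yy(2) by (simp add: *(1-3))
      next
        case False
        then have "x' = x" "x - a \<in> \<int>" using *(8) by (auto simp: same_cell_def)
        then show ?thesis using \<open>\<epsilon> > 0\<close> by (simp add: *(1,3) cell)
      qed
    qed
    then show "\<exists>T. \<forall>x t x' t'. ((x, t), (x', t')) \<in> ?C \<longrightarrow> T \<le> t \<longrightarrow> \<bar>x - x'\<bar> < \<epsilon>" by blast
  qed
qed

section \<open>Coordinates and free modules on a given universe\<close>

text \<open>The only element is \<open>undefined\<close>, so that a section over this module has the
  value which \<open>opr\<close> returns off the cone.\<close>

definition triv_module :: "('r, 'm) module" where
  "triv_module = \<lparr>carrier = {undefined}, monoid.mult = undefined, one = undefined, ring.zero = undefined,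
     ring.add = (\<lambda>_ _. undefined), smult = (\<lambda>_ _. undefined)\<rparr>"

lemma left_module_triv: "ring R \<Longrightarrow> left_module R triv_module"
proof -
  assume "ring R"
  then interpret ring R .
  have "abelian_group triv_module"
    by (rule abelian_groupI) (auto simp: triv_module_def)
  then show ?thesis
    by (intro left_module.intro left_module_axioms.intro \<open>ring R\<close>) (auto simp: triv_module_def)
qed

definition coord :: "('r, 'k) ring_scheme \<Rightarrow> ('r, 'm) module \<Rightarrow> 'm set \<Rightarrow> 'm \<Rightarrow> 'm \<Rightarrow> 'r" where
  "coord R M B v = (THE c. c \<in> B \<rightarrow>\<^sub>E carrier R \<and> v = (\<Oplus>\<^bsub>M\<^esub>b\<in>B. c b \<odot>\<^bsub>M\<^esub> b))"

locale based_module = left_module R M for R :: "('r, 'k) ring_scheme" (structure) and M :: "('r, 'm) module" (structure) +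
  fixes B :: "'m set"
  assumes basis: "is_basis R M B"
begin

lemma B: "finite B" "B \<subseteq> carrier M"
  using basis by (auto simp: is_basis_def)

lemma comb_closed: "c \<in> B \<rightarrow> carrier R \<Longrightarrow> (\<Oplus>\<^bsub>M\<^esub>b\<in>B. c b \<odot>\<^bsub>M\<^esub> b) \<in> carrier M"
  using B by (intro M.finsum_closed) (auto intro!: smult_closed)

lemma coord:
  assumes "v \<in> carrier M"
  shows "coord R M B v \<in> B \<rightarrow>\<^sub>E carrier R" "(\<Oplus>\<^bsub>M\<^esub>b\<in>B. coord R M B v b \<odot>\<^bsub>M\<^esub> b) = v"
proof -
  have "\<exists>!c. c \<in> B \<rightarrow>\<^sub>E carrier R \<and> v = (\<Oplus>\<^bsub>M\<^esub>b\<in>B. c b \<odot>\<^bsub>M\<^esub> b)"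
    using basis assms by (auto simp: is_basis_def)
  from theI'[OF this] show "coord R M B v \<in> B \<rightarrow>\<^sub>E carrier R" "(\<Oplus>\<^bsub>M\<^esub>b\<in>B. coord R M B v b \<odot>\<^bsub>M\<^esub> b) = v"
    unfolding coord_def by auto
qed

lemma coord_unique:
  assumes "c \<in> B \<rightarrow>\<^sub>E carrier R"
  shows "coord R M B (\<Oplus>\<^bsub>M\<^esub>b\<in>B. c b \<odot>\<^bsub>M\<^esub> b) = c"
proof -
  let ?v = "\<Oplus>\<^bsub>M\<^esub>b\<in>B. c b \<odot>\<^bsub>M\<^esub> b"
  have "?v \<in> carrier M" using assms by (intro comb_closed) auto
  then have "\<exists>!c. c \<in> B \<rightarrow>\<^sub>E carrier R \<and> ?v = (\<Oplus>\<^bsub>M\<^esub>b\<in>B. c b \<odot>\<^bsub>M\<^esub> b)"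
    using basis by (auto simp: is_basis_def)
  then show ?thesis unfolding coord_def using assms by (intro the1_equality) auto
qed

lemma coord_add:
  assumes v: "v \<in> carrier M" and w: "w \<in> carrier M"
  shows "coord R M B (v \<oplus>\<^bsub>M\<^esub> w) = (\<lambda>b\<in>B. coord R M B v b \<oplus> coord R M B w b)"
proof -
  let ?c = "coord R M B"
  have c: "?c v b \<in> carrier R" "?c w b \<in> carrier R" if "b \<in> B" for b using coord(1)[OF v] coord(1)[OF w] that by auto
  have "(\<Oplus>\<^bsub>M\<^esub>b\<in>B. (\<lambda>b\<in>B. ?c v b \<oplus> ?c w b) b \<odot>\<^bsub>M\<^esub> b) = (\<Oplus>\<^bsub>M\<^esub>b\<in>B. ?c v b \<odot>\<^bsub>M\<^esub> b \<oplus>\<^bsub>M\<^esub> ?c w b \<odot>\<^bsub>M\<^esub> b)"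
    using B c by (intro M.finsum_cong') (auto simp: smult_l_distr subset_iff intro!: smult_closed M.add.m_closed)
  also have "\<dots> = (\<Oplus>\<^bsub>M\<^esub>b\<in>B. ?c v b \<odot>\<^bsub>M\<^esub> b) \<oplus>\<^bsub>M\<^esub> (\<Oplus>\<^bsub>M\<^esub>b\<in>B. ?c w b \<odot>\<^bsub>M\<^esub> b)"
    using B c by (intro M.finsum_addf) (auto simp: subset_iff intro!: smult_closed)
  also have "\<dots> = v \<oplus>\<^bsub>M\<^esub> w" by (simp add: coord(2) v w)
  finally show ?thesis using coord_unique[of "\<lambda>b\<in>B. ?c v b \<oplus> ?c w b"] c by auto
qed

lemma comb_smult:
  assumes a: "a \<in> carrier R" and S: "finite S" "S \<subseteq> B" and c: "c \<in> B \<rightarrow> carrier R"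
  shows "(\<Oplus>\<^bsub>M\<^esub>b\<in>S. (a \<otimes> c b) \<odot>\<^bsub>M\<^esub> b) = a \<odot>\<^bsub>M\<^esub> (\<Oplus>\<^bsub>M\<^esub>b\<in>S. c b \<odot>\<^bsub>M\<^esub> b)"
  using S
proof (induction S rule: finite_induct)
  case empty
  have "modfam R (\<lambda>_::unit. M)" by (auto simp: modfam_def intro: left_module_axioms)
  from modfam_ops(6)[OF this a] show ?case by simp
next
  case (insert x F)
  have c': "c b \<in> carrier R" "b \<in> carrier M" if "b \<in> insert x F" for b using insert.prems B c that by auto
  have "(\<Oplus>\<^bsub>M\<^esub>b\<in>insert x F. (a \<otimes> c b) \<odot>\<^bsub>M\<^esub> b) = (a \<otimes> c x) \<odot>\<^bsub>M\<^esub> x \<oplus>\<^bsub>M\<^esub> (\<Oplus>\<^bsub>M\<^esub>b\<in>F. (a \<otimes> c b) \<odot>\<^bsub>M\<^esub> b)"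
    using insert.hyps c' a by (intro M.finsum_insert) (auto intro!: smult_closed)
  also have "\<dots> = a \<odot>\<^bsub>M\<^esub> (c x \<odot>\<^bsub>M\<^esub> x) \<oplus>\<^bsub>M\<^esub> a \<odot>\<^bsub>M\<^esub> (\<Oplus>\<^bsub>M\<^esub>b\<in>F. c b \<odot>\<^bsub>M\<^esub> b)"
    using insert c' a by (simp add: smult_assoc1)
  also have "\<dots> = a \<odot>\<^bsub>M\<^esub> (c x \<odot>\<^bsub>M\<^esub> x \<oplus>\<^bsub>M\<^esub> (\<Oplus>\<^bsub>M\<^esub>b\<in>F. c b \<odot>\<^bsub>M\<^esub> b))"
    using c' a by (intro smult_r_distr[symmetric] M.finsum_closed) (auto intro!: smult_closed)
  also have "c x \<odot>\<^bsub>M\<^esub> x \<oplus>\<^bsub>M\<^esub> (\<Oplus>\<^bsub>M\<^esub>b\<in>F. c b \<odot>\<^bsub>M\<^esub> b) = (\<Oplus>\<^bsub>M\<^esub>b\<in>insert x F. c b \<odot>\<^bsub>M\<^esub> b)"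
    using insert.hyps c' a by (intro M.finsum_insert[symmetric]) (auto intro!: smult_closed)
  finally show ?case .
qed

lemma coord_smult:
  assumes a: "a \<in> carrier R" and v: "v \<in> carrier M"
  shows "coord R M B (a \<odot>\<^bsub>M\<^esub> v) = (\<lambda>b\<in>B. a \<otimes> coord R M B v b)"
proof -
  let ?c = "coord R M B"
  have c: "?c v b \<in> carrier R" if "b \<in> B" for b using coord(1)[OF v] that by auto
  have "(\<Oplus>\<^bsub>M\<^esub>b\<in>B. (\<lambda>b\<in>B. a \<otimes> ?c v b) b \<odot>\<^bsub>M\<^esub> b) = (\<Oplus>\<^bsub>M\<^esub>b\<in>B. (a \<otimes> ?c v b) \<odot>\<^bsub>M\<^esub> b)"
    using B c a by (intro M.finsum_cong') (auto simp: subset_iff intro!: smult_closed)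
  also have "\<dots> = a \<odot>\<^bsub>M\<^esub> (\<Oplus>\<^bsub>M\<^esub>b\<in>B. ?c v b \<odot>\<^bsub>M\<^esub> b)"
    using B c a by (intro comb_smult) auto
  also have "\<dots> = a \<odot>\<^bsub>M\<^esub> v" by (simp add: coord(2) v)
  finally show ?thesis using coord_unique[of "\<lambda>b\<in>B. a \<otimes> ?c v b"] c a by auto
qed

end

text \<open>The module of all functions from \<open>L\<close> to \<open>R\<close>, transported along
  \<open>h\<close> into the given universe.\<close>

definition free_module :: "('r, 'k) ring_scheme \<Rightarrow> 'l set \<Rightarrow> (('l \<Rightarrow> 'r) \<Rightarrow> 'm) \<Rightarrow> ('r, 'm) module" where
  "free_module R L h = (let g = inv_into (L \<rightarrow>\<^sub>E carrier R) h in
     \<lparr>carrier = h ` (L \<rightarrow>\<^sub>E carrier R), monoid.mult = undefined, one = undefined,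
      ring.zero = h (\<lambda>l\<in>L. \<zero>\<^bsub>R\<^esub>), ring.add = (\<lambda>v w. h (\<lambda>l\<in>L. g v l \<oplus>\<^bsub>R\<^esub> g w l)),
      smult = (\<lambda>a v. h (\<lambda>l\<in>L. a \<otimes>\<^bsub>R\<^esub> g v l))\<rparr>)"

locale free_module_data = ring R for R :: "('r, 'k) ring_scheme" (structure) +
  fixes L :: "'l set" and h :: "('l \<Rightarrow> 'r) \<Rightarrow> 'm"
  assumes L: "finite L" and h: "inj_on h (L \<rightarrow>\<^sub>E carrier R)"
begin

abbreviation "M \<equiv> free_module R L h"

lemma carrier_M: "carrier M = h ` (L \<rightarrow>\<^sub>E carrier R)"
  by (simp add: free_module_def Let_def)

lemma zero_M: "\<zero>\<^bsub>M\<^esub> = h (\<lambda>l\<in>L. \<zero>)"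
  by (simp add: free_module_def Let_def)

lemma add_M: "f \<in> L \<rightarrow>\<^sub>E carrier R \<Longrightarrow> f' \<in> L \<rightarrow>\<^sub>E carrier R \<Longrightarrow> h f \<oplus>\<^bsub>M\<^esub> h f' = h (\<lambda>l\<in>L. f l \<oplus> f' l)"
  by (simp add: free_module_def Let_def inv_into_f_f[OF h])

lemma smult_M: "f \<in> L \<rightarrow>\<^sub>E carrier R \<Longrightarrow> a \<odot>\<^bsub>M\<^esub> h f = h (\<lambda>l\<in>L. a \<otimes> f l)"
  by (simp add: free_module_def Let_def inv_into_f_f[OF h])

lemma restrict_carrier: "(\<And>l. l \<in> L \<Longrightarrow> F l \<in> carrier R) \<Longrightarrow> (\<lambda>l\<in>L. F l) \<in> L \<rightarrow>\<^sub>E carrier R"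
  by (simp add: restrict_PiE_iff)

lemma abelian_group_M: "abelian_group M"
proof (rule abelian_groupI)
  fix x y assume "x \<in> carrier M" "y \<in> carrier M"
  then obtain f f' where f: "f \<in> L \<rightarrow>\<^sub>E carrier R" "x = h f" "f' \<in> L \<rightarrow>\<^sub>E carrier R" "y = h f'"
    by (auto simp: carrier_M)
  have fl: "f l \<in> carrier R" "f' l \<in> carrier R" if "l \<in> L" for l using f that by auto
  show "x \<oplus>\<^bsub>M\<^esub> y \<in> carrier M"
    unfolding f(2,4) add_M[OF f(1,3)] carrier_M using fl by (intro imageI restrict_carrier) simp
  show "x \<oplus>\<^bsub>M\<^esub> y = y \<oplus>\<^bsub>M\<^esub> x"
    unfolding f(2,4) add_M[OF f(1,3)] add_M[OF f(3,1)]
    using fl by (intro arg_cong[of _ _ h] restrict_ext a_comm)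
  fix z assume "z \<in> carrier M"
  then obtain f'' where f'': "f'' \<in> L \<rightarrow>\<^sub>E carrier R" "z = h f''" by (auto simp: carrier_M)
  have 1: "(\<lambda>l\<in>L. f l \<oplus> f' l) \<in> L \<rightarrow>\<^sub>E carrier R" "(\<lambda>l\<in>L. f' l \<oplus> f'' l) \<in> L \<rightarrow>\<^sub>E carrier R"
    using fl f'' by (intro restrict_carrier; auto)+
  show "x \<oplus>\<^bsub>M\<^esub> y \<oplus>\<^bsub>M\<^esub> z = x \<oplus>\<^bsub>M\<^esub> (y \<oplus>\<^bsub>M\<^esub> z)"
    unfolding f(2,4) f''(2) add_M[OF f(1,3)] add_M[OF f(3) f''(1)] add_M[OF 1(1) f''(1)] add_M[OF f(1) 1(2)]
    using fl f'' by (intro arg_cong[of _ _ h] restrict_ext) (auto intro!: a_assoc)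
next
  have 0: "(\<lambda>l\<in>L. \<zero>) \<in> L \<rightarrow>\<^sub>E carrier R" by auto
  then show "\<zero>\<^bsub>M\<^esub> \<in> carrier M" by (auto simp: zero_M carrier_M)
  fix x assume "x \<in> carrier M"
  then obtain f where f: "f \<in> L \<rightarrow>\<^sub>E carrier R" "x = h f" by (auto simp: carrier_M)
  have fl: "f l \<in> carrier R" if "l \<in> L" for l using f that by auto
  have "(\<lambda>l\<in>L. (\<lambda>l\<in>L. \<zero>) l \<oplus> f l) = f"
    using fl by (intro PiE_ext[OF restrict_carrier f(1)]) simp_all
  then show "\<zero>\<^bsub>M\<^esub> \<oplus>\<^bsub>M\<^esub> x = x" by (simp add: zero_M f(2) add_M[OF 0 f(1)])
  have n: "(\<lambda>l\<in>L. \<ominus> f l) \<in> L \<rightarrow>\<^sub>E carrier R" using fl by (intro restrict_carrier) simp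
  have "h (\<lambda>l\<in>L. \<ominus> f l) \<oplus>\<^bsub>M\<^esub> x = \<zero>\<^bsub>M\<^esub>"
    unfolding f(2) add_M[OF n f(1)] zero_M using fl by (intro arg_cong[of _ _ h] restrict_ext) (auto simp: l_neg)
  then show "\<exists>y\<in>carrier M. y \<oplus>\<^bsub>M\<^esub> x = \<zero>\<^bsub>M\<^esub>" using imageI[OF n, of h, folded carrier_M] by blast
qed

lemma left_module_M: "left_module R M"
proof (intro left_module.intro left_module_axioms.intro abelian_group_M ring_axioms)
  fix a x assume a: "a \<in> carrier R" and "x \<in> carrier M"
  then obtain f where f: "f \<in> L \<rightarrow>\<^sub>E carrier R" "x = h f" by (auto simp: carrier_M)
  have fl: "f l \<in> carrier R" if "l \<in> L" for l using f that by auto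
  have af: "(\<lambda>l\<in>L. b \<otimes> f l) \<in> L \<rightarrow>\<^sub>E carrier R" if "b \<in> carrier R" for b
    using fl that by (intro restrict_carrier) simp
  show "a \<odot>\<^bsub>M\<^esub> x \<in> carrier M" unfolding f(2) smult_M[OF f(1)] carrier_M by (intro imageI af a)
  fix b assume b: "b \<in> carrier R"
  show "(a \<oplus> b) \<odot>\<^bsub>M\<^esub> x = a \<odot>\<^bsub>M\<^esub> x \<oplus>\<^bsub>M\<^esub> b \<odot>\<^bsub>M\<^esub> x"
    unfolding f(2) smult_M[OF f(1)] add_M[OF af[OF a] af[OF b]]
    using fl a b by (intro arg_cong[of _ _ h] restrict_ext) (auto simp: l_distr)
  show "(a \<otimes> b) \<odot>\<^bsub>M\<^esub> x = a \<odot>\<^bsub>M\<^esub> (b \<odot>\<^bsub>M\<^esub> x)"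
    unfolding f(2) smult_M[OF f(1)] smult_M[OF af[OF b]]
    using fl a b by (intro arg_cong[of _ _ h] restrict_ext) (auto simp: m_assoc)
next
  fix a x y assume a: "a \<in> carrier R" and "x \<in> carrier M" "y \<in> carrier M"
  then obtain f f' where f: "f \<in> L \<rightarrow>\<^sub>E carrier R" "x = h f" "f' \<in> L \<rightarrow>\<^sub>E carrier R" "y = h f'"
    by (auto simp: carrier_M)
  have fl: "f l \<in> carrier R" "f' l \<in> carrier R" if "l \<in> L" for l using f that by auto
  have 1: "(\<lambda>l\<in>L. f l \<oplus> f' l) \<in> L \<rightarrow>\<^sub>E carrier R" "(\<lambda>l\<in>L. a \<otimes> f l) \<in> L \<rightarrow>\<^sub>E carrier R"
    "(\<lambda>l\<in>L. a \<otimes> f' l) \<in> L \<rightarrow>\<^sub>E carrier R" using fl a by (intro restrict_carrier; simp)+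
  show "a \<odot>\<^bsub>M\<^esub> (x \<oplus>\<^bsub>M\<^esub> y) = a \<odot>\<^bsub>M\<^esub> x \<oplus>\<^bsub>M\<^esub> a \<odot>\<^bsub>M\<^esub> y"
    unfolding f(2,4) smult_M[OF f(1)] smult_M[OF f(3)] add_M[OF f(1,3)] smult_M[OF 1(1)] add_M[OF 1(2,3)]
    using fl a by (intro arg_cong[of _ _ h] restrict_ext) (auto simp: r_distr)
next
  fix x assume "x \<in> carrier M"
  then obtain f where f: "f \<in> L \<rightarrow>\<^sub>E carrier R" "x = h f" by (auto simp: carrier_M)
  have fl: "f l \<in> carrier R" if "l \<in> L" for l using f that by auto
  have "(\<lambda>l\<in>L. \<one> \<otimes> f l) = f" using fl by (intro PiE_ext[OF restrict_carrier f(1)]) simp_all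
  then show "\<one> \<odot>\<^bsub>M\<^esub> x = x" by (simp add: f(2) smult_M[OF f(1)])
qed

definition unit_vec :: "'l \<Rightarrow> 'm" where
  "unit_vec l = h (\<lambda>l'\<in>L. if l' = l then \<one> else \<zero>)"

lemma unit_vec_closed: "unit_vec l \<in> carrier M"
  unfolding unit_vec_def carrier_M by (intro imageI) auto

lemma sum_unit_vec:
  assumes k: "k \<in> L \<rightarrow> carrier R" and S: "finite S" "S \<subseteq> L"
  shows "(\<Oplus>\<^bsub>M\<^esub>l\<in>S. k l \<odot>\<^bsub>M\<^esub> unit_vec l) = h (\<lambda>l\<in>L. if l \<in> S then k l else \<zero>)"
  using S
proof (induction S rule: finite_induct)
  case empty
  interpret M: abelian_group M by (rule abelian_group_M)
  show ?case by (simp add: zero_M restrict_def)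
next
  case (insert x F)
  interpret M: left_module R M by (rule left_module_M)
  have kl: "k l \<in> carrier R" if "l \<in> insert x F" for l using insert.prems k that by auto
  have d: "(\<lambda>l'\<in>L. if l' = x then \<one> else \<zero>) \<in> L \<rightarrow>\<^sub>E carrier R" by auto
  have *: "(\<lambda>l\<in>L. k x \<otimes> (\<lambda>l'\<in>L. if l' = x then \<one> else \<zero>) l) \<in> L \<rightarrow>\<^sub>E carrier R"
    "(\<lambda>l\<in>L. if l \<in> F then k l else \<zero>) \<in> L \<rightarrow>\<^sub>E carrier R" using kl by (intro restrict_carrier; simp)+
  have FL: "F \<subseteq> L" using insert.prems by simp
  have "(\<Oplus>\<^bsub>M\<^esub>l\<in>insert x F. k l \<odot>\<^bsub>M\<^esub> unit_vec l) = k x \<odot>\<^bsub>M\<^esub> unit_vec x \<oplus>\<^bsub>M\<^esub> (\<Oplus>\<^bsub>M\<^esub>l\<in>F. k l \<odot>\<^bsub>M\<^esub> unit_vec l)"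
    using insert.hyps kl by (intro M.M.finsum_insert) (auto intro!: M.smult_closed unit_vec_closed)
  also have "\<dots> = h (\<lambda>l\<in>L. k x \<otimes> (\<lambda>l'\<in>L. if l' = x then \<one> else \<zero>) l) \<oplus>\<^bsub>M\<^esub> h (\<lambda>l\<in>L. if l \<in> F then k l else \<zero>)"
    unfolding unit_vec_def[of x] smult_M[OF d] insert.IH[OF FL] ..
  also have "\<dots> = h (\<lambda>l\<in>L. if l \<in> insert x F then k l else \<zero>)"
    unfolding add_M[OF *]
    using insert.hyps kl by (intro arg_cong[of _ _ h] restrict_ext) auto
  finally show ?case .
qed

lemma fg_free_M: "fg_free R M"
  unfolding fg_free_def
proof (intro conjI left_module_M)
  interpret M: left_module R M by (rule left_module_M)
  show "\<exists>B. is_basis R M B"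
  \<comment> \<open>Over the zero ring all unit vectors coincide and do not index the labels; there
    the empty set serves as a basis.\<close>
  proof (cases "\<one> = \<zero>")
    case True
    then have R0: "carrier R = {\<zero>}" by (rule one_zeroD)
    then have "L \<rightarrow>\<^sub>E carrier R = {\<lambda>l\<in>L. \<zero>}" by (simp add: PiE_singleton restrict_def)
    then have "carrier M = {\<zero>\<^bsub>M\<^esub>}" by (simp add: carrier_M zero_M)
    then have "is_basis R M {}" by (simp add: is_basis_def)
    then show ?thesis by blast
  next
    case False
    have inj: "inj_on unit_vec L"
    proof (rule inj_onI)
      fix l l' assume l: "l \<in> L" "l' \<in> L" and eq: "unit_vec l = unit_vec l'"
      have "(\<lambda>x\<in>L. if x = l then \<one> else \<zero>) = (\<lambda>x\<in>L. if x = l' then \<one> else \<zero>)"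
        using eq unfolding unit_vec_def by (rule inj_onD[OF h]) auto
      from fun_cong[OF this, of l] show "l = l'" using False l by (auto split: if_splits)
    qed
    have sum: "(\<Oplus>\<^bsub>M\<^esub>b\<in>unit_vec ` L. c b \<odot>\<^bsub>M\<^esub> b) = h (\<lambda>l\<in>L. c (unit_vec l))"
      if c: "c \<in> unit_vec ` L \<rightarrow>\<^sub>E carrier R" for c
    proof -
      have "(\<Oplus>\<^bsub>M\<^esub>b\<in>unit_vec ` L. c b \<odot>\<^bsub>M\<^esub> b) = (\<Oplus>\<^bsub>M\<^esub>l\<in>L. c (unit_vec l) \<odot>\<^bsub>M\<^esub> unit_vec l)"
        using c by (intro M.M.finsum_reindex inj) (auto intro!: M.smult_closed unit_vec_closed)
      also have "\<dots> = h (\<lambda>l\<in>L. if l \<in> L then c (unit_vec l) else \<zero>)"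
        using c L by (intro sum_unit_vec) auto
      finally show ?thesis by (simp cong: restrict_cong)
    qed
    have "\<exists>!c. c \<in> unit_vec ` L \<rightarrow>\<^sub>E carrier R \<and> v = (\<Oplus>\<^bsub>M\<^esub>b\<in>unit_vec ` L. c b \<odot>\<^bsub>M\<^esub> b)"
      if v: "v \<in> carrier M" for v
    proof -
      obtain f where f: "f \<in> L \<rightarrow>\<^sub>E carrier R" "v = h f" using v by (auto simp: carrier_M)
      define c where "c = (\<lambda>b\<in>unit_vec ` L. f (inv_into L unit_vec b))"
      have c: "c \<in> unit_vec ` L \<rightarrow>\<^sub>E carrier R" using f by (auto simp: c_def inv_into_f_f[OF inj])
      have cf: "(\<lambda>l\<in>L. c (unit_vec l)) = f"
        using f by (intro PiE_ext[OF restrict_carrier f(1)]) (auto simp: c_def inv_into_f_f[OF inj])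
      show ?thesis
      proof (rule ex1I[of _ c])
        show "c \<in> unit_vec ` L \<rightarrow>\<^sub>E carrier R \<and> v = (\<Oplus>\<^bsub>M\<^esub>b\<in>unit_vec ` L. c b \<odot>\<^bsub>M\<^esub> b)"
          using c cf f by (simp add: sum[OF c])
        fix d assume d: "d \<in> unit_vec ` L \<rightarrow>\<^sub>E carrier R \<and> v = (\<Oplus>\<^bsub>M\<^esub>b\<in>unit_vec ` L. d b \<odot>\<^bsub>M\<^esub> b)"
        then have "h f = h (\<lambda>l\<in>L. d (unit_vec l))" using sum[of d] f(2) by simp
        then have "f = (\<lambda>l\<in>L. d (unit_vec l))" by (rule inj_onD[OF h]) (use f d in auto)
        then have "d (unit_vec l) = c (unit_vec l)" if "l \<in> L" for l
          using fun_cong[of f _ l] fun_cong[OF cf, of l] that by simp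
        then have "d b = c b" if "b \<in> unit_vec ` L" for b using that by auto
        then show "d = c" using c d by (intro PiE_ext) auto
      qed
    qed
    then have "is_basis R M (unit_vec ` L)" unfolding is_basis_def using L unit_vec_closed by auto
    then show ?thesis by blast
  qed
qed

end

text \<open>A function on a finite set is encoded by the list of its values along one fixed
  enumeration. Repetitions in the enumeration are harmless for injectivity.\<close>

definition list_emb :: "('r list \<Rightarrow> 'm) \<Rightarrow> 'l set \<Rightarrow> ('l \<Rightarrow> 'r) \<Rightarrow> 'm" where
  "list_emb \<iota> L f = \<iota> (map f (SOME xs. set xs = L))"

lemma inj_list_emb:
  assumes "inj_on \<iota> (lists C)" "finite L"
  shows "inj_on (list_emb \<iota> L) (L \<rightarrow>\<^sub>E C)"
proof (rule inj_onI)
  fix f g assume f: "f \<in> L \<rightarrow>\<^sub>E C" and g: "g \<in> L \<rightarrow>\<^sub>E C" and eq: "list_emb \<iota> L f = list_emb \<iota> L g"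
  define xs where "xs = (SOME xs. set xs = L)"
  have xs: "set xs = L" unfolding xs_def using finite_list[OF assms(2)] by (rule someI_ex)
  have "map f xs = map g xs"
    using eq unfolding list_emb_def xs_def[symmetric]
    by (rule inj_onD[OF assms(1)]) (use f g xs in auto)
  then have "f x = g x" if "x \<in> L" for x using that xs by auto
  then show "f = g" using f g by (intro PiE_ext) auto
qed

section \<open>Presented objects and their morphisms\<close>

abbreviation cone :: "('x::topological_space \<times> real) set" where
  "cone \<equiv> topspace cone_top"

lemma cone_iff: "y \<in> cone \<longleftrightarrow> 1 \<le> snd y"
  by (auto simp: cone_top_def mem_Times_iff)

definition locally_finite :: "('i \<times> 'i) set \<Rightarrow> bool" where
  "locally_finite E \<longleftrightarrow> (\<forall>i. finite (E `` {i})) \<and> (\<forall>i. finite (E\<inverse> `` {i}))"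

lemma locally_finite_Id: "locally_finite Relation.Id"
  by (auto simp: locally_finite_def)

lemma locally_finite_comp: "locally_finite E \<Longrightarrow> locally_finite E' \<Longrightarrow> locally_finite (E O E')"
proof -
  assume *: "locally_finite E" "locally_finite E'"
  have "(E O E') `` {i} = (\<Union>j\<in>E `` {i}. E' `` {j})" "(E O E')\<inverse> `` {i} = (\<Union>j\<in>E'\<inverse> `` {i}. E\<inverse> `` {j})" for i
    by auto
  then show ?thesis using * by (auto simp: locally_finite_def)
qed

lemma locally_finite_subset: "locally_finite E \<Longrightarrow> E' \<subseteq> E \<Longrightarrow> locally_finite E'"
  unfolding locally_finite_def by (meson Image_mono converse_mono finite_subset subset_refl)

lemma locally_finite_Un: "locally_finite E \<Longrightarrow> locally_finite E' \<Longrightarrow> locally_finite (E \<union> E')"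
  by (simp add: locally_finite_def Un_Image converse_Un)

lemma restr_restr: "restr N Z (restr N Z' s) = restr N (Z \<inter> Z') s"
  by (auto simp: restr_def)

lemma supp_restr_subset: "supp N (restr N Z s) \<subseteq> Z"
  by (auto simp: supp_restr)

lemma local_op_restr:
  assumes "modfam R N" "\<forall>\<rho>\<in>H. (\<forall>i. \<rho> i \<in> J \<longleftrightarrow> i \<in> J) \<and> (\<forall>i. N (\<rho> i) = N i)"
  shows "local_op R N H (restr N J) Relation.Id"
  unfolding local_op_def
proof (intro conjI)
  show "linop R N (restr N J)"
    unfolding linop_def using sec_restr[OF assms(1)]
    by (auto simp: restr_def sadd_def smul_def fun_eq_iff modfam_ops[OF assms(1)])
  show "eqv N H (restr N J)" using assms(2) by (auto simp: eqv_def restr_def fun_eq_iff)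
  show "loc N (restr N J) Relation.Id" by (auto simp: loc_def supp_restr)
qed

lemma sec_supp_empty: "supp N s = {} \<Longrightarrow> s = (\<lambda>i. \<zero>\<^bsub>N i\<^esub>)"
  by (auto simp: supp_def)

text \<open>An index \<open>i\<close> stands for a summand \<open>N i\<close> at the point \<open>pos i\<close>, and \<open>key\<close> separates the summands over
  one point. As keys are invariant under the group, a geometric module built from them is invariant
  on the nose, as the definition of the objects demands, and not only up to isomorphism.\<close>

locale index_system = line_data D setp
  for D :: "('g, 'x::topological_space) line_space" and setp +
  fixes R :: "('r, 'k) ring_scheme" and N :: "'i \<Rightarrow> ('r, 'm) module" and pos :: "'i \<Rightarrow> 'x \<times> real"
    and key :: "'i \<Rightarrow> 'c" and act_ix :: "'g \<Rightarrow> 'i \<Rightarrow> 'i" and I :: "'i set" and \<iota> :: "'r list \<Rightarrow> 'm"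
  assumes R: "ring R" and \<iota>: "inj_on \<iota> (lists (carrier R))"
    and N: "modfam R N"
    and fg: "i \<in> I \<Longrightarrow> fg_free R (N i)"
    and triv: "i \<notin> I \<Longrightarrow> carrier (N i) = {\<zero>\<^bsub>N i\<^esub>}"
    and pos: "i \<in> I \<Longrightarrow> pos i \<in> cone"
    and pos_key: "i \<in> I \<Longrightarrow> j \<in> I \<Longrightarrow> pos i = pos j \<Longrightarrow> key i = key j \<Longrightarrow> i = j"
    and fin: "finite {i \<in> I. carrier (N i) \<noteq> {\<zero>\<^bsub>N i\<^esub>} \<and> proj D (fst (pos i)) \<in> {a..b} \<and> snd (pos i) \<le> h}"
    and fin_fib: "finite {i \<in> I. pos i = y}"
    and act_bij: "g \<in> carrier (grp D) \<Longrightarrow> bij (act_ix g)"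
    and act_N: "g \<in> carrier (grp D) \<Longrightarrow> N (act_ix g i) = N i"
    and act_pos: "g \<in> carrier (grp D) \<Longrightarrow> pos (act_ix g i) = act_cone (act_bar D) g (pos i)"
    and act_key: "g \<in> carrier (grp D) \<Longrightarrow> key (act_ix g i) = key i"
    and act_I: "g \<in> carrier (grp D) \<Longrightarrow> act_ix g i \<in> I \<longleftrightarrow> i \<in> I"
begin

definition "H = act_ix ` carrier (grp D)"

lemma invfam: "invfam N H"
  by (auto simp: invfam_def H_def act_bij act_N)

definition invariant :: "'i set \<Rightarrow> bool" where
  "invariant J \<longleftrightarrow> J \<subseteq> I \<and> (\<forall>g\<in>carrier (grp D). \<forall>i. act_ix g i \<in> J \<longleftrightarrow> i \<in> J)"

definition fib :: "'i set \<Rightarrow> 'x \<times> real \<Rightarrow> 'i set" where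
  "fib J y = {i \<in> J. pos i = y}"

lemma finite_fib: "J \<subseteq> I \<Longrightarrow> finite (fib J y)"
  by (rule finite_subset[OF _ fin_fib[of y]]) (auto simp: fib_def)

lemma supp_I: "s \<in> sec N \<Longrightarrow> supp N s \<subseteq> I"
  using triv sec_carrier by (fastforce simp: supp_def)

lemma sec_comp_act: "g \<in> carrier (grp D) \<Longrightarrow> s \<in> sec N \<Longrightarrow> s \<circ> act_ix g \<in> sec N"
  using sec_comp[OF invfam] by (auto simp: H_def)

lemma act_cone_inj: "g \<in> carrier (grp D) \<Longrightarrow> act_cone (act_bar D) g y = act_cone (act_bar D) g z \<longleftrightarrow> y = z"
proof -
  assume g: "g \<in> carrier (grp D)"
  have "inj (act_bar D g)" using group_action.inj_prop[OF action g] by simp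
  then show ?thesis by (simp add: act_cone_def prod_eq_iff inj_eq)
qed

lemma act_cone_cone: "act_cone (act_bar D) g y \<in> cone \<longleftrightarrow> y \<in> cone"
  by (simp add: cone_iff act_cone_def)

lemma act_fib: "invariant J \<Longrightarrow> g \<in> carrier (grp D) \<Longrightarrow>
    act_ix g i \<in> fib J (act_cone (act_bar D) g y) \<longleftrightarrow> i \<in> fib J y"
  by (simp add: fib_def act_pos act_cone_inj invariant_def)

text \<open>\<open>inn y\<close> and \<open>out y\<close> identify \<open>Z y\<close> with the sections supported on the indices in \<open>J\<close> over \<open>y\<close>.\<close>

definition pres :: "'i set \<Rightarrow> ('x \<times> real \<Rightarrow> ('r, 'm) module) \<Rightarrow> ('x \<times> real \<Rightarrow> 'm \<Rightarrow> 'i \<Rightarrow> 'm) \<Rightarrow>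
    ('x \<times> real \<Rightarrow> ('i \<Rightarrow> 'm) \<Rightarrow> 'm) \<Rightarrow> bool" where
  "pres J Z inn out \<longleftrightarrow> invariant J \<and> Z \<in> O_objs R D \<and>
     (\<forall>y\<in>cone. \<forall>s\<in>sec N. out y s \<in> carrier (Z y)) \<and>
     (\<forall>y\<in>cone. \<forall>s\<in>sec N. \<forall>t\<in>sec N. out y (sadd N s t) = out y s \<oplus>\<^bsub>Z y\<^esub> out y t) \<and>
     (\<forall>y\<in>cone. \<forall>a\<in>carrier R. \<forall>s\<in>sec N. out y (smul N a s) = a \<odot>\<^bsub>Z y\<^esub> out y s) \<and>
     (\<forall>y\<in>cone. \<forall>v\<in>carrier (Z y). inn y v \<in> sec N \<and> out y (inn y v) = v) \<and>
     (\<forall>y\<in>cone. \<forall>s\<in>sec N. inn y (out y s) = restr N (fib J y) s) \<and>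
     (\<forall>g\<in>carrier (grp D). \<forall>y\<in>cone. \<forall>s\<in>sec N. out (act_cone (act_bar D) g y) s = out y (s \<circ> act_ix g))"

end

section \<open>Objects read off from sections, and the matrices of operators between them\<close>

locale presented = index_system +
  fixes J Z inn out
  assumes pres: "pres J Z inn out"
begin

lemma J: "invariant J" "J \<subseteq> I"
  using pres by (auto simp: pres_def invariant_def)

lemma Z: "Z \<in> O_objs R D"
  using pres by (auto simp: pres_def)

lemma out_closed: "y \<in> cone \<Longrightarrow> s \<in> sec N \<Longrightarrow> out y s \<in> carrier (Z y)"
  using pres by (auto simp: pres_def)

lemma out_add: "y \<in> cone \<Longrightarrow> s \<in> sec N \<Longrightarrow> t \<in> sec N \<Longrightarrow> out y (sadd N s t) = out y s \<oplus>\<^bsub>Z y\<^esub> out y t"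
  using pres by (auto simp: pres_def)

lemma out_smul: "y \<in> cone \<Longrightarrow> a \<in> carrier R \<Longrightarrow> s \<in> sec N \<Longrightarrow> out y (smul N a s) = a \<odot>\<^bsub>Z y\<^esub> out y s"
  using pres by (auto simp: pres_def)

lemma inn_sec: "y \<in> cone \<Longrightarrow> v \<in> carrier (Z y) \<Longrightarrow> inn y v \<in> sec N"
  using pres by (auto simp: pres_def)

lemma out_inn: "y \<in> cone \<Longrightarrow> v \<in> carrier (Z y) \<Longrightarrow> out y (inn y v) = v"
  using pres by (auto simp: pres_def)

lemma inn_out: "y \<in> cone \<Longrightarrow> s \<in> sec N \<Longrightarrow> inn y (out y s) = restr N (fib J y) s"
  using pres by (auto simp: pres_def)

lemma out_act: "g \<in> carrier (grp D) \<Longrightarrow> y \<in> cone \<Longrightarrow> s \<in> sec N \<Longrightarrow>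
    out (act_cone (act_bar D) g y) s = out y (s \<circ> act_ix g)"
  using pres by (auto simp: pres_def)

lemma left_module_Z: "y \<in> cone \<Longrightarrow> left_module R (Z y)"
  using Z by (auto simp: O_objs_def geom_module_def fg_free_def)

lemma abelian_group_Z: "y \<in> cone \<Longrightarrow> abelian_group (Z y)"
  using left_moduleD left_module_Z by blast

lemma Z_act: "g \<in> carrier (grp D) \<Longrightarrow> y \<in> cone \<Longrightarrow> Z (act_cone (act_bar D) g y) = Z y"
  using Z by (auto simp: O_objs_def inv_module_def)

lemma out_restr: "y \<in> cone \<Longrightarrow> s \<in> sec N \<Longrightarrow> out y (restr N (fib J y) s) = out y s"
  by (metis inn_out out_closed out_inn)

lemma restr_inn: "y \<in> cone \<Longrightarrow> v \<in> carrier (Z y) \<Longrightarrow> restr N (fib J y) (inn y v) = inn y v"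
  by (metis inn_out inn_sec out_inn)

lemma supp_inn: "y \<in> cone \<Longrightarrow> v \<in> carrier (Z y) \<Longrightarrow> supp N (inn y v) \<subseteq> fib J y"
  by (metis restr_inn supp_restr_subset)

lemma out_zero: "y \<in> cone \<Longrightarrow> out y (\<lambda>i. \<zero>\<^bsub>N i\<^esub>) = \<zero>\<^bsub>Z y\<^esub>"
proof -
  assume y: "y \<in> cone"
  interpret Z: abelian_group "Z y" using y by (rule abelian_group_Z)
  let ?z = "\<lambda>i. \<zero>\<^bsub>N i\<^esub>"
  have z: "?z \<in> sec N" by (rule sec_zero[OF N])
  have "sadd N ?z ?z = ?z" by (auto simp: sadd_def modfam_ops[OF N])
  then have "out y ?z \<oplus>\<^bsub>Z y\<^esub> out y ?z = out y ?z" using out_add[OF y z z] by simp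
  then show ?thesis using out_closed[OF y z] by (metis Z.add.r_cancel_one)
qed

lemma out_off: "y \<in> cone \<Longrightarrow> s \<in> sec N \<Longrightarrow> supp N s \<inter> fib J y = {} \<Longrightarrow> out y s = \<zero>\<^bsub>Z y\<^esub>"
proof -
  assume *: "y \<in> cone" "s \<in> sec N" "supp N s \<inter> fib J y = {}"
  then have "supp N (restr N (fib J y) s) = {}" by (auto simp: supp_restr)
  from sec_supp_empty[OF this] show ?thesis using out_restr[OF *(1,2)] out_zero[OF *(1)] by simp
qed

lemma inn_add:
  assumes y: "y \<in> cone" and v: "v \<in> carrier (Z y)" "w \<in> carrier (Z y)"
  shows "inn y (v \<oplus>\<^bsub>Z y\<^esub> w) = sadd N (inn y v) (inn y w)"
proof -
  have s: "sadd N (inn y v) (inn y w) \<in> sec N" using inn_sec[OF y] v by (intro sec_sadd[OF N]) auto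
  have "inn y (v \<oplus>\<^bsub>Z y\<^esub> w) = inn y (out y (sadd N (inn y v) (inn y w)))"
    using v inn_sec[OF y] by (simp add: out_add[OF y] out_inn[OF y])
  also have "\<dots> = restr N (fib J y) (sadd N (inn y v) (inn y w))" by (rule inn_out[OF y s])
  also have "\<dots> = sadd N (restr N (fib J y) (inn y v)) (restr N (fib J y) (inn y w))"
    by (auto simp: restr_def sadd_def modfam_ops[OF N])
  finally show ?thesis using restr_inn[OF y] v by simp
qed

lemma inn_smul:
  assumes y: "y \<in> cone" and v: "v \<in> carrier (Z y)" and a: "a \<in> carrier R"
  shows "inn y (a \<odot>\<^bsub>Z y\<^esub> v) = smul N a (inn y v)"
proof -
  have s: "smul N a (inn y v) \<in> sec N" using inn_sec[OF y] v by (intro sec_smul[OF N] a) auto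
  have "inn y (a \<odot>\<^bsub>Z y\<^esub> v) = inn y (out y (smul N a (inn y v)))"
    using v inn_sec[OF y] by (simp add: out_smul[OF y a] out_inn[OF y])
  also have "\<dots> = restr N (fib J y) (smul N a (inn y v))" by (rule inn_out[OF y s])
  also have "\<dots> = smul N a (restr N (fib J y) (inn y v))"
    using a by (auto simp: restr_def smul_def modfam_ops[OF N])
  finally show ?thesis using restr_inn[OF y] v by simp
qed

text \<open>Since \<open>inn\<close> is determined by \<open>out\<close> and the fibre, its
  equivariance is inherited from that of \<open>out\<close> and of the fibres.\<close>

lemma inn_act:
  assumes g: "g \<in> carrier (grp D)" and y: "y \<in> cone" and v: "v \<in> carrier (Z y)"
  shows "inn y v = inn (act_cone (act_bar D) g y) v \<circ> act_ix g"
proof -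
  let ?gy = "act_cone (act_bar D) g y"
  have gy: "?gy \<in> cone" using y by (simp add: act_cone_cone)
  have v': "v \<in> carrier (Z ?gy)" using v Z_act[OF g y] by simp
  let ?s = "inn ?gy v"
  have s: "?s \<in> sec N" by (rule inn_sec[OF gy v'])
  have "v = out y (?s \<circ> act_ix g)" using out_act[OF g y s] out_inn[OF gy v'] by simp
  then have "inn y v = restr N (fib J y) (?s \<circ> act_ix g)"
    using inn_out[OF y sec_comp_act[OF g s]] by simp
  also have "\<dots> = restr N (fib J ?gy) ?s \<circ> act_ix g"
    by (auto simp: restr_def act_fib[OF J(1) g] act_N[OF g])
  finally show ?thesis using restr_inn[OF gy v'] by simp
qed

end

context index_system
begin

definition pos_rel :: "('i \<times> 'i) set \<Rightarrow> ((real \<times> real) \<times> (real \<times> real)) set" where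
  "pos_rel E = (\<lambda>(i, j). (cone_line D (pos i), cone_line D (pos j))) ` (E \<inter> I \<times> I)"

text \<open>What makes the matrix of \<open>T\<close> a morphism: local finiteness gives finite rows
  and columns, \<open>ctrl\<close> yields a relation in \<open>E_Gcc\<close>, and
  \<open>local_op\<close> supplies linear and invariant entries.\<close>

definition good :: "('i, 'm) operator \<Rightarrow> bool" where
  "good T \<longleftrightarrow> (\<exists>E. local_op R N H T E \<and> locally_finite E \<and> ctrl (pos_rel E))"

lemma good_linop: "good T \<Longrightarrow> linop R N T"
  by (auto simp: good_def local_op_def)

lemma good_sec: "good T \<Longrightarrow> s \<in> sec N \<Longrightarrow> T s \<in> sec N"
  using good_linop linopD(1) by blast

lemma goodI: "local_op R N H T E \<Longrightarrow> locally_finite E \<Longrightarrow> ctrl (pos_rel E) \<Longrightarrow> good T"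
  by (auto simp: good_def)

lemma good_id: "good (\<lambda>s. s)"
proof (rule goodI[OF local_op_id locally_finite_Id])
  show "ctrl (pos_rel Relation.Id)"
    by (rule ctrl_subset[OF ctrl_Id]) (auto simp: pos_rel_def cone_line_def)
qed

lemma good_restr: "invariant J \<Longrightarrow> good (restr N J)"
proof (rule goodI[OF local_op_restr[OF N] locally_finite_Id])
  show "ctrl (pos_rel Relation.Id)"
    by (rule ctrl_subset[OF ctrl_Id]) (auto simp: pos_rel_def cone_line_def)
qed (auto simp: H_def act_N invariant_def)

lemma good_comp:
  assumes "good T" "good S"
  shows "good (\<lambda>s. S (T s))"
proof -
  obtain E where E: "local_op R N H T E" "locally_finite E" "ctrl (pos_rel E)" using assms(1) by (auto simp: good_def)
  obtain F where F: "local_op R N H S F" "locally_finite F" "ctrl (pos_rel F)" using assms(2) by (auto simp: good_def)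
  \<comment> \<open>\<open>pos_rel\<close> sees only pairs in \<open>I\<close>, so an uncontrolled
    detour through an index off \<open>I\<close> has to be excluded before composing.\<close>
  let ?E = "(E \<inter> I \<times> I) O (F \<inter> I \<times> I)"
  note restrict = local_op_restrict[OF _ supp_I]
  show ?thesis
  proof (rule goodI)
    show "local_op R N H (\<lambda>s. S (T s)) ?E" using restrict[OF E(1)] restrict[OF F(1)] by (rule local_op_comp)
    show "locally_finite ?E"
      by (rule locally_finite_subset[OF locally_finite_comp[OF E(2) F(2)]]) auto
    show "ctrl (pos_rel ?E)"
      by (rule ctrl_subset[OF ctrl_comp[OF E(3) F(3)]]) (force simp: pos_rel_def)
  qed
qed

definition mor :: "('x \<times> real \<Rightarrow> ('r, 'm) module) \<Rightarrow> ('x \<times> real \<Rightarrow> 'm \<Rightarrow> 'i \<Rightarrow> 'm) \<Rightarrow>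
    ('x \<times> real \<Rightarrow> ('i \<Rightarrow> 'm) \<Rightarrow> 'm) \<Rightarrow> ('i, 'm) operator \<Rightarrow> 'x \<times> real \<Rightarrow> 'x \<times> real \<Rightarrow> 'm \<Rightarrow> 'm" where
  "mor Z inn out T = (\<lambda>x\<in>cone. \<lambda>y\<in>cone. \<lambda>v\<in>carrier (Z x). out y (T (inn x v)))"

end

locale presented2 = A: presented D setp R N pos key act_ix I \<iota> J Z inn out +
  B: presented D setp R N pos key act_ix I \<iota> J' Z' inn' out'
  for D :: "('g, 'x::topological_space) line_space" and setp and R :: "('r, 'k) ring_scheme"
    and N :: "'i \<Rightarrow> ('r, 'm) module" and pos and key :: "'i \<Rightarrow> 'c" and act_ix I \<iota> J Z inn out J' Z' inn' out'
begin

abbreviation "morAB T \<equiv> A.mor Z inn out' T"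

lemma mor_supp_mor:
  assumes "local_op R N A.H T E"
  shows "mor_supp cone_top Z Z' (morAB T) \<subseteq> (\<lambda>(i, j). (pos i, pos j)) ` (E \<inter> J \<times> J')"
proof clarify
  fix x r y s assume "((x, r), (y, s)) \<in> mor_supp cone_top Z Z' (morAB T)"
  then obtain u w where uw: "u = (x, r)" "w = (y, s)" "u \<in> cone" "w \<in> cone" "morAB T u w \<noteq> zero_map (Z u) (Z' w)"
    by (auto simp: mor_supp_def)
  then obtain v where v: "v \<in> carrier (Z u)" "out' w (T (inn u v)) \<noteq> \<zero>\<^bsub>Z' w\<^esub>"
    by (auto simp: A.mor_def zero_map_def restrict_def fun_eq_iff split: if_splits)
  have s: "inn u v \<in> sec N" by (rule A.inn_sec[OF uw(3) v(1)])
  then have "supp N (T (inn u v)) \<inter> A.fib J' w \<noteq> {}"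
    using B.out_off[OF uw(4)] local_op_sec[OF assms] v(2) by blast
  then obtain j where j: "j \<in> supp N (T (inn u v))" "j \<in> J'" "pos j = w" by (auto simp: A.fib_def)
  then obtain i where i: "i \<in> supp N (inn u v)" "(i, j) \<in> E" using local_op_supp[OF assms s] by blast
  then have "i \<in> J" "pos i = u" using A.supp_inn[OF uw(3) v(1)] by (auto simp: A.fib_def)
  then show "((x, r), (y, s)) \<in> (\<lambda>(i, j). (pos i, pos j)) ` (E \<inter> J \<times> J')"
    using i j uw by force
qed

lemma mor_lin:
  assumes T: "linop R N T" and x: "x \<in> cone" and y: "y \<in> cone"
  shows "morAB T x y \<in> lin_maps R (Z x) (Z' y)"
proof -
  interpret M: left_module R "Z x" by (rule A.left_module_Z[OF x])
  have "morAB T x y = (\<lambda>v\<in>carrier (Z x). out' y (T (inn x v)))" using x y by (simp add: A.mor_def)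
  moreover have "(\<lambda>v\<in>carrier (Z x). out' y (T (inn x v))) \<in> lin_maps R (Z x) (Z' y)"
    unfolding lin_maps_def
    by (auto simp: M.smult_closed A.inn_sec[OF x] linopD[OF T] A.inn_add[OF x] A.inn_smul[OF x]
        B.out_add[OF y] B.out_smul[OF y] intro!: B.out_closed[OF y])
  ultimately show ?thesis by simp
qed

lemma mor_homs:
  assumes "A.good T"
  shows "morAB T \<in> O_homs R D Z Z'"
proof -
  obtain E where E: "local_op R N A.H T E" "locally_finite E" "ctrl (A.pos_rel E)"
    using assms by (auto simp: A.good_def)
  note ms = mor_supp_mor[OF E(1)]
  have fin: "finite {x. (x, y) \<in> mor_supp cone_top Z Z' (morAB T)}"
    "finite {x. (y, x) \<in> mor_supp cone_top Z Z' (morAB T)}" for y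
  proof -
    have "{x. (x, y) \<in> mor_supp cone_top Z Z' (morAB T)} \<subseteq> pos ` (\<Union>j\<in>A.fib J' y. E\<inverse> `` {j})"
      using ms by (fastforce simp: A.fib_def)
    moreover have "finite (\<Union>j\<in>A.fib J' y. E\<inverse> `` {j})"
      using A.finite_fib[OF B.J(2)] E(2) by (auto simp: locally_finite_def)
    ultimately show "finite {x. (x, y) \<in> mor_supp cone_top Z Z' (morAB T)}"
      by (meson finite_imageI finite_subset)
    have "{x. (y, x) \<in> mor_supp cone_top Z Z' (morAB T)} \<subseteq> pos ` (\<Union>j\<in>A.fib J y. E `` {j})"
      using ms by (fastforce simp: A.fib_def)
    moreover have "finite (\<Union>j\<in>A.fib J y. E `` {j})"
      using A.finite_fib[OF A.J(2)] E(2) by (auto simp: locally_finite_def)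
    ultimately show "finite {x. (y, x) \<in> mor_supp cone_top Z Z' (morAB T)}"
      by (meson finite_imageI finite_subset)
  qed
  have "morAB T \<in> (\<Pi>\<^sub>E x\<in>cone. \<Pi>\<^sub>E y\<in>cone. lin_maps R (Z x) (Z' y))"
  proof (rule PiE_I, rule PiE_I)
    show "morAB T x y \<in> lin_maps R (Z x) (Z' y)" if "x \<in> cone" "y \<in> cone" for x y
      by (rule mor_lin[OF local_opD(1)[OF E(1)] that])
  qed (auto simp: A.mor_def)
  then have geom: "morAB T \<in> geom_mor R cone_top Z Z'" using fin by (auto simp: geom_mor_def)
  have inv: "inv_mor (grp D) (act_cone (act_bar D)) cone_top (morAB T)"
    unfolding inv_mor_def
  proof (intro ballI)
    fix g x y assume g: "g \<in> carrier (grp D)" and x: "x \<in> (cone :: ('x \<times> real) set)" and y: "y \<in> (cone :: ('x \<times> real) set)"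
    let ?a = "act_cone (act_bar D) g"
    have gx: "?a x \<in> cone" "?a y \<in> cone" using x y by (auto simp: A.act_cone_cone)
    have "out' (?a y) (T (inn (?a x) v)) = out' y (T (inn x v))" if v: "v \<in> carrier (Z x)" for v
    proof -
      have v': "v \<in> carrier (Z (?a x))" using v A.Z_act[OF g x] by simp
      have s: "inn (?a x) v \<in> sec N" by (rule A.inn_sec[OF gx(1) v'])
      have "out' (?a y) (T (inn (?a x) v)) = out' y (T (inn (?a x) v) \<circ> act_ix g)"
        by (rule B.out_act[OF g y local_op_sec[OF E(1) s]])
      also have "T (inn (?a x) v) \<circ> act_ix g = T (inn (?a x) v \<circ> act_ix g)"
        using local_opD(2)[OF E(1)] s g by (auto simp: eqv_def A.H_def)
      also have "inn (?a x) v \<circ> act_ix g = inn x v" by (rule A.inn_act[OF g x v, symmetric])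
      finally show ?thesis .
    qed
    then show "morAB T (?a x) (?a y) = morAB T x y"
      using x y gx by (auto simp: A.mor_def A.Z_act[OF g x])
  qed
  have "A.pos_rel E \<subseteq> (UNIV \<times> {1..}) \<times> (UNIV \<times> {1..})"
    using A.pos by (auto simp: A.pos_rel_def cone_line_def cone_iff)
  then obtain F where F: "F \<in> E_Gcc (grp D) (act_line D)" "A.pos_rel E \<subseteq> F"
    using A.ctrl_E_Gcc[OF E(3)] by blast
  have "((proj D x, t), (proj D y, s)) \<in> F" if m: "((x, t), (y, s)) \<in> mor_supp cone_top Z Z' (morAB T)" for x t y s
  proof -
    obtain i j where ij: "(i, j) \<in> E" "i \<in> J" "j \<in> J'" "pos i = (x, t)" "pos j = (y, s)" using ms m by auto
    then have "(cone_line D (pos i), cone_line D (pos j)) \<in> A.pos_rel E"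
      unfolding A.pos_rel_def using A.J(2) B.J(2) by (intro image_eqI[of _ _ "(i, j)"]) auto
    then show ?thesis using F(2) ij by (auto simp: cone_line_def)
  qed
  then have "\<forall>((x, t), (y, s))\<in>mor_supp cone_top Z Z' (morAB T). ((proj D x, t), (proj D y, s)) \<in> F" by auto
  then show ?thesis using geom inv F(1) unfolding O_homs_def by blast
qed

text \<open>A morphism sees an operator only on sections supported in \<open>J\<close> and reads the
  result only on \<open>J'\<close>.\<close>

lemma mor_cong:
  assumes "\<And>s. s \<in> sec N \<Longrightarrow> supp N s \<subseteq> J \<Longrightarrow> restr N J' (T s) = restr N J' (S s)"
    and T: "linop R N T" and S: "linop R N S"
  shows "morAB T = morAB S"
proof -
  have "out' y (T (inn x v)) = out' y (S (inn x v))" if x: "x \<in> cone" and y: "y \<in> cone" and v: "v \<in> carrier (Z x)" for x y v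
  proof -
    have s: "inn x v \<in> sec N" by (rule A.inn_sec[OF x v])
    have "supp N (inn x v) \<subseteq> J" using A.supp_inn[OF x v] by (auto simp: A.fib_def)
    from assms(1)[OF s this] have "restr N (A.fib J' y) (T (inn x v)) = restr N (A.fib J' y) (S (inn x v))"
      by (auto simp: restr_def fun_eq_iff A.fib_def split: if_splits)
    then show ?thesis
      using B.out_restr[OF y linopD(1)[OF T s]] B.out_restr[OF y linopD(1)[OF S s]] by simp
  qed
  then show ?thesis by (auto simp: A.mor_def fun_eq_iff restrict_def)
qed

end

text \<open>Distinct points have disjoint fibres, so additivity gathers the summands into one
  section. This evaluates the sum over intermediate points in a matrix product.\<close>

lemma (in index_system) sum_fibres:
  assumes M: "abelian_group M" and f: "\<And>s. s \<in> sec N \<Longrightarrow> f s \<in> carrier M"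
    and add: "\<And>s t. s \<in> sec N \<Longrightarrow> t \<in> sec N \<Longrightarrow> f (sadd N s t) = f s \<oplus>\<^bsub>M\<^esub> f t"
    and t: "t \<in> sec N" and Y: "finite Y"
  shows "(\<Oplus>\<^bsub>M\<^esub>y\<in>Y. f (restr N (fib J y) t)) = f (restr N (\<Union>y\<in>Y. fib J y) t)"
  using Y
proof (induction Y rule: finite_induct)
  interpret M: abelian_group M by (rule M)
  let ?z = "\<lambda>i. \<zero>\<^bsub>N i\<^esub>"
  case empty
  have z: "?z \<in> sec N" by (rule sec_zero[OF N])
  have "sadd N ?z ?z = ?z" by (auto simp: sadd_def modfam_ops[OF N])
  then have "f ?z = \<zero>\<^bsub>M\<^esub>" using add[OF z z] f[OF z] by (metis M.add.r_cancel_one)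
  moreover have "restr N (\<Union>y\<in>{}. fib J y) t = ?z" by (simp add: restr_def)
  ultimately show ?case by simp
next
  interpret M: abelian_group M by (rule M)
  case (insert y Y)
  have s: "restr N X t \<in> sec N" for X by (rule sec_restr[OF N t])
  have "(\<Oplus>\<^bsub>M\<^esub>y\<in>insert y Y. f (restr N (fib J y) t)) = f (restr N (fib J y) t) \<oplus>\<^bsub>M\<^esub> (\<Oplus>\<^bsub>M\<^esub>y\<in>Y. f (restr N (fib J y) t))"
    using insert.hyps f s by (intro M.finsum_insert) auto
  also have "\<dots> = f (sadd N (restr N (fib J y) t) (restr N (\<Union>y\<in>Y. fib J y) t))"
    using insert.IH add[OF s s] by simp
  also have "sadd N (restr N (fib J y) t) (restr N (\<Union>y\<in>Y. fib J y) t) = restr N (\<Union>y\<in>insert y Y. fib J y) t"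
    using insert.hyps by (subst sadd_restr[OF N t]) (auto simp: fib_def)
  finally show ?case .
qed

locale presented3 = AB: presented2 D setp R N pos key act_ix I \<iota> J Z inn out J' Z' inn' out' +
  C: presented D setp R N pos key act_ix I \<iota> J'' Z'' inn'' out''
  for D :: "('g, 'x::topological_space) line_space" and setp and R :: "('r, 'k) ring_scheme"
    and N :: "'i \<Rightarrow> ('r, 'm) module" and pos and key :: "'i \<Rightarrow> 'c" and act_ix I \<iota> J Z inn out J' Z' inn' out' J'' Z'' inn'' out''
begin

text \<open>Passing through the middle object cuts a section down to \<open>J'\<close>; the sum over
  its points is then gathered inside one application of \<open>S\<close>.\<close>

lemma mor_comp_mor:
  assumes T: "AB.A.good T" and S: "linop R N S"
  shows "mor_comp cone_top Z Z' Z'' (AB.A.mor Z' inn' out'' S) (AB.A.mor Z inn out' T) =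
    AB.A.mor Z inn out'' (\<lambda>s. S (restr N J' (T s)))"
proof -
  let ?\<phi> = "AB.A.mor Z inn out' T"
  have T': "linop R N T" by (rule AB.A.good_linop[OF T])
  have "(\<Oplus>\<^bsub>Z'' z\<^esub>y\<in>{y. (x, y) \<in> mor_supp cone_top Z Z' ?\<phi>}. AB.A.mor Z' inn' out'' S y z (?\<phi> x y v)) =
      out'' z (S (restr N J' (T (inn x v))))"
    if x: "x \<in> cone" and z: "z \<in> cone" and v: "v \<in> carrier (Z x)" for x z v
  proof -
    let ?Y = "{y. (x, y) \<in> mor_supp cone_top Z Z' ?\<phi>}"
    let ?t = "T (inn x v)"
    interpret M: abelian_group "Z'' z" by (rule C.abelian_group_Z[OF z])
    have t: "?t \<in> sec N" by (rule linopD(1)[OF T' AB.A.inn_sec[OF x v]])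
    have Y: "finite ?Y" "?Y \<subseteq> cone"
      using AB.mor_homs[OF T] x by (auto simp: O_homs_def geom_mor_def mor_supp_def)
    have s: "restr N X ?t \<in> sec N" for X by (rule sec_restr[OF AB.A.N t])
    have "(\<Oplus>\<^bsub>Z'' z\<^esub>y\<in>?Y. AB.A.mor Z' inn' out'' S y z (?\<phi> x y v)) =
        (\<Oplus>\<^bsub>Z'' z\<^esub>y\<in>?Y. out'' z (S (restr N (AB.A.fib J' y) ?t)))"
    proof (rule M.finsum_cong')
      show "(\<lambda>y. out'' z (S (restr N (AB.A.fib J' y) ?t))) \<in> ?Y \<rightarrow> carrier (Z'' z)"
        using C.out_closed[OF z linopD(1)[OF S s]] by auto
      fix y assume "y \<in> ?Y"
      then have y: "y \<in> cone" using Y by auto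
      have "?\<phi> x y v = out' y ?t" using x y v by (simp add: AB.A.mor_def)
      moreover have "out' y ?t \<in> carrier (Z' y)" by (rule AB.B.out_closed[OF y t])
      ultimately show "AB.A.mor Z' inn' out'' S y z (?\<phi> x y v) = out'' z (S (restr N (AB.A.fib J' y) ?t))"
        using y z by (simp add: AB.A.mor_def[of Z'] AB.B.inn_out[OF y t])
    qed simp
    also have "\<dots> = out'' z (S (restr N (\<Union>y\<in>?Y. AB.A.fib J' y) ?t))"
      by (rule AB.A.sum_fibres[OF M.abelian_group_axioms _ _ t Y(1)])
         (auto simp: C.out_add[OF z] linopD[OF S] intro!: C.out_closed[OF z])
    also have "restr N (\<Union>y\<in>?Y. AB.A.fib J' y) ?t = restr N J' ?t"
    proof
      fix i
      show "restr N (\<Union>y\<in>?Y. AB.A.fib J' y) ?t i = restr N J' ?t i"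
      \<comment> \<open>A point over \<open>J'\<close> is missing from the sum only if its entry is
        zero; as \<open>inn'\<close> recovers the section from \<open>out'\<close>, the section
        itself then vanishes on that fibre.\<close>
      proof (cases "i \<in> J' \<and> pos i \<notin> ?Y")
        case True
        have y: "pos i \<in> cone" using True AB.B.J(2) AB.A.pos by auto
        have "?\<phi> x (pos i) = zero_map (Z x) (Z' (pos i))" using True x y by (auto simp: mor_supp_def)
        from fun_cong[OF this, of v] have "out' (pos i) ?t = \<zero>\<^bsub>Z' (pos i)\<^esub>"
          using x y v by (simp add: AB.A.mor_def zero_map_def)
        then have "restr N (AB.A.fib J' (pos i)) ?t = inn' (pos i) \<zero>\<^bsub>Z' (pos i)\<^esub>"
          using AB.B.inn_out[OF y t] by simp
        also have "\<dots> = restr N (AB.A.fib J' (pos i)) (\<lambda>i. \<zero>\<^bsub>N i\<^esub>)"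
          using AB.B.inn_out[OF y sec_zero[OF AB.A.N]] AB.B.out_zero[OF y] by simp
        finally have "?t i = \<zero>\<^bsub>N i\<^esub>" using True by (auto simp: restr_def AB.A.fib_def fun_eq_iff split: if_splits)
        then show ?thesis by (simp add: restr_def)
      qed (auto simp: restr_def AB.A.fib_def)
    qed
    finally show ?thesis .
  qed
  then show ?thesis
    unfolding mor_comp_def by (auto simp: AB.A.mor_def[of Z _ _ "\<lambda>s. S (restr N J' (T s))"] fun_eq_iff restrict_def)
qed

end

context presented
begin

lemma mor_id_mor: "mor Z inn out (\<lambda>s. s) = mor_id cone_top Z"
proof -
  have "out y (inn x v) = (if x = y then v else \<zero>\<^bsub>Z y\<^esub>)"
    if x: "x \<in> cone" and y: "y \<in> cone" and v: "v \<in> carrier (Z x)" for x y v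
  proof (cases "x = y")
    case True then show ?thesis using out_inn[OF x v] by simp
  next
    case False
    then have "supp N (inn x v) \<inter> fib J y = {}" using supp_inn[OF x v] by (auto simp: fib_def)
    then show ?thesis using False out_off[OF y inn_sec[OF x v]] by simp
  qed
  then show ?thesis by (auto simp: mor_def mor_id_def zero_map_def fun_eq_iff restrict_def)
qed

lemma mor_add_mor:
  assumes "linop R N T" "linop R N S"
  shows "mor_add cone_top Z Z (mor Z inn out T) (mor Z inn out S) = mor Z inn out (\<lambda>s. sadd N (T s) (S s))"
  unfolding mor_add_def mor_def using inn_sec linopD(1)[OF assms(1)] linopD(1)[OF assms(2)]
  by (auto simp: fun_eq_iff restrict_def out_add)

end

section \<open>A strictly invariant object for every invariant set of indices\<close>

context index_system
begin

text \<open>The choice depends on the module and not on the index, so indices in one orbit, which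
  carry equal modules, receive the same basis.\<close>

definition bas :: "('r, 'm) module \<Rightarrow> 'm set" where
  "bas M = (SOME B. is_basis R M B)"

text \<open>Labels mention keys instead of indices; as keys and bases are constant on orbits, the
  points of an orbit have literally the same set of labels and hence equal modules.\<close>

definition lab :: "'i set \<Rightarrow> 'x \<times> real \<Rightarrow> ('c \<times> 'm) set" where
  "lab J y = (\<Union>i\<in>fib J y. {key i} \<times> bas (N i))"

definition ix :: "'i set \<Rightarrow> 'x \<times> real \<Rightarrow> 'c \<Rightarrow> 'i" where
  "ix J y c = (THE i. i \<in> fib J y \<and> key i = c)"

definition std_mod :: "'i set \<Rightarrow> 'x \<times> real \<Rightarrow> ('r, 'm) module" where
  "std_mod J = (\<lambda>y\<in>cone. free_module R (lab J y) (list_emb \<iota> (lab J y)))"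

definition std_fun :: "'i set \<Rightarrow> 'x \<times> real \<Rightarrow> ('i \<Rightarrow> 'm) \<Rightarrow> 'c \<times> 'm \<Rightarrow> 'r" where
  "std_fun J y s = (\<lambda>l\<in>lab J y. let i = ix J y (fst l) in coord R (N i) (bas (N i)) (s i) (snd l))"

definition std_out :: "'i set \<Rightarrow> 'x \<times> real \<Rightarrow> ('i \<Rightarrow> 'm) \<Rightarrow> 'm" where
  "std_out J y s = list_emb \<iota> (lab J y) (std_fun J y s)"

definition std_inn :: "'i set \<Rightarrow> 'x \<times> real \<Rightarrow> 'm \<Rightarrow> 'i \<Rightarrow> 'm" where
  "std_inn J y v = (let f = inv_into (lab J y \<rightarrow>\<^sub>E carrier R) (list_emb \<iota> (lab J y)) v in
     (\<lambda>i. if i \<in> fib J y then (\<Oplus>\<^bsub>N i\<^esub>b\<in>bas (N i). f (key i, b) \<odot>\<^bsub>N i\<^esub> b) else \<zero>\<^bsub>N i\<^esub>))"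

context
  fixes J assumes J: "invariant J"
begin

lemma JI: "J \<subseteq> I"
  using J by (simp add: invariant_def)

lemma based: "i \<in> J \<Longrightarrow> based_module R (N i) (bas (N i))"
proof -
  assume "i \<in> J"
  then have "fg_free R (N i)" using fg JI by auto
  then have "left_module R (N i)" "\<exists>B. is_basis R (N i) B" by (auto simp: fg_free_def)
  then show ?thesis
    by (intro based_module.intro based_module_axioms.intro) (auto simp: bas_def intro: someI_ex)
qed

lemma fib_J: "i \<in> fib J y \<Longrightarrow> i \<in> J"
  by (simp add: fib_def)

lemma finite_lab: "finite (lab J y)"
  using finite_fib[OF JI, of y] based_module.B(1)[OF based] by (auto simp: lab_def fib_def)

lemma ix_key: "i \<in> fib J y \<Longrightarrow> ix J y (key i) = i"
  unfolding ix_def using JI pos_key by (intro the_equality) (auto simp: fib_def)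

lemma lab_iff:
  assumes i: "i \<in> fib J y"
  shows "(key i, b) \<in> lab J y \<longleftrightarrow> b \<in> bas (N i)"
proof
  assume "(key i, b) \<in> lab J y"
  then obtain j where j: "j \<in> fib J y" "key j = key i" "b \<in> bas (N j)" by (auto simp: lab_def)
  have "j = i" using ix_key[OF j(1)] ix_key[OF i] unfolding j(2) by (rule trans[OF sym])
  then show "b \<in> bas (N i)" using j(3) by simp
qed (use i in \<open>auto simp: lab_def\<close>)

lemma labE:
  assumes "l \<in> lab J y" obtains i b where "l = (key i, b)" "i \<in> fib J y" "b \<in> bas (N i)"
  using assms by (auto simp: lab_def)

lemma std_fun: "i \<in> fib J y \<Longrightarrow> b \<in> bas (N i) \<Longrightarrow> std_fun J y s (key i, b) = coord R (N i) (bas (N i)) (s i) b"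
  by (simp add: std_fun_def lab_iff ix_key Let_def)

lemma free_data: "free_module_data R (lab J y) (list_emb \<iota> (lab J y))"
  by (intro free_module_data.intro free_module_data_axioms.intro R finite_lab inj_list_emb \<iota>)

lemma std_fun_closed: "s \<in> sec N \<Longrightarrow> std_fun J y s \<in> lab J y \<rightarrow>\<^sub>E carrier R"
proof -
  assume s: "s \<in> sec N"
  have "std_fun J y s l \<in> carrier R" if "l \<in> lab J y" for l
    using that
  proof (rule labE)
    fix i b assume i: "l = (key i, b)" "i \<in> fib J y" "b \<in> bas (N i)"
    show ?thesis
      using based_module.coord(1)[OF based[OF fib_J[OF i(2)]] sec_carrier[OF s]] i by (auto simp: std_fun)
  qed
  then show ?thesis by (auto simp: std_fun_def)
qed

lemma std_fun_ext:
  assumes "\<And>i b. i \<in> fib J y \<Longrightarrow> b \<in> bas (N i) \<Longrightarrow> f (key i, b) = g (key i, b)"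
    and "f \<in> lab J y \<rightarrow>\<^sub>E carrier R" "g \<in> lab J y \<rightarrow>\<^sub>E carrier R"
  shows "f = g"
  by (rule PiE_ext[OF assms(2,3)]) (auto elim!: labE simp: assms(1))

lemma std_inn_emb:
  assumes "f \<in> lab J y \<rightarrow>\<^sub>E carrier R"
  shows "std_inn J y (list_emb \<iota> (lab J y) f) =
    (\<lambda>i. if i \<in> fib J y then (\<Oplus>\<^bsub>N i\<^esub>b\<in>bas (N i). f (key i, b) \<odot>\<^bsub>N i\<^esub> b) else \<zero>\<^bsub>N i\<^esub>)"
  by (simp add: std_inn_def Let_def inv_into_f_f[OF free_module_data.h[OF free_data] assms])

lemma lab_act: "g \<in> carrier (grp D) \<Longrightarrow> lab J (act_cone (act_bar D) g y) = lab J y"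
proof -
  assume g: "g \<in> carrier (grp D)"
  have "fib J (act_cone (act_bar D) g y) = act_ix g ` fib J y"
  proof (intro equalityI subsetI)
    fix i assume i: "i \<in> fib J (act_cone (act_bar D) g y)"
    obtain j where "i = act_ix g j" using act_bij[OF g] by (metis bij_pointE)
    then show "i \<in> act_ix g ` fib J y" using i act_fib[OF J g] by auto
  qed (auto simp: act_fib[OF J g])
  then show ?thesis by (simp add: lab_def act_key[OF g] act_N[OF g])
qed

lemma std_fun_act:
  assumes g: "g \<in> carrier (grp D)" and s: "s \<in> sec N"
  shows "std_fun J (act_cone (act_bar D) g y) s = std_fun J y (s \<circ> act_ix g)"
proof (rule std_fun_ext[of y])
  show "std_fun J (act_cone (act_bar D) g y) s \<in> lab J y \<rightarrow>\<^sub>E carrier R"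
    using std_fun_closed[OF s, of "act_cone (act_bar D) g y"] by (simp add: lab_act[OF g])
  show "std_fun J y (s \<circ> act_ix g) \<in> lab J y \<rightarrow>\<^sub>E carrier R"
    by (rule std_fun_closed[OF sec_comp_act[OF g s]])
  fix i b assume i: "i \<in> fib J y" "b \<in> bas (N i)"
  have "act_ix g i \<in> fib J (act_cone (act_bar D) g y)" using i by (simp add: act_fib[OF J g])
  from std_fun[OF this, of b s] show "std_fun J (act_cone (act_bar D) g y) s (key i, b) = std_fun J y (s \<circ> act_ix g) (key i, b)"
    using i by (simp add: std_fun act_key[OF g] act_N[OF g])
qed

text \<open>Coordinates in the chosen bases identify the sections over a point with functions on its
  labels, and these with elements of the universe.\<close>

lemma pres_std: "pres J (std_mod J) (std_inn J) (std_out J)"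
proof -
  let ?Z = "std_mod J"
  have Zy: "?Z y = free_module R (lab J y) (list_emb \<iota> (lab J y))" if "y \<in> cone" for y
    using that by (simp add: std_mod_def)
  note carr = free_module_data.carrier_M[OF free_data]
  have 1: "std_out J y s \<in> carrier (?Z y)" if "y \<in> cone" "s \<in> sec N" for y s
    unfolding Zy[OF that(1)] carr std_out_def by (intro imageI std_fun_closed that)
  have 2: "std_out J y (sadd N s t) = std_out J y s \<oplus>\<^bsub>?Z y\<^esub> std_out J y t"
    if y: "y \<in> cone" and s: "s \<in> sec N" and t: "t \<in> sec N" for y s t
  proof -
    interpret ring R by (rule R)
    note st = std_fun_closed[OF s, of y] std_fun_closed[OF t, of y] std_fun_closed[OF sec_sadd[OF N s t], of y]
    have "std_fun J y (sadd N s t) = (\<lambda>l\<in>lab J y. std_fun J y s l \<oplus>\<^bsub>R\<^esub> std_fun J y t l)"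
    proof (rule std_fun_ext[OF _ st(3)])
      show "(\<lambda>l\<in>lab J y. std_fun J y s l \<oplus>\<^bsub>R\<^esub> std_fun J y t l) \<in> lab J y \<rightarrow>\<^sub>E carrier R"
        using st by (intro free_module_data.restrict_carrier[OF free_data]) auto
      fix i b assume i: "i \<in> fib J y" "b \<in> bas (N i)"
      show "std_fun J y (sadd N s t) (key i, b) = (\<lambda>l\<in>lab J y. std_fun J y s l \<oplus>\<^bsub>R\<^esub> std_fun J y t l) (key i, b)"
        using i based_module.coord_add[OF based[OF fib_J[OF i(1)]] sec_carrier[OF s] sec_carrier[OF t]]
        by (simp add: std_fun lab_iff sadd_def)
    qed
    then show ?thesis
      unfolding std_out_def Zy[OF y] free_module_data.add_M[OF free_data st(1,2)] by simp
  qed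
  have 3: "std_out J y (smul N a s) = a \<odot>\<^bsub>?Z y\<^esub> std_out J y s"
    if y: "y \<in> cone" and a: "a \<in> carrier R" and s: "s \<in> sec N" for y a s
  proof -
    interpret ring R by (rule R)
    note st = std_fun_closed[OF s, of y] std_fun_closed[OF sec_smul[OF N a s], of y]
    have "std_fun J y (smul N a s) = (\<lambda>l\<in>lab J y. a \<otimes>\<^bsub>R\<^esub> std_fun J y s l)"
    proof (rule std_fun_ext[OF _ st(2)])
      show "(\<lambda>l\<in>lab J y. a \<otimes>\<^bsub>R\<^esub> std_fun J y s l) \<in> lab J y \<rightarrow>\<^sub>E carrier R"
        using st a by (intro free_module_data.restrict_carrier[OF free_data]) auto
      fix i b assume i: "i \<in> fib J y" "b \<in> bas (N i)"
      show "std_fun J y (smul N a s) (key i, b) = (\<lambda>l\<in>lab J y. a \<otimes>\<^bsub>R\<^esub> std_fun J y s l) (key i, b)"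
        using i based_module.coord_smult[OF based[OF fib_J[OF i(1)]] a sec_carrier[OF s]]
        by (simp add: std_fun lab_iff smul_def)
    qed
    then show ?thesis
      unfolding std_out_def Zy[OF y] free_module_data.smult_M[OF free_data st(1)] by simp
  qed
  have 4: "std_inn J y v \<in> sec N \<and> std_out J y (std_inn J y v) = v" if y: "y \<in> cone" and v: "v \<in> carrier (?Z y)" for y v
  proof -
    obtain f where f: "f \<in> lab J y \<rightarrow>\<^sub>E carrier R" "v = list_emb \<iota> (lab J y) f"
      using v unfolding Zy[OF y] carr by auto
    have fi: "(\<lambda>b\<in>bas (N i). f (key i, b)) \<in> bas (N i) \<rightarrow>\<^sub>E carrier R" if "i \<in> fib J y" for i
      using f(1) lab_iff[OF that] by (auto simp: PiE_iff)
    have e: "std_inn J y v i = (if i \<in> fib J y then (\<Oplus>\<^bsub>N i\<^esub>b\<in>bas (N i). (\<lambda>b\<in>bas (N i). f (key i, b)) b \<odot>\<^bsub>N i\<^esub> b) else \<zero>\<^bsub>N i\<^esub>)" for i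
    proof (cases "i \<in> fib J y")
      case True
      interpret bm: based_module R "N i" "bas (N i)" by (rule based[OF fib_J[OF True]])
      have "(\<Oplus>\<^bsub>N i\<^esub>b\<in>bas (N i). f (key i, b) \<odot>\<^bsub>N i\<^esub> b) = (\<Oplus>\<^bsub>N i\<^esub>b\<in>bas (N i). (\<lambda>b\<in>bas (N i). f (key i, b)) b \<odot>\<^bsub>N i\<^esub> b)"
        using fi[OF True] bm.B by (intro bm.M.finsum_cong') (auto intro!: bm.smult_closed simp: PiE_iff)
      then show ?thesis using True by (simp add: f(2) std_inn_emb[OF f(1)])
    qed (simp add: f(2) std_inn_emb[OF f(1)])
    have s: "std_inn J y v \<in> sec N"
    proof (rule secI[OF _ finite_fib[OF JI, of y]])
      show "std_inn J y v i \<in> carrier (N i)" for i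
      proof (cases "i \<in> fib J y")
        case True
        show ?thesis using based_module.comb_closed[OF based[OF fib_J[OF True]]] fi[OF True] True by (simp add: e PiE_iff)
      qed (simp add: e modfam_ops[OF N])
      show "supp N (std_inn J y v) \<subseteq> fib J y" by (auto simp: supp_def e)
    qed
    have "std_fun J y (std_inn J y v) = f"
    proof (rule std_fun_ext[OF _ std_fun_closed[OF s] f(1)])
      fix i b assume i: "i \<in> fib J y" "b \<in> bas (N i)"
      show "std_fun J y (std_inn J y v) (key i, b) = f (key i, b)"
        using based_module.coord_unique[OF based[OF fib_J[OF i(1)]] fi[OF i(1)]] i by (simp add: std_fun e)
    qed
    then show ?thesis using s by (simp add: std_out_def f(2))
  qed
  have 5: "std_inn J y (std_out J y s) = restr N (fib J y) s" if y: "y \<in> cone" and s: "s \<in> sec N" for y s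
  proof
    fix i
    show "std_inn J y (std_out J y s) i = restr N (fib J y) s i"
    proof (cases "i \<in> fib J y")
      case True
      interpret bm: based_module R "N i" "bas (N i)" by (rule based[OF fib_J[OF True]])
      have "(\<Oplus>\<^bsub>N i\<^esub>b\<in>bas (N i). std_fun J y s (key i, b) \<odot>\<^bsub>N i\<^esub> b) =
          (\<Oplus>\<^bsub>N i\<^esub>b\<in>bas (N i). coord R (N i) (bas (N i)) (s i) b \<odot>\<^bsub>N i\<^esub> b)"
        using bm.coord(1)[OF sec_carrier[OF s]] bm.B
        by (intro bm.M.finsum_cong') (auto intro!: bm.smult_closed simp: std_fun[OF True] PiE_iff)
      also have "\<dots> = s i" by (rule bm.coord(2)[OF sec_carrier[OF s]])
      finally show ?thesis using True by (simp add: std_out_def std_inn_emb[OF std_fun_closed[OF s]] restr_def)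
    qed (simp add: std_out_def std_inn_emb[OF std_fun_closed[OF s]] restr_def)
  qed
  have 6: "std_out J (act_cone (act_bar D) g y) s = std_out J y (s \<circ> act_ix g)"
    if "g \<in> carrier (grp D)" "s \<in> sec N" for g y s
    by (simp add: std_out_def std_fun_act[OF that] lab_act[OF that(1)])
  \<comment> \<open>Two distinct elements over a point differ at some index of its fibre under
    \<open>std_inn\<close>, so the module at that index is nonzero.\<close>
  have supp: "mod_supp cone_top ?Z \<subseteq> pos ` {i \<in> J. carrier (N i) \<noteq> {\<zero>\<^bsub>N i\<^esub>}}"
  proof
    fix y assume "y \<in> mod_supp cone_top ?Z"
    then have y: "y \<in> cone" and ne: "carrier (?Z y) \<noteq> {\<zero>\<^bsub>?Z y\<^esub>}" by (auto simp: mod_supp_def)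
    interpret Z: abelian_group "?Z y" unfolding Zy[OF y] by (rule free_module_data.abelian_group_M[OF free_data])
    obtain v where v: "v \<in> carrier (?Z y)" "v \<noteq> \<zero>\<^bsub>?Z y\<^esub>" using ne Z.zero_closed by blast
    have "std_inn J y v \<noteq> std_inn J y \<zero>\<^bsub>?Z y\<^esub>" using 4[OF y v(1)] 4[OF y Z.zero_closed] v(2) by metis
    then obtain i where i: "std_inn J y v i \<noteq> std_inn J y \<zero>\<^bsub>?Z y\<^esub> i" by blast
    then have "i \<in> fib J y" by (auto simp: std_inn_def Let_def split: if_splits)
    moreover have "std_inn J y v i \<in> carrier (N i)" "std_inn J y \<zero>\<^bsub>?Z y\<^esub> i \<in> carrier (N i)"
      using 4[OF y v(1)] 4[OF y Z.zero_closed] by (auto intro: sec_carrier)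
    ultimately show "y \<in> pos ` {i \<in> J. carrier (N i) \<noteq> {\<zero>\<^bsub>N i\<^esub>}}" using i by (auto simp: fib_def)
  qed
  have lf: "\<exists>U. openin cone_top U \<and> y \<in> U \<and> finite (U \<inter> mod_supp cone_top ?Z)" if y: "y \<in> cone" for y
  proof -
    \<comment> \<open>A bounded strip of bounded height: by \<open>fin\<close> it meets the support
      in a finite set.\<close>
    let ?U = "{z \<in> (UNIV \<times> {1..} :: ('x \<times> real) set). proj D (fst z) \<in> {proj D (fst y) - 1<..<proj D (fst y) + 1} \<and> snd z < snd y + 1}"
    have "continuous_on UNIV (\<lambda>z. proj D (fst z))" by (intro continuous_on_compose2[OF continuous_proj] continuous_intros) auto
    then have o1: "open ((\<lambda>z :: 'x \<times> real. proj D (fst z)) -` {proj D (fst y) - 1<..<proj D (fst y) + 1})"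
      by (intro open_vimage) auto
    have o2: "open ((\<lambda>z :: 'x \<times> real. snd z) -` {..<snd y + 1})"
      by (intro open_vimage continuous_intros)
    have eq: "?U = (UNIV \<times> {1..}) \<inter> (((\<lambda>z. proj D (fst z)) -` {proj D (fst y) - 1<..<proj D (fst y) + 1}) \<inter> (snd -` {..<snd y + 1}))"
      by auto
    have "openin cone_top ?U" unfolding cone_top_def eq by (intro openin_open_Int open_Int o1 o2)
    moreover have "y \<in> ?U" using y by (auto simp: cone_iff mem_Times_iff)
    moreover have "finite (?U \<inter> mod_supp cone_top ?Z)"
    proof (rule finite_subset)
      show "?U \<inter> mod_supp cone_top ?Z \<subseteq> pos ` {i \<in> I. carrier (N i) \<noteq> {\<zero>\<^bsub>N i\<^esub>} \<and>
          proj D (fst (pos i)) \<in> {proj D (fst y) - 1..proj D (fst y) + 1} \<and> snd (pos i) \<le> snd y + 1}"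
        using supp JI by fastforce
    qed (intro finite_imageI fin)
    ultimately show ?thesis by blast
  qed
  have "?Z \<in> O_objs R D"
    unfolding O_objs_def
  proof (intro CollectI conjI)
    show "geom_module R cone_top ?Z"
      unfolding geom_module_def
    proof (intro conjI ballI)
      show "?Z \<in> extensional cone" by (simp add: std_mod_def)
      show "fg_free R (?Z y)" if "y \<in> cone" for y
        unfolding Zy[OF that] by (rule free_module_data.fg_free_M[OF free_data])
    qed (rule lf)
    show "inv_module (grp D) (act_cone (act_bar D)) cone_top ?Z"
      unfolding inv_module_def by (auto simp: std_mod_def act_cone_cone lab_act)
    show "\<exists>K. compact K \<and> mod_supp cone_top ?Z \<subseteq> (\<Union>g\<in>carrier (grp D). act_bar D g ` K) \<times> {1..}"
    proof (intro exI conjI subsetI)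
      \<comment> \<open>The preimage of a unit interval is compact, and its translates cover the
        whole space.\<close>
      show "compact (proj D -` {0..1})" by (rule compact_proj)
      fix y assume "y \<in> mod_supp cone_top ?Z"
      then have y: "y \<in> cone" by (simp add: mod_supp_def)
      have "fst y \<in> (\<Union>g\<in>carrier (grp D). act_bar D g ` (proj D -` {0..1}))"
      proof -
        let ?x = "proj D (fst y)"
        obtain g where g: "g \<in> carrier (grp D)" "\<And>x. act_line D g x = x + of_int \<lfloor>?x\<rfloor>"
          using translation by blast
        have "surj (act_bar D g)" using group_action.surj_prop[OF action g(1)] by simp
        then obtain z where z: "fst y = act_bar D g z" by (meson surjD)
        then have "?x = proj D z + of_int \<lfloor>?x\<rfloor>" using proj_act[of g z] g(2) by simp
        then have "proj D z \<in> {0..1}" by (simp; linarith)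
        then show ?thesis using g(1) z by blast
      qed
      then show "y \<in> (\<Union>g\<in>carrier (grp D). act_bar D g ` (proj D -` {0..1})) \<times> {1..}"
        using y by (simp add: mem_Times_iff cone_iff)
    qed
  qed
  then show ?thesis unfolding pres_def using J 1 2 3 4 5 6 by blast
qed

end
end

section \<open>Relations in the first K-group\<close>

text \<open>Membership of \<open>a\<close> and \<open>- a\<close> replaces computations in the quotient: then a relator only needs to lie in
  the free abelian group when it is used, and the closure of all automorphisms of the category under
  composition is never needed.\<close>

definition null :: "('o, 'f) add_cat \<Rightarrow> (('o \<times> 'f) \<Rightarrow>\<^sub>0 int) \<Rightarrow> bool" where
  "null \<C> a \<longleftrightarrow> a \<in> K1_rel_subgroup \<C> \<and> - a \<in> K1_rel_subgroup \<C>"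

lemma K1_rel_subgroup_add: "a \<in> K1_rel_subgroup \<C> \<Longrightarrow> b \<in> K1_rel_subgroup \<C> \<Longrightarrow> a + b \<in> K1_rel_subgroup \<C>"
  unfolding K1_rel_subgroup_def using generate.eng[of a "free_Abelian_group (Auts \<C>)" _ b] by simp

lemma null_add: "null \<C> a \<Longrightarrow> null \<C> b \<Longrightarrow> null \<C> (a + b)"
  unfolding null_def using K1_rel_subgroup_add[of a \<C> b] K1_rel_subgroup_add[of "-a" \<C> "-b"] by simp

lemma null_uminus: "null \<C> a \<Longrightarrow> null \<C> (- a)"
  by (simp add: null_def)

lemma null_diff: "null \<C> a \<Longrightarrow> null \<C> b \<Longrightarrow> null \<C> (a - b)"
  using null_add[of \<C> a "-b"] null_uminus by fastforce

lemma null_rel: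
  assumes "a \<in> K1_rels \<C>" "a \<in> carrier (free_Abelian_group (Auts \<C>))"
  shows "null \<C> a"
proof -
  have "inv\<^bsub>free_Abelian_group (Auts \<C>)\<^esub> a = - a"
    using assms(2) by (intro inv_free_Abelian_group) (simp add: free_Abelian_group_def)
  then show ?thesis
    unfolding null_def K1_rel_subgroup_def
    using generate.incl[OF assms(1)] generate.inv[OF assms(1), of "free_Abelian_group (Auts \<C>)"] by simp
qed

lemma frag_closed: "x \<in> S \<Longrightarrow> frag_of x \<in> carrier (free_Abelian_group S)"
  by (simp add: free_Abelian_group_def)

lemma free_Abelian_diff:
  "a \<in> carrier (free_Abelian_group S) \<Longrightarrow> b \<in> carrier (free_Abelian_group S) \<Longrightarrow> a - b \<in> carrier (free_Abelian_group S)"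
  using keys_diff[of a b] by (auto simp: free_Abelian_group_def)

lemma null_comp:
  assumes "(A, \<alpha>) \<in> Auts \<C>" "(A, \<beta>) \<in> Auts \<C>" "(A, Comp \<C> A A A \<alpha> \<beta>) \<in> Auts \<C>"
  shows "null \<C> (frag_of (A, Comp \<C> A A A \<alpha> \<beta>) - frag_of (A, \<alpha>) - frag_of (A, \<beta>))"
proof (rule null_rel)
  show "frag_of (A, Comp \<C> A A A \<alpha> \<beta>) - frag_of (A, \<alpha>) - frag_of (A, \<beta>) \<in> K1_rels \<C>"
    unfolding K1_rels_def using assms by blast
qed (intro free_Abelian_diff frag_closed assms)

lemma null_exact:
  assumes "(A, \<alpha>) \<in> Auts \<C>" "(B, \<beta>) \<in> Auts \<C>" "(C, \<gamma>) \<in> Auts \<C>" "split_exact \<C> A B C i q"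
    "Comp \<C> A B B \<beta> i = Comp \<C> A A B i \<alpha>" "Comp \<C> B B C q \<beta> = Comp \<C> B C C \<gamma> q"
  shows "null \<C> (frag_of (B, \<beta>) - frag_of (A, \<alpha>) - frag_of (C, \<gamma>))"
proof (rule null_rel)
  show "frag_of (B, \<beta>) - frag_of (A, \<alpha>) - frag_of (C, \<gamma>) \<in> K1_rels \<C>"
    unfolding K1_rels_def using assms by blast
qed (intro free_Abelian_diff frag_closed assms)

lemma K1_class_null:
  assumes "null \<C> (frag_of (A, \<alpha>))"
  shows "K1_class \<C> A \<alpha> = \<one>\<^bsub>K1 \<C>\<^esub>"
proof -
  let ?S = "K1_rel_subgroup \<C>" and ?a = "frag_of (A, \<alpha>)"
  have "{n + ?a | n. n \<in> ?S} = ?S"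
  proof (intro equalityI subsetI)
    fix x assume x: "x \<in> ?S"
    then have "x - ?a \<in> ?S" using K1_rel_subgroup_add[of x \<C> "- ?a"] assms by (simp add: null_def)
    then show "x \<in> {n + ?a | n. n \<in> ?S}" by (intro CollectI exI[of _ "x - ?a"]) simp
  qed (use assms K1_rel_subgroup_add in \<open>auto simp: null_def\<close>)
  then show ?thesis by (auto simp: K1_class_def K1_def FactGroup_def r_coset_def)
qed

section \<open>Classes of invertible operators in the K-group\<close>

context index_system
begin

lemma restr_I: "s \<in> sec N \<Longrightarrow> restr N I s = s"
  by (rule restr_id[OF supp_I])

lemma presented: "pres J Z inn out \<Longrightarrow> presented D setp R N pos key act_ix I \<iota> J Z inn out"
  by (intro presented.intro presented_axioms.intro index_system_axioms)

lemma presented2: "pres J Z inn out \<Longrightarrow> pres J' Z' inn' out' \<Longrightarrow>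
    presented2 D setp R N pos key act_ix I \<iota> J Z inn out J' Z' inn' out'"
  by (intro presented2.intro presented)

lemma presented3: "pres J Z inn out \<Longrightarrow> pres J' Z' inn' out' \<Longrightarrow> pres J'' Z'' inn'' out'' \<Longrightarrow>
    presented3 D setp R N pos key act_ix I \<iota> J Z inn out J' Z' inn' out' J'' Z'' inn'' out''"
  by (intro presented3.intro presented2 presented)

lemma Hom_mor:
  assumes "pres J Z inn out" "pres J' Z' inn' out'" "good T"
  shows "mor Z inn out' T \<in> Hom (O_cat R D) Z Z'"
  using presented2.mor_homs[OF presented2[OF assms(1,2)] assms(3)] by (simp add: O_cat_def)

lemma Comp_mor:
  assumes "pres J Z inn out" "pres J' Z' inn' out'" "pres J'' Z'' inn'' out''" "good T" "good S"
  shows "Comp (O_cat R D) Z Z' Z'' (mor Z' inn' out'' S) (mor Z inn out' T) = mor Z inn out'' (\<lambda>s. S (restr N J' (T s)))"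
  using presented3.mor_comp_mor[OF presented3[OF assms(1-3)] assms(4) good_linop[OF assms(5)]]
  by (simp add: O_cat_def)

lemma mor_eqI:
  assumes "pres J Z inn out" "pres J' Z' inn' out'"
    and "\<And>s. s \<in> sec N \<Longrightarrow> supp N s \<subseteq> J \<Longrightarrow> restr N J' (T s) = restr N J' (S s)" and "good T" "good S"
  shows "mor Z inn out' T = mor Z inn out' S"
  using presented2.mor_cong[OF presented2[OF assms(1,2)] assms(3) good_linop[OF assms(4)] good_linop[OF assms(5)]] .

lemma Id_mor: "pres J Z inn out \<Longrightarrow> mor Z inn out (\<lambda>s. s) = Id (O_cat R D) Z"
  using presented.mor_id_mor[OF presented] by (simp add: O_cat_def)

lemma Obj_pres: "pres J Z inn out \<Longrightarrow> Z \<in> Obj (O_cat R D)"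
  by (simp add: pres_def O_cat_def)

lemma pres_invariant: "pres J Z inn out \<Longrightarrow> invariant J"
  by (simp add: pres_def)

text \<open>The inverse is part of the data, because its spread and control do not follow from those
  of \<open>T\<close>.\<close>

definition units :: "('i, 'm) operator \<Rightarrow> ('i, 'm) operator \<Rightarrow> bool" where
  "units T T' \<longleftrightarrow> good T \<and> good T' \<and> inverse_ops N T T'"

lemma units_sym: "units T T' \<Longrightarrow> units T' T"
  by (auto simp: units_def inverse_ops_sym)

lemma units_comp: "units T T' \<Longrightarrow> units S S' \<Longrightarrow> units (\<lambda>s. T (S s)) (\<lambda>s. S' (T' s))"
  unfolding units_def using good_comp[of S T] good_comp[of T' S']
    inverse_ops_comp[of R N S T' T S', OF good_linop good_linop] by simp

lemma units_id: "units (\<lambda>s. s) (\<lambda>s. s)"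
  by (simp add: units_def good_id inverse_ops_def)

context
  fixes Z inn out
  assumes Z: "pres I Z inn out"
begin

definition gen :: "('i, 'm) operator \<Rightarrow> (('x \<times> real \<Rightarrow> ('r, 'm) module) \<times> ('x \<times> real \<Rightarrow> 'x \<times> real \<Rightarrow> 'm \<Rightarrow> 'm)) \<Rightarrow>\<^sub>0 int" where
  "gen T = frag_of (Z, mor Z inn out T)"

lemma Comp_units:
  assumes "good T" "good S"
  shows "Comp (O_cat R D) Z Z Z (mor Z inn out T) (mor Z inn out S) = mor Z inn out (\<lambda>s. T (S s))"
  unfolding Comp_mor[OF Z Z Z assms(2,1)]
proof (rule mor_eqI[OF Z Z])
  show "good (\<lambda>s. T (restr N I (S s)))" "good (\<lambda>s. T (S s))"
    using good_comp[OF good_comp[OF assms(2) good_restr[OF pres_invariant[OF Z]]] assms(1)]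
      good_comp[OF assms(2,1)] by simp_all
qed (simp add: restr_I good_sec[OF assms(2)])

lemma gen_cong:
  assumes "good T" "good S" "\<And>s. s \<in> sec N \<Longrightarrow> T s = S s"
  shows "gen T = gen S"
  unfolding gen_def using mor_eqI[OF Z Z _ assms(1,2)] assms(3) by simp

lemma Auts_units:
  assumes "units T T'"
  shows "(Z, mor Z inn out T) \<in> Auts (O_cat R D)"
proof -
  have g: "good T" "good T'" and inv: "inverse_ops N T T'" using assms by (auto simp: units_def)
  have c: "mor Z inn out (\<lambda>s. S (S' s)) = Id (O_cat R D) Z"
    if "good S" "good S'" "inverse_ops N S S'" for S S'
    unfolding Id_mor[OF Z, symmetric]
    by (rule mor_eqI[OF Z Z _ good_comp[OF that(2,1)] good_id]) (use that(3) in \<open>simp add: inverse_ops_def\<close>)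
  have "inverse_mors (O_cat R D) Z (mor Z inn out T) (mor Z inn out T')"
    unfolding inverse_mors_def Comp_units[OF g] Comp_units[OF g(2,1)]
    using c[OF g inv] c[OF g(2,1) inverse_ops_sym[OF inv]] Hom_mor[OF Z Z g(1)] Hom_mor[OF Z Z g(2)] Obj_pres[OF Z]
    by simp
  then show ?thesis by (auto simp: Auts_def)
qed

lemma null_gen_comp:
  assumes "units T T'" "units S S'"
  shows "null (O_cat R D) (gen (\<lambda>s. T (S s)) - gen T - gen S)"
proof -
  have "good T" "good S" using assms by (auto simp: units_def)
  from Comp_units[OF this] show ?thesis
    unfolding gen_def
    using null_comp[OF Auts_units[OF assms(1)] Auts_units[OF assms(2)]] Auts_units[OF units_comp[OF assms]] by simp
qed

text \<open>The relation for the identity composed with itself is minus the generator of the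
  identity.\<close>

lemma null_gen_id: "null (O_cat R D) (gen (\<lambda>s. s))"
  using null_uminus[OF null_gen_comp[OF units_id units_id]] by simp

lemma null_gen_inverse:
  assumes "units T T'"
  shows "null (O_cat R D) (gen T + gen T')"
proof -
  have "gen (\<lambda>s. T (T' s)) = gen (\<lambda>s. s)"
    using assms units_comp[OF assms units_sym[OF assms]]
    by (intro gen_cong good_id) (auto simp: units_def inverse_ops_def)
  then have "null (O_cat R D) (gen (\<lambda>s. s) - gen T - gen T')"
    using null_gen_comp[OF assms units_sym[OF assms]] by simp
  from null_diff[OF null_gen_id this] show ?thesis by (simp add: add.commute)
qed

lemma null_gen_commutator:
  assumes T: "units T T'" and S: "units S S'"
  shows "null (O_cat R D) (gen (\<lambda>s. T (S (T' (S' s)))))"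
proof -
  note T' = units_sym[OF T] and S' = units_sym[OF S]
  note 1 = null_gen_comp[OF T units_comp[OF S units_comp[OF T' S']]]
  note 2 = null_gen_comp[OF S units_comp[OF T' S']]
  note 3 = null_gen_comp[OF T' S']
  have "null (O_cat R D) ((gen (\<lambda>s. T (S (T' (S' s)))) - gen T - gen (\<lambda>s. S (T' (S' s)))) +
     ((gen (\<lambda>s. S (T' (S' s))) - gen S - gen (\<lambda>s. T' (S' s))) + (gen (\<lambda>s. T' (S' s)) - gen T' - gen S')) +
     ((gen T + gen T') + (gen S + gen S')))"
    by (intro null_add 1 2 3 null_gen_inverse[OF T] null_gen_inverse[OF S])
  then show ?thesis by (simp add: algebra_simps)
qed

lemma null_gen_comp2:
  assumes "units T T'" "units S S'" "null (O_cat R D) (gen T)" "null (O_cat R D) (gen S)"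
  shows "null (O_cat R D) (gen (\<lambda>s. T (S s)))"
  using null_add[OF null_add[OF null_gen_comp[OF assms(1,2)] assms(3)] assms(4)] by (simp add: algebra_simps)

text \<open>With respect to the splitting of \<open>I\<close> into \<open>J\<close> and its
  complement, \<open>T\<close> preserves the first part and induces the identity on the quotient,
  whose class is trivial. This leads from the stabilised object back to \<open>A\<close>.\<close>

lemma null_summand:
  assumes A: "pres J A innA outA" and T: "units T T'"
    and al: "(A, mor A innA outA T) \<in> Auts (O_cat R D)"
    and TJ: "\<And>s. s \<in> sec N \<Longrightarrow> supp N s \<subseteq> J \<Longrightarrow> supp N (T s) \<subseteq> J"
    and TK: "\<And>s. s \<in> sec N \<Longrightarrow> restr N (I - J) (T s) = restr N (I - J) s"
  shows "null (O_cat R D) (gen T - frag_of (A, mor A innA outA T))"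
proof -
  let ?\<C> = "O_cat R D"
  let ?K = "I - J"
  have J: "invariant J" by (rule pres_invariant[OF A])
  then have "invariant ?K" by (auto simp: invariant_def act_I)
  from pres_std[OF this] obtain C innC outC where C: "pres ?K C innC outC" by blast
  have gT: "good T" using T by (simp add: units_def)
  note good = good_id good_restr[OF pres_invariant[OF Z]] good_restr[OF J] good_restr[OF \<open>invariant ?K\<close>]
    gT good_comp[OF gT good_restr[OF J]] good_comp[OF gT good_restr[OF pres_invariant[OF Z]]]
    good_comp[OF good_restr[OF pres_invariant[OF Z]] gT]
  \<comment> \<open>All four maps of the split sequence come from the identity operator; the
    presentations at the two ends turn it into inclusions and projections.\<close>
  define i where "i = mor A innA out (\<lambda>s. s)"
  define q where "q = mor Z inn outC (\<lambda>s. s)"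
  define r where "r = mor Z inn outA (\<lambda>s. s)"
  define s where "s = mor C innC out (\<lambda>s. s)"
  have JI: "J \<subseteq> I" using J by (simp add: invariant_def)
  have homs: "i \<in> Hom ?\<C> A Z" "q \<in> Hom ?\<C> Z C" "r \<in> Hom ?\<C> Z A" "s \<in> Hom ?\<C> C Z"
    unfolding i_def q_def r_def s_def by (intro Hom_mor[OF A Z] Hom_mor[OF Z C] Hom_mor[OF Z A] Hom_mor[OF C Z] good_id)+
  have rr: "restr N X (restr N Y t) = restr N X t" if "X \<subseteq> Y" for X Y t
    using that by (simp add: restr_restr Int_absorb2)
  have ri: "Comp ?\<C> A Z A r i = Id ?\<C> A"
    unfolding r_def i_def Comp_mor[OF A Z A good_id good_id] Id_mor[OF A, symmetric]
    by (rule mor_eqI[OF A A]) (auto simp: good rr JI)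
  have qs: "Comp ?\<C> C Z C q s = Id ?\<C> C"
    unfolding q_def s_def Comp_mor[OF C Z C good_id good_id] Id_mor[OF C, symmetric]
    by (rule mor_eqI[OF C C]) (auto simp: good rr)
  have "Add ?\<C> Z Z (Comp ?\<C> Z A Z i r) (Comp ?\<C> Z C Z s q) =
      mor Z inn out (\<lambda>t. sadd N (restr N J t) (restr N ?K t))"
    unfolding q_def s_def i_def r_def Comp_mor[OF Z A Z good_id good_id] Comp_mor[OF Z C Z good_id good_id]
    using presented.mor_add_mor[OF presented[OF Z] good_linop[OF good(3)] good_linop[OF good(4)]]
    by (simp add: O_cat_def)
  also have "\<dots> = mor Z inn out (\<lambda>t. t)"
  proof -
    have "sadd N (restr N J t) (restr N ?K t) = t" if "t \<in> sec N" for t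
      using sadd_restr[OF N that, of J ?K] JI restr_I[OF that] by (simp add: Un_absorb1)
    moreover have "inn y v \<in> sec N" if "y \<in> cone" "v \<in> carrier (Z y)" for y v
      using presented.inn_sec[OF presented[OF Z] that] .
    ultimately show ?thesis unfolding mor_def by (intro restrict_ext) simp
  qed
  finally have sum: "Add ?\<C> Z Z (Comp ?\<C> Z A Z i r) (Comp ?\<C> Z C Z s q) = Id ?\<C> Z"
    by (simp add: Id_mor[OF Z])
  have ex: "split_exact ?\<C> A Z C i q"
    unfolding split_exact_def using homs ri qs sum by blast
  have ia: "Comp ?\<C> A Z Z (mor Z inn out T) i = Comp ?\<C> A A Z i (mor A innA outA T)"
    unfolding i_def Comp_mor[OF A Z Z good_id gT] Comp_mor[OF A A Z gT good_id]
  proof (rule mor_eqI[OF A Z])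
    fix t assume t: "t \<in> sec N" "supp N t \<subseteq> J"
    then show "restr N I (T (restr N I t)) = restr N I (restr N J (T t))"
      using TJ[OF t] by (simp add: restr_I restr_id)
  qed (simp_all add: good)
  have qb: "Comp ?\<C> Z Z C q (mor Z inn out T) = Comp ?\<C> Z C C (mor C innC outC (\<lambda>s. s)) q"
    unfolding q_def Comp_mor[OF Z Z C gT good_id] Comp_mor[OF Z C C good_id good_id]
    by (rule mor_eqI[OF Z C]) (simp_all add: good rr TK)
  have cc: "Comp ?\<C> C C C (mor C innC outC (\<lambda>s. s)) (mor C innC outC (\<lambda>s. s)) = mor C innC outC (\<lambda>s. s)"
    unfolding Comp_mor[OF C C C good_id good_id] by (rule mor_eqI[OF C C]) (simp_all add: good rr)
  have aC: "(C, mor C innC outC (\<lambda>s. s)) \<in> Auts ?\<C>"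
    unfolding Auts_def inverse_mors_def
    using cc Hom_mor[OF C C good_id] Obj_pres[OF C] Id_mor[OF C] by auto
  have "null ?\<C> (frag_of (C, mor C innC outC (\<lambda>s. s)))"
    using null_uminus[OF null_comp[OF aC aC]] aC cc by simp
  from null_add[OF null_exact[OF al Auts_units[OF T] aC ex ia qb] this] show ?thesis
    by (simp add: gen_def)
qed

end
end

section \<open>Morphisms as operators on sections\<close>

lemma (in left_module) finsum_smult:
  assumes a: "a \<in> carrier R" and f: "f \<in> X \<rightarrow> carrier M"
  shows "(\<Oplus>\<^bsub>M\<^esub>x\<in>X. a \<odot>\<^bsub>M\<^esub> f x) = a \<odot>\<^bsub>M\<^esub> (\<Oplus>\<^bsub>M\<^esub>x\<in>X. f x)"
  using f
proof (induction X rule: infinite_finite_induct)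
  case (infinite X)
  then show ?case using smult_zero[OF a] by simp
next
  case empty
  then show ?case using smult_zero[OF a] by simp
next
  case (insert x X)
  then have fx: "f x \<in> carrier M" "f \<in> X \<rightarrow> carrier M" by auto
  have "(\<Oplus>\<^bsub>M\<^esub>x\<in>insert x X. a \<odot>\<^bsub>M\<^esub> f x) = a \<odot>\<^bsub>M\<^esub> f x \<oplus>\<^bsub>M\<^esub> (\<Oplus>\<^bsub>M\<^esub>x\<in>X. a \<odot>\<^bsub>M\<^esub> f x)"
    using insert.hyps fx smult_closed[OF a] by (intro M.finsum_insert) auto
  also have "\<dots> = a \<odot>\<^bsub>M\<^esub> (f x \<oplus>\<^bsub>M\<^esub> (\<Oplus>\<^bsub>M\<^esub>x\<in>X. f x))"
    using insert.IH[OF fx(2)] smult_r_distr[OF a fx(1) M.finsum_closed[OF fx(2)]] by simp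
  also have "f x \<oplus>\<^bsub>M\<^esub> (\<Oplus>\<^bsub>M\<^esub>x\<in>X. f x) = (\<Oplus>\<^bsub>M\<^esub>x\<in>insert x X. f x)"
    using insert.hyps fx by (intro M.finsum_insert[symmetric]) auto
  finally show ?case .
qed

text \<open>Off the cone a section has a single possible value, which makes sections total functions.\<close>

definition ext_mod :: "('x::topological_space \<times> real \<Rightarrow> ('r, 'm) module) \<Rightarrow> 'x \<times> real \<Rightarrow> ('r, 'm) module" where
  "ext_mod A y = (if y \<in> cone then A y else triv_module)"

definition opr :: "('x::topological_space \<times> real \<Rightarrow> ('r, 'm) module) \<Rightarrow> ('x \<times> real \<Rightarrow> 'x \<times> real \<Rightarrow> 'm \<Rightarrow> 'm) \<Rightarrow>
    ('x \<times> real \<Rightarrow> 'm) \<Rightarrow> 'x \<times> real \<Rightarrow> 'm" where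
  "opr A \<phi> s = (\<lambda>y. if y \<in> cone then \<Oplus>\<^bsub>A y\<^esub>x\<in>{x. (x, y) \<in> mor_supp cone_top A A \<phi>}. \<phi> x y (s x) else undefined)"

text \<open>Copies of either sign go up, by the absolute value of \<open>k\<close>; the sign only
  distinguishes copies and, for the outer ones, selects the kind of cell.\<close>

definition shift :: "('g, 'x) line_space \<Rightarrow> ('x \<Rightarrow> real \<Rightarrow> 'x) \<Rightarrow> real \<Rightarrow> int \<Rightarrow> 'x \<times> real \<Rightarrow> 'x \<times> real" where
  "shift D setp a k y =
     (setp (fst y) (contract a (snd y / (snd y + \<bar>of_int k\<bar>)) (proj D (fst y))), snd y + \<bar>of_int k\<bar>)"

section \<open>The stabilisation of an object by doubly indexed copies\<close>

locale line_module = line_data D setp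
  for D :: "('g, 'x::topological_space) line_space" and setp +
  fixes R :: "('r, 'k) ring_scheme" and A :: "'x \<times> real \<Rightarrow> ('r, 'm) module" and \<iota> :: "'r list \<Rightarrow> 'm"
  assumes R: "ring R" and \<iota>: "inj_on \<iota> (lists (carrier R))" and A: "A \<in> O_objs R D"
begin

definition "N0 = ext_mod A"
definition "H0 = act_cone (act_bar D) ` carrier (grp D)"

lemma N0: "y \<in> cone \<Longrightarrow> N0 y = A y"
  by (simp add: N0_def ext_mod_def)

lemma fg_A: "y \<in> cone \<Longrightarrow> fg_free R (A y)"
  using A by (simp add: O_objs_def geom_module_def)

lemma left_module_A: "y \<in> cone \<Longrightarrow> left_module R (A y)"
  using fg_A by (simp add: fg_free_def)

lemma modfam_N0: "modfam R N0"
  unfolding modfam_def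
proof
  show "left_module R (N0 y)" for y
    using left_module_A left_module_triv[OF R] by (cases "y \<in> cone") (simp_all add: N0_def ext_mod_def)
qed

lemma triv_N0: "y \<notin> cone \<Longrightarrow> carrier (N0 y) = {\<zero>\<^bsub>N0 y\<^esub>}"
  by (simp add: N0_def ext_mod_def triv_module_def)

lemma sec_off: "s \<in> sec N0 \<Longrightarrow> y \<notin> cone \<Longrightarrow> s y = undefined"
  using sec_carrier[of s N0 y] by (simp add: N0_def ext_mod_def triv_module_def)

lemma supp_cone: "s \<in> sec N0 \<Longrightarrow> supp N0 s \<subseteq> cone"
  using triv_N0 sec_carrier by (fastforce simp: supp_def)

lemma act_cone_iff: "act_cone (act_bar D) g y \<in> cone \<longleftrightarrow> y \<in> cone"
  by (simp add: cone_iff act_cone_def)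

lemma N0_act: "g \<in> carrier (grp D) \<Longrightarrow> N0 (act_cone (act_bar D) g y) = N0 y"
  using A by (simp add: N0_def ext_mod_def act_cone_iff O_objs_def inv_module_def)

lemma bij_act: "g \<in> carrier (grp D) \<Longrightarrow> bij (act_cone (act_bar D) g :: 'x \<times> real \<Rightarrow> 'x \<times> real)"
proof -
  assume g: "g \<in> carrier (grp D)"
  have "bij (act_bar D g)"
    using group_action.inj_prop[OF action g] group_action.surj_prop[OF action g] by (simp add: bij_def)
  then have "bij (map_prod (act_bar D g) (id :: real \<Rightarrow> real))"
    by (simp add: bij_def prod.inj_map map_prod_surj)
  moreover have "act_cone (act_bar D) g = map_prod (act_bar D g) (id :: real \<Rightarrow> real)" by (auto simp: act_cone_def)
  ultimately show ?thesis by simp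
qed

lemma invfam_N0: "invfam N0 H0"
  by (auto simp: invfam_def H0_def bij_act N0_act)

text \<open>The box is compact because the preimage of an interval is, and a locally finite set
  meets a compact set in finitely many points.\<close>

lemma finite_supp_box: "finite {y \<in> mod_supp cone_top A. proj D (fst y) \<in> {a..b} \<and> snd y \<le> h}"
proof -
  let ?S = "mod_supp cone_top A"
  let ?C = "(proj D -` {a..b}) \<times> {1..h}"
  have lf: "\<exists>U. openin cone_top U \<and> y \<in> U \<and> finite (U \<inter> ?S)" if "y \<in> cone" for y
    using A that by (auto simp: O_objs_def geom_module_def)
  have "\<exists>T. open T \<and> y \<in> T \<and> finite (T \<inter> ?S)" if "y \<in> ?C" for y
  proof -
    have "y \<in> cone" using that by (auto simp: cone_iff)
    then obtain U where U: "openin cone_top U" "y \<in> U" "finite (U \<inter> ?S)" using lf by blast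
    then obtain T where T: "open T" "U = (UNIV \<times> {1..}) \<inter> T" by (auto simp: cone_top_def openin_open)
    have "T \<inter> ?S = U \<inter> ?S" using T by (auto simp: mod_supp_def cone_top_def)
    then show ?thesis using T U by auto
  qed
  then obtain T where T: "\<And>y. y \<in> ?C \<Longrightarrow> open (T y) \<and> y \<in> T y \<and> finite (T y \<inter> ?S)" by metis
  have "compact ?C" by (intro compact_Times compact_proj compact_Icc)
  moreover have "?C \<subseteq> (\<Union>y\<in>?C. T y)" using T by blast
  ultimately obtain F where F: "F \<subseteq> ?C" "finite F" "?C \<subseteq> (\<Union>y\<in>F. T y)"
    using T compactE_image[of ?C ?C T] by metis
  have "{y \<in> ?S. proj D (fst y) \<in> {a..b} \<and> snd y \<le> h} \<subseteq> (\<Union>y\<in>F. T y \<inter> ?S)"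
  proof
    fix y assume y: "y \<in> {y \<in> ?S. proj D (fst y) \<in> {a..b} \<and> snd y \<le> h}"
    then have "1 \<le> snd y" by (auto simp: mod_supp_def cone_iff)
    then have "y \<in> ?C" using y by (auto simp: mem_Times_iff)
    then show "y \<in> (\<Union>y\<in>F. T y \<inter> ?S)" using F(3) y by blast
  qed
  moreover have "finite (\<Union>y\<in>F. T y \<inter> ?S)" using F T by blast
  ultimately show ?thesis by (rule finite_subset)
qed

lemma shift_zero [simp]: "y \<in> cone \<Longrightarrow> shift D setp a 0 y = y"
  by (simp add: shift_def cone_iff prod_eq_iff)

lemma snd_shift [simp]: "snd (shift D setp a k y) = snd y + \<bar>of_int k\<bar>"
  by (simp add: shift_def)

lemma proj_shift: "proj D (fst (shift D setp a k y)) = contract a (snd y / (snd y + \<bar>of_int k\<bar>)) (proj D (fst y))"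
  by (simp add: shift_def)

lemma shift_cone: "y \<in> cone \<Longrightarrow> shift D setp a k y \<in> cone"
  by (simp add: cone_iff)

lemma shift_factor:
  assumes "y \<in> cone"
  shows "0 < snd y / (snd y + \<bar>of_int k\<bar>)" "snd y / (snd y + \<bar>of_int k\<bar>) \<le> 1"
  using assms by (auto simp: cone_iff)

lemma shift_inj:
  assumes y: "y \<in> cone" "z \<in> cone" and eq: "shift D setp a k y = shift D setp a k z"
  shows "y = z"
proof -
  have s: "snd y = snd z" using arg_cong[OF eq, of snd] by simp
  have "contract a (snd y / (snd y + \<bar>of_int k\<bar>)) (proj D (fst y)) = contract a (snd y / (snd y + \<bar>of_int k\<bar>)) (proj D (fst z))"
    using arg_cong[OF eq, of "\<lambda>w. proj D (fst w)"] unfolding proj_shift s .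
  then have "proj D (fst y) = proj D (fst z)" by (rule contract_inj[OF shift_factor[OF y(1)]])
  moreover have "setp (fst (shift D setp a k w)) (proj D (fst w)) = fst w" for w by (simp add: shift_def)
  ultimately have "fst y = fst z" using eq by metis
  then show ?thesis using s by (simp add: prod_eq_iff)
qed

lemma shift_act:
  assumes g: "g \<in> carrier (grp D)" and a: "2 * a = of_int m"
  shows "shift D setp a k (act_cone (act_bar D) g y) = act_cone (act_bar D) g (shift D setp a k y)"
proof -
  obtain n :: int where n: "(\<forall>x. act_line D g x = of_int n + x) \<or> (\<forall>x. act_line D g x = of_int n - x)"
    using act_line[OF g] by blast
  have "contract a c (act_line D g x) = act_line D g (contract a c x)" for c x
    using n contract_translate[of a c n x] contract_reflect[OF a, of c n x] by auto
  then show ?thesis by (simp add: shift_def act_cone_def proj_act act_setp)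
qed

text \<open>Copies with \<open>m > 0\<close> are contracted to the integers and those with
  \<open>m < 0\<close> to the half-integers. The two swindles thus run in opposite directions and
  share copy 0, whose shift is trivial.\<close>

definition cell :: "int \<Rightarrow> real" where
  "cell m = (if 0 \<le> m then 1/2 else 0)"

lemma two_cell: "2 * cell m = of_int (if 0 \<le> m then 1 else 0)"
  by (simp add: cell_def)

definition ixN :: "int \<times> int \<times> ('x \<times> real) \<Rightarrow> ('r, 'm) module" where
  "ixN = liftN (liftN N0)"

text \<open>The inner copies \<open>n\<close>, always contracted to the integers, serve to split the
  automorphism; the outer copies \<open>m\<close> carry the swindles. The copy with both indices 0
  is the object itself.\<close>

definition ix_pos :: "int \<times> int \<times> ('x \<times> real) \<Rightarrow> 'x \<times> real" where
  "ix_pos = (\<lambda>(m, n, y). shift D setp (cell m) m (shift D setp (1/2) n y))"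

definition ix_key :: "int \<times> int \<times> ('x \<times> real) \<Rightarrow> int \<times> int" where
  "ix_key = (\<lambda>(m, n, y). (m, n))"

definition ix_act :: "'g \<Rightarrow> int \<times> int \<times> ('x \<times> real) \<Rightarrow> int \<times> int \<times> ('x \<times> real)" where
  "ix_act g = map_prod id (map_prod id (act_cone (act_bar D) g))"

definition ixI :: "(int \<times> int \<times> ('x \<times> real)) set" where
  "ixI = UNIV \<times> UNIV \<times> cone"

lemma ix_fin: "finite {i \<in> ixI. carrier (ixN i) \<noteq> {\<zero>\<^bsub>ixN i\<^esub>} \<and> proj D (fst (ix_pos i)) \<in> {a..b} \<and> snd (ix_pos i) \<le> h}"
proof (rule finite_subset)
  \<comment> \<open>Each of the two contractions moves a point by at most 1, hence the margin 2. The
    height bounds both copy numbers.\<close>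
  let ?B = "{y \<in> mod_supp cone_top A. proj D (fst y) \<in> {a - 2..b + 2} \<and> snd y \<le> h}"
  let ?K = "{- \<lceil>h\<rceil>..\<lceil>h\<rceil>}"
  show "{i \<in> ixI. carrier (ixN i) \<noteq> {\<zero>\<^bsub>ixN i\<^esub>} \<and> proj D (fst (ix_pos i)) \<in> {a..b} \<and> snd (ix_pos i) \<le> h} \<subseteq> ?K \<times> ?K \<times> ?B"
  proof
    fix i
    assume i: "i \<in> {i \<in> ixI. carrier (ixN i) \<noteq> {\<zero>\<^bsub>ixN i\<^esub>} \<and> proj D (fst (ix_pos i)) \<in> {a..b} \<and> snd (ix_pos i) \<le> h}"
    obtain m n y t where mn: "i = (m, n, y, t)" by (cases i)
    have *: "(m, n, y, t) \<in> ixI" "carrier (ixN (m, n, y, t)) \<noteq> {\<zero>\<^bsub>ixN (m, n, y, t)\<^esub>}"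
      "proj D (fst (ix_pos (m, n, y, t))) \<in> {a..b}" "snd (ix_pos (m, n, y, t)) \<le> h" using i by (simp_all add: mn)
    have c: "(y, t) \<in> cone" using *(1) by (simp add: ixI_def)
    then have t: "1 \<le> t" by (simp add: cone_iff)
    have h: "t + \<bar>of_int n\<bar> + \<bar>of_int m\<bar> \<le> h" using *(4) by (simp add: ix_pos_def)
    let ?z = "shift D setp (1/2) n (y, t)"
    have "\<bar>proj D (fst ?z) - proj D y\<bar> \<le> 1"
      using contract_displacement shift_factor[OF c, of n] by (simp add: proj_shift)
    moreover have "\<bar>proj D (fst (ix_pos (m, n, y, t))) - proj D (fst ?z)\<bar> \<le> 1"
      using contract_displacement shift_factor[OF shift_cone[OF c, of "1/2" n], of m]
      by (simp add: ix_pos_def proj_shift[of "cell m" m])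
    ultimately have "proj D y \<in> {a - 2..b + 2}" using *(3) unfolding atLeastAtMost_iff by linarith
    moreover have "(y, t) \<in> mod_supp cone_top A" using *(2) c by (simp add: mod_supp_def ixN_def N0)
    moreover have "real_of_int m \<le> h" "- real_of_int m \<le> h" "real_of_int n \<le> h" "- real_of_int n \<le> h"
      using h t by linarith+
    then have "m \<in> ?K" "n \<in> ?K" by (simp_all, linarith+)
    ultimately show "i \<in> ?K \<times> ?K \<times> ?B" using h t by (simp add: mn)
  qed
  show "finite (?K \<times> ?K \<times> ?B)" by (intro finite_cartesian_product finite_supp_box) auto
qed

lemma ix_pos_key:
  assumes "i \<in> ixI" "j \<in> ixI" "ix_pos i = ix_pos j" "ix_key i = ix_key j"
  shows "i = j"
proof -
  obtain m n y z where ij: "i = (m, n, y)" "j = (m, n, z)" using assms(4) by (cases i, cases j) (auto simp: ix_key_def)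
  have c: "y \<in> cone" "z \<in> cone" using assms(1,2) ij by (auto simp: ixI_def)
  have "shift D setp (1/2) n y = shift D setp (1/2) n z"
    using assms(3) by (intro shift_inj[OF shift_cone[OF c(1)] shift_cone[OF c(2)]]) (simp add: ij ix_pos_def)
  then show ?thesis using shift_inj[OF c] ij by simp
qed

lemma ix_fin_fib: "finite {i \<in> ixI. ix_pos i = y}"
proof (rule inj_on_finite[of ix_key _ "{- \<lceil>snd y\<rceil>..\<lceil>snd y\<rceil>} \<times> {- \<lceil>snd y\<rceil>..\<lceil>snd y\<rceil>}"])
  show "inj_on ix_key {i \<in> ixI. ix_pos i = y}" using ix_pos_key by (auto simp: inj_on_def)
  show "ix_key ` {i \<in> ixI. ix_pos i = y} \<subseteq> {- \<lceil>snd y\<rceil>..\<lceil>snd y\<rceil>} \<times> {- \<lceil>snd y\<rceil>..\<lceil>snd y\<rceil>}"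
  proof (rule image_subsetI)
    fix i assume i: "i \<in> {i \<in> ixI. ix_pos i = y}"
    obtain m n x t where mn: "i = (m, n, x, t)" by (cases i)
    have "1 \<le> t" "snd y = t + \<bar>of_int n\<bar> + \<bar>of_int m\<bar>" using i by (auto simp: mn ixI_def cone_iff ix_pos_def)
    then have "real_of_int m \<le> snd y" "- real_of_int m \<le> snd y" "real_of_int n \<le> snd y" "- real_of_int n \<le> snd y" by linarith+
    then have "m \<in> {- \<lceil>snd y\<rceil>..\<lceil>snd y\<rceil>}" "n \<in> {- \<lceil>snd y\<rceil>..\<lceil>snd y\<rceil>}" by (simp_all, linarith+)
    then show "ix_key i \<in> {- \<lceil>snd y\<rceil>..\<lceil>snd y\<rceil>} \<times> {- \<lceil>snd y\<rceil>..\<lceil>snd y\<rceil>}" by (simp add: mn ix_key_def)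
  qed
qed auto

sublocale ixs: index_system D setp R ixN ix_pos ix_key ix_act ixI \<iota>
proof (intro index_system.intro index_system_axioms.intro line_data_axioms)
  show "ring R" by (rule R)
  show "inj_on \<iota> (lists (carrier R))" by (rule \<iota>)
  show "modfam R ixN" unfolding ixN_def by (intro modfam_liftN modfam_N0)
  show "fg_free R (ixN i)" if "i \<in> ixI" for i using that fg_A by (auto simp: ixI_def ixN_def N0)
  show "carrier (ixN i) = {\<zero>\<^bsub>ixN i\<^esub>}" if "i \<notin> ixI" for i
    using that triv_N0 by (cases i) (simp add: ixI_def ixN_def)
  show "ix_pos i \<in> cone" if "i \<in> ixI" for i using that by (auto simp: ixI_def ix_pos_def intro!: shift_cone)
  show "bij (ix_act g)" if "g \<in> carrier (grp D)" for g
    unfolding ix_act_def bij_def using bij_act[OF that, unfolded bij_def]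
    by (intro conjI prod.inj_map map_prod_surj) simp_all
  show "ixN (ix_act g i) = ixN i" if "g \<in> carrier (grp D)" for g i
    by (cases i) (simp add: ixN_def ix_act_def N0_act[OF that])
  show "ix_pos (ix_act g i) = act_cone (act_bar D) g (ix_pos i)" if "g \<in> carrier (grp D)" for g i
    using shift_act[OF that two_cell] shift_act[OF that, of "1/2" 1] by (cases i) (simp add: ix_pos_def ix_act_def)
  show "ix_key (ix_act g i) = ix_key i" if "g \<in> carrier (grp D)" for g i
    by (cases i) (simp add: ix_key_def ix_act_def)
  show "ix_act g i \<in> ixI \<longleftrightarrow> i \<in> ixI" if "g \<in> carrier (grp D)" for g i
    by (cases i) (simp add: ixI_def ix_act_def act_cone_iff)
qed (fact ix_pos_key ix_fin ix_fin_fib)+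

lemma ixH: "ixs.H = liftH (liftH H0)"
  by (simp add: ixs.H_def liftH_def H0_def image_image ix_act_def)

end

section \<open>The operator of a morphism\<close>

context line_module
begin

abbreviation "msupp \<equiv> mor_supp cone_top A A"

lemma msupp_cone:
  assumes "(x, y) \<in> msupp \<phi>"
  shows "x \<in> cone" "y \<in> cone"
  using assms by (auto simp: mor_supp_def)

lemma sec_A: "s \<in> sec N0 \<Longrightarrow> x \<in> cone \<Longrightarrow> s x \<in> carrier (A x)"
  using sec_carrier[of s N0 x] by (simp add: N0)

lemma opr_cone: "y \<in> cone \<Longrightarrow> opr A \<phi> s y = (\<Oplus>\<^bsub>A y\<^esub>x\<in>{x. (x, y) \<in> msupp \<phi>}. \<phi> x y (s x))"
  by (simp add: opr_def)

definition line_rel :: "(('x \<times> real) \<times> ('x \<times> real)) set \<Rightarrow> ((real \<times> real) \<times> (real \<times> real)) set" where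
  "line_rel E = map_prod (cone_line D) (cone_line D) ` E"

context
  fixes \<phi> assumes \<phi>: "\<phi> \<in> O_homs R D A A"
begin

lemma hom_lin: "x \<in> cone \<Longrightarrow> y \<in> cone \<Longrightarrow> \<phi> x y \<in> lin_maps R (A x) (A y)"
  using \<phi> by (auto simp: O_homs_def geom_mor_def)

lemma hom_closed: "x \<in> cone \<Longrightarrow> y \<in> cone \<Longrightarrow> v \<in> carrier (A x) \<Longrightarrow> \<phi> x y v \<in> carrier (A y)"
  using hom_lin by (fastforce simp: lin_maps_def)

lemma hom_add: "x \<in> cone \<Longrightarrow> y \<in> cone \<Longrightarrow> v \<in> carrier (A x) \<Longrightarrow> w \<in> carrier (A x) \<Longrightarrow>
    \<phi> x y (v \<oplus>\<^bsub>A x\<^esub> w) = \<phi> x y v \<oplus>\<^bsub>A y\<^esub> \<phi> x y w"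
  using hom_lin[of x y] by (simp add: lin_maps_def)

lemma hom_smult: "x \<in> cone \<Longrightarrow> y \<in> cone \<Longrightarrow> v \<in> carrier (A x) \<Longrightarrow> a \<in> carrier R \<Longrightarrow>
    \<phi> x y (a \<odot>\<^bsub>A x\<^esub> v) = a \<odot>\<^bsub>A y\<^esub> \<phi> x y v"
  using hom_lin[of x y] by (simp add: lin_maps_def)

lemma hom_zero: "x \<in> cone \<Longrightarrow> y \<in> cone \<Longrightarrow> \<phi> x y \<zero>\<^bsub>A x\<^esub> = \<zero>\<^bsub>A y\<^esub>"
proof -
  assume *: "x \<in> cone" "y \<in> cone"
  interpret X: left_module R "A x" using * by (intro left_module_A)
  interpret Y: left_module R "A y" using * by (intro left_module_A)
  have "\<phi> x y \<zero>\<^bsub>A x\<^esub> \<oplus>\<^bsub>A y\<^esub> \<phi> x y \<zero>\<^bsub>A x\<^esub> = \<phi> x y \<zero>\<^bsub>A x\<^esub>"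
    using hom_add[OF *, of "\<zero>\<^bsub>A x\<^esub>" "\<zero>\<^bsub>A x\<^esub>"] by simp
  then show ?thesis using hom_closed[OF *, of "\<zero>\<^bsub>A x\<^esub>"] by (metis Y.M.add.r_cancel_one X.M.zero_closed)
qed

lemma hom_off: "x \<in> cone \<Longrightarrow> y \<in> cone \<Longrightarrow> (x, y) \<notin> msupp \<phi> \<Longrightarrow> v \<in> carrier (A x) \<Longrightarrow> \<phi> x y v = \<zero>\<^bsub>A y\<^esub>"
  by (auto simp: mor_supp_def zero_map_def)

lemma finite_col: "finite {x. (x, y) \<in> msupp \<phi>}" and finite_row: "finite {x. (y, x) \<in> msupp \<phi>}"
proof -
  have "finite {x. (x, y) \<in> msupp \<phi>} \<and> finite {x. (y, x) \<in> msupp \<phi>}"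
  proof (cases "y \<in> cone")
    case True
    then show ?thesis using \<phi> by (auto simp: O_homs_def geom_mor_def)
  next
    case False
    then have e: "{x. (x, y) \<in> msupp \<phi>} = {}" "{x. (y, x) \<in> msupp \<phi>} = {}" by (auto dest: msupp_cone)
    show ?thesis unfolding e by simp
  qed
  then show "finite {x. (x, y) \<in> msupp \<phi>}" "finite {x. (y, x) \<in> msupp \<phi>}" by auto
qed

lemma locally_finite_msupp: "locally_finite (msupp \<phi>)"
  using finite_col finite_row by (simp add: locally_finite_def Image_def)

lemma ctrl_msupp: "ctrl (line_rel (msupp \<phi>))"
proof -
  obtain E where E: "E \<in> E_Gcc (grp D) (act_line D)"
    "\<forall>((x, t), (y, s))\<in>msupp \<phi>. ((proj D x, t), (proj D y, s)) \<in> E"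
    using \<phi> by (auto simp: O_homs_def)
  then have "line_rel (msupp \<phi>) \<subseteq> E" by (auto simp: line_rel_def cone_line_def)
  then show ?thesis using E_Gcc_ctrl[OF E(1)] ctrl_subset by blast
qed

lemma summand_closed: "s \<in> sec N0 \<Longrightarrow> (\<lambda>x. \<phi> x y (s x)) \<in> {x. (x, y) \<in> msupp \<phi>} \<rightarrow> carrier (A y)"
  by (intro Pi_I hom_closed sec_A; simp add: msupp_cone)

lemma opr_supp: "s \<in> sec N0 \<Longrightarrow> supp N0 (opr A \<phi> s) \<subseteq> msupp \<phi> `` supp N0 s"
proof
  fix y assume s: "s \<in> sec N0" and y: "y \<in> supp N0 (opr A \<phi> s)"
  have yc: "y \<in> cone"
  proof (rule ccontr)
    assume "y \<notin> cone"
    then show False using y by (simp add: supp_def opr_def N0_def ext_mod_def triv_module_def)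
  qed
  interpret Y: left_module R "A y" by (rule left_module_A[OF yc])
  show "y \<in> msupp \<phi> `` supp N0 s"
  proof (rule ccontr)
    assume no: "y \<notin> msupp \<phi> `` supp N0 s"
    have z: "\<phi> x y (s x) = \<zero>\<^bsub>A y\<^esub>" if x: "(x, y) \<in> msupp \<phi>" for x
    proof -
      have xc: "x \<in> cone" by (rule msupp_cone[OF x])
      have "x \<notin> supp N0 s" using no x by auto
      then show ?thesis using hom_zero[OF xc yc] by (simp add: supp_def N0[OF xc])
    qed
    have "opr A \<phi> s y = (\<Oplus>\<^bsub>A y\<^esub>x\<in>{x. (x, y) \<in> msupp \<phi>}. \<zero>\<^bsub>A y\<^esub>)"
      unfolding opr_cone[OF yc] by (intro Y.M.finsum_cong') (simp_all add: z)
    then show False using y by (simp add: supp_def N0[OF yc])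
  qed
qed

lemma opr_sec: "s \<in> sec N0 \<Longrightarrow> opr A \<phi> s \<in> sec N0"
proof (rule secI[OF _ _ opr_supp])
  assume s: "s \<in> sec N0"
  show "opr A \<phi> s y \<in> carrier (N0 y)" for y
  proof (cases "y \<in> cone")
    case True
    interpret Y: left_module R "A y" by (rule left_module_A[OF True])
    show ?thesis using Y.M.finsum_closed[OF summand_closed[OF s]] True by (simp add: N0 opr_def)
  next
    case False
    then show ?thesis by (simp add: opr_def N0_def ext_mod_def triv_module_def)
  qed
  have "msupp \<phi> `` supp N0 s = (\<Union>x\<in>supp N0 s. {y. (x, y) \<in> msupp \<phi>})" by auto
  then show "finite (msupp \<phi> `` supp N0 s)" using finite_supp[OF s] finite_row by simp
qed

lemma linop_opr: "linop R N0 (opr A \<phi>)"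
  unfolding linop_def
proof (intro conjI ballI Pi_I opr_sec)
  fix s t assume s: "s \<in> sec N0" and t: "t \<in> sec N0"
  show "opr A \<phi> (sadd N0 s t) = sadd N0 (opr A \<phi> s) (opr A \<phi> t)"
  proof
    fix y
    show "opr A \<phi> (sadd N0 s t) y = sadd N0 (opr A \<phi> s) (opr A \<phi> t) y"
    proof (cases "y \<in> cone")
      case True
      interpret Y: left_module R "A y" by (rule left_module_A[OF True])
      have "opr A \<phi> (sadd N0 s t) y = (\<Oplus>\<^bsub>A y\<^esub>x\<in>{x. (x, y) \<in> msupp \<phi>}. \<phi> x y (s x) \<oplus>\<^bsub>A y\<^esub> \<phi> x y (t x))"
        unfolding opr_cone[OF True]
      proof (rule Y.M.finsum_cong')
        show "(\<lambda>x. \<phi> x y (s x) \<oplus>\<^bsub>A y\<^esub> \<phi> x y (t x)) \<in> {x. (x, y) \<in> msupp \<phi>} \<rightarrow> carrier (A y)"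
          using summand_closed[OF s, of y] summand_closed[OF t, of y] by auto
        fix x assume "x \<in> {x. (x, y) \<in> msupp \<phi>}"
        then have xc: "x \<in> cone" by (simp add: msupp_cone)
        show "\<phi> x y (sadd N0 s t x) = \<phi> x y (s x) \<oplus>\<^bsub>A y\<^esub> \<phi> x y (t x)"
          using hom_add[OF xc True sec_A[OF s xc] sec_A[OF t xc]] by (simp add: sadd_def N0[OF xc])
      qed simp
      also have "\<dots> = opr A \<phi> s y \<oplus>\<^bsub>A y\<^esub> opr A \<phi> t y"
        unfolding opr_cone[OF True] by (intro Y.M.finsum_addf summand_closed s t)
      finally show ?thesis by (simp add: sadd_def N0[OF True])
    next
      case False
      then show ?thesis by (simp add: opr_def sadd_def N0_def ext_mod_def triv_module_def)
    qed
  qed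
next
  fix a s assume a: "a \<in> carrier R" and s: "s \<in> sec N0"
  show "opr A \<phi> (smul N0 a s) = smul N0 a (opr A \<phi> s)"
  proof
    fix y
    show "opr A \<phi> (smul N0 a s) y = smul N0 a (opr A \<phi> s) y"
    proof (cases "y \<in> cone")
      case True
      interpret Y: left_module R "A y" by (rule left_module_A[OF True])
      have "opr A \<phi> (smul N0 a s) y = (\<Oplus>\<^bsub>A y\<^esub>x\<in>{x. (x, y) \<in> msupp \<phi>}. a \<odot>\<^bsub>A y\<^esub> \<phi> x y (s x))"
        unfolding opr_cone[OF True]
      proof (rule Y.M.finsum_cong')
        show "(\<lambda>x. a \<odot>\<^bsub>A y\<^esub> \<phi> x y (s x)) \<in> {x. (x, y) \<in> msupp \<phi>} \<rightarrow> carrier (A y)"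
          using summand_closed[OF s, of y] Y.smult_closed[OF a] by auto
        fix x assume "x \<in> {x. (x, y) \<in> msupp \<phi>}"
        then have xc: "x \<in> cone" by (simp add: msupp_cone)
        show "\<phi> x y (smul N0 a s x) = a \<odot>\<^bsub>A y\<^esub> \<phi> x y (s x)"
          using hom_smult[OF xc True sec_A[OF s xc] a] by (simp add: smul_def N0[OF xc])
      qed simp
      also have "\<dots> = a \<odot>\<^bsub>A y\<^esub> opr A \<phi> s y"
        unfolding opr_cone[OF True] by (intro Y.finsum_smult summand_closed s a)
      finally show ?thesis by (simp add: smul_def N0[OF True])
    next
      case False
      then show ?thesis by (simp add: opr_def smul_def N0_def ext_mod_def triv_module_def)
    qed
  qed
qed

lemma eqv_opr: "eqv N0 H0 (opr A \<phi>)"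
  unfolding eqv_def H0_def
proof (intro ballI, elim imageE, hypsubst)
  fix s g assume s: "s \<in> sec N0" and g: "g \<in> carrier (grp D)"
  let ?a = "act_cone (act_bar D) g"
  have inv: "\<phi> (?a x) (?a y) = \<phi> x y" if "x \<in> cone" "y \<in> cone" for x y
    using \<phi> g that by (auto simp: O_homs_def inv_mor_def)
  have Aa: "A (?a x) = A x" if "x \<in> cone" for x
    using A g that by (auto simp: O_objs_def inv_module_def)
  have ms: "(?a x, ?a y) \<in> msupp \<phi> \<longleftrightarrow> (x, y) \<in> msupp \<phi>" if "y \<in> cone" for x y
    using that by (auto simp: mor_supp_def act_cone_iff inv Aa)
  show "opr A \<phi> (s \<circ> ?a) = opr A \<phi> s \<circ> ?a"
  proof
    fix y
    show "opr A \<phi> (s \<circ> ?a) y = (opr A \<phi> s \<circ> ?a) y"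
    proof (cases "y \<in> cone")
      case True
      interpret Y: left_module R "A y" by (rule left_module_A[OF True])
      have im: "{x. (x, ?a y) \<in> msupp \<phi>} = ?a ` {x. (x, y) \<in> msupp \<phi>}"
      proof (intro equalityI subsetI)
        fix x assume x: "x \<in> {x. (x, ?a y) \<in> msupp \<phi>}"
        obtain z where "x = ?a z" using bij_act[OF g] by (metis bij_pointE)
        then show "x \<in> ?a ` {x. (x, y) \<in> msupp \<phi>}" using x ms[OF True] by auto
      qed (use ms[OF True] in auto)
      have inj: "inj_on ?a {x. (x, y) \<in> msupp \<phi>}" using bij_act[OF g] by (auto simp: bij_def intro: inj_on_subset)
      have "opr A \<phi> s (?a y) = (\<Oplus>\<^bsub>A y\<^esub>x\<in>?a ` {x. (x, y) \<in> msupp \<phi>}. \<phi> x (?a y) (s x))"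
        using True by (simp add: opr_def act_cone_iff Aa im)
      also have "\<dots> = (\<Oplus>\<^bsub>A y\<^esub>x\<in>{x. (x, y) \<in> msupp \<phi>}. \<phi> (?a x) (?a y) (s (?a x)))"
        using summand_closed[OF s, of "?a y"] by (intro Y.M.finsum_reindex inj) (simp add: im Aa[OF True])
      also have "\<dots> = opr A \<phi> (s \<circ> ?a) y"
        unfolding opr_cone[OF True]
      proof (rule Y.M.finsum_cong')
        show "(\<lambda>x. \<phi> x y ((s \<circ> ?a) x)) \<in> {x. (x, y) \<in> msupp \<phi>} \<rightarrow> carrier (A y)"
          using summand_closed[OF sec_comp[OF invfam_N0 _ s], of ?a y] g by (simp add: H0_def)
        fix x assume "x \<in> {x. (x, y) \<in> msupp \<phi>}"
        then show "\<phi> (?a x) (?a y) (s (?a x)) = \<phi> x y ((s \<circ> ?a) x)"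
          by (simp add: inv True msupp_cone)
      qed simp
      finally show ?thesis by simp
    next
      case False
      then show ?thesis by (simp add: opr_def act_cone_iff)
    qed
  qed
qed

lemma local_op_opr: "local_op R N0 H0 (opr A \<phi>) (msupp \<phi>)"
  using linop_opr eqv_opr opr_supp by (simp add: local_op_def loc_def)

text \<open>Sections concentrated at one point give back the entries of the matrix.\<close>

lemma opr_single:
  assumes x: "x \<in> cone" and v: "v \<in> carrier (A x)" and y: "y \<in> cone"
    and s: "s \<in> sec N0" "s x = v" "supp N0 s \<subseteq> {x}"
  shows "opr A \<phi> s y = \<phi> x y v"
proof -
  interpret Y: left_module R "A y" by (rule left_module_A[OF y])
  have z: "\<phi> x' y (s x') = \<zero>\<^bsub>A y\<^esub>" if "(x', y) \<in> msupp \<phi>" "x' \<noteq> x" for x'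
  proof -
    have xc: "x' \<in> cone" by (rule msupp_cone[OF that(1)])
    have "x' \<notin> supp N0 s" using s that by auto
    then show ?thesis using hom_zero[OF xc y] by (simp add: supp_def N0[OF xc])
  qed
  show ?thesis
  proof (cases "(x, y) \<in> msupp \<phi>")
    case True
    have "opr A \<phi> s y = (\<Oplus>\<^bsub>A y\<^esub>x'\<in>{x. (x, y) \<in> msupp \<phi>}. if x' = x then \<phi> x' y (s x') else \<zero>\<^bsub>A y\<^esub>)"
      unfolding opr_cone[OF y] using summand_closed[OF s(1), of y]
      by (intro Y.M.finsum_cong') (auto simp: z Pi_iff)
    also have "\<dots> = \<phi> x y (s x)"
      using True by (intro Y.M.add.finprod_singleton_swap finite_col summand_closed s(1)) simp
    finally show ?thesis by (simp add: s)
  next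
    case False
    have z': "\<phi> x' y (s x') = \<zero>\<^bsub>A y\<^esub>" if "(x', y) \<in> msupp \<phi>" for x' using z[OF that] that False by blast
    have "opr A \<phi> s y = (\<Oplus>\<^bsub>A y\<^esub>x'\<in>{x. (x, y) \<in> msupp \<phi>}. \<zero>\<^bsub>A y\<^esub>)"
      unfolding opr_cone[OF y] by (intro Y.M.finsum_cong') (simp_all add: z')
    then show ?thesis using hom_off[OF x y False v] by simp
  qed
qed

end

text \<open>By additivity and finiteness of supports it is enough to treat a section concentrated at
  one point, where applying the two operators computes an entry of the matrix product.\<close>

lemma opr_comp:
  assumes \<phi>: "\<phi> \<in> O_homs R D A A" and \<psi>: "\<psi> \<in> O_homs R D A A"
    and comp: "mor_comp cone_top A A A \<psi> \<phi> = mor_id cone_top A" and s: "s \<in> sec N0"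
  shows "opr A \<psi> (opr A \<phi> s) = s"
proof -
  have lin: "linop R N0 (\<lambda>s. opr A \<psi> (opr A \<phi> s))" by (rule linop_comp[OF linop_opr[OF \<phi>] linop_opr[OF \<psi>]])
  have single: "opr A \<psi> (opr A \<phi> s) = s" if s: "s \<in> sec N0" and sx: "supp N0 s \<subseteq> {x}" and x: "x \<in> cone" for s x
  proof
    fix z
    show "opr A \<psi> (opr A \<phi> s) z = s z"
    proof (cases "z \<in> cone")
      case True
      interpret Y: left_module R "A z" by (rule left_module_A[OF True])
      define v where "v = s x"
      have v: "v \<in> carrier (A x)" using sec_A[OF s x] by (simp add: v_def)
      have \<phi>s: "opr A \<phi> s y = \<phi> x y v" if "y \<in> cone" for y
        using opr_single[OF \<phi> x v that s _ sx] by (simp add: v_def)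
      have cl: "\<psi> y z (\<phi> x y v) \<in> carrier (A z)" if "y \<in> cone" for y
        by (intro hom_closed[OF \<psi>] hom_closed[OF \<phi>] that True x v)
      have "opr A \<psi> (opr A \<phi> s) z = (\<Oplus>\<^bsub>A z\<^esub>y\<in>{y. (y, z) \<in> msupp \<psi>}. \<psi> y z (\<phi> x y v))"
        unfolding opr_cone[OF True] by (intro Y.M.finsum_cong') (simp_all add: cl \<phi>s msupp_cone Pi_iff)
      \<comment> \<open>The operator sums over the points from which \<psi> reaches
        \<open>z\<close>, the matrix product over those that \<phi> reaches from \<open>x\<close>;
        the terms by which they differ vanish.\<close>
      also have "\<dots> = (\<Oplus>\<^bsub>A z\<^esub>y\<in>{y. (x, y) \<in> msupp \<phi>}. \<psi> y z (\<phi> x y v))"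
      proof (rule Y.M.add.finprod_mono_neutral_cong)
        fix y assume "y \<in> {y. (x, y) \<in> msupp \<phi>} - {y. (y, z) \<in> msupp \<psi>}"
        then have y: "y \<in> cone" "(y, z) \<notin> msupp \<psi>" by (auto dest: msupp_cone)
        show "\<psi> y z (\<phi> x y v) = \<zero>\<^bsub>A z\<^esub>"
          by (intro hom_off[OF \<psi>] hom_closed[OF \<phi>] True v x y)
      next
        fix y assume y: "y \<in> {y. (y, z) \<in> msupp \<psi>} - {y. (x, y) \<in> msupp \<phi>}"
        then have yc: "y \<in> cone" by (auto dest: msupp_cone)
        show "\<psi> y z (\<phi> x y v) = \<zero>\<^bsub>A z\<^esub>"
          using y hom_off[OF \<phi> x yc _ v] hom_zero[OF \<psi> yc True] by simp
      qed (simp_all add: finite_col[OF \<psi>] finite_row[OF \<phi>] cl msupp_cone Pi_iff)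
      also have "\<dots> = mor_comp cone_top A A A \<psi> \<phi> x z v"
        using x True v by (simp add: mor_comp_def)
      also have "\<dots> = (if x = z then v else \<zero>\<^bsub>A z\<^esub>)"
        using x True v by (cases "x = z") (simp_all add: comp mor_id_def zero_map_def)
      also have "\<dots> = s z"
      proof (cases "x = z")
        case False
        then have "z \<notin> supp N0 s" using sx by blast
        then show ?thesis using False by (simp add: supp_def N0[OF True])
      qed (simp add: v_def)
      finally show ?thesis .
    next
      case False
      then show ?thesis using sec_off[OF s False] by (simp add: opr_def)
    qed
  qed
  have "opr A \<psi> (opr A \<phi> t) = t" if "finite X" "X \<subseteq> cone" "t \<in> sec N0" "supp N0 t \<subseteq> X" for X t
    using that
  proof (induction X arbitrary: t rule: finite_induct)
    case empty
    then have "supp N0 t = {}" by simp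
    from sec_supp_empty[OF this] show ?case using linop_zero[OF modfam_N0 lin] by simp
  next
    case (insert x X)
    let ?a = "restr N0 {x} t" and ?b = "restr N0 X t"
    have ab: "?a \<in> sec N0" "?b \<in> sec N0" using sec_restr[OF modfam_N0 insert.prems(2)] by auto
    have "sadd N0 ?a ?b = t"
      using sadd_restr[OF modfam_N0 insert.prems(2), of "{x}" X] insert.hyps insert.prems(3) by (simp add: restr_id)
    moreover have "opr A \<psi> (opr A \<phi> ?a) = ?a"
      using insert.prems(1) by (intro single[OF ab(1), of x]) (auto simp: supp_restr)
    moreover have "opr A \<psi> (opr A \<phi> ?b) = ?b"
      using insert.prems(1) ab(2) by (intro insert.IH) (auto simp: supp_restr)
    ultimately show ?case using linopD(2)[OF lin ab] by simp
  qed
  from this[OF finite_supp[OF s] supp_cone[OF s] s order_refl] show ?thesis .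
qed

definition J0 :: "(int \<times> int \<times> ('x \<times> real)) set" where
  "J0 = {0} \<times> {0} \<times> cone"

definition inn0 :: "'x \<times> real \<Rightarrow> 'm \<Rightarrow> int \<times> int \<times> ('x \<times> real) \<Rightarrow> 'm" where
  "inn0 y v = (\<lambda>i. if i = (0, 0, y) then v else \<zero>\<^bsub>ixN i\<^esub>)"

definition out0 :: "'x \<times> real \<Rightarrow> (int \<times> int \<times> ('x \<times> real) \<Rightarrow> 'm) \<Rightarrow> 'm" where
  "out0 y s = s (0, 0, y)"

lemma ixN0: "y \<in> cone \<Longrightarrow> ixN (m, n, y) = A y"
  by (simp add: ixN_def N0)

text \<open>The modules of \<open>A\<close> are used as they are and not rebuilt from labels, so
  that the operator of \<alpha> gives back \<alpha> itself and no isomorphism of objects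
  intervenes.\<close>

lemma pres_A: "ixs.pres J0 A inn0 out0"
proof -
  have J0: "ixs.invariant J0"
    unfolding ixs.invariant_def by (auto simp: J0_def ixI_def ix_act_def act_cone_iff)
  have fib: "ixs.fib J0 y = {(0, 0, y)}" if "y \<in> cone" for y
    using that unfolding ixs.fib_def by (auto simp: J0_def ix_pos_def)
  have inn: "inn0 y v \<in> sec ixN" if "y \<in> cone" "v \<in> carrier (A y)" for y v
  proof (rule secI[of _ _ "{(0, 0, y)}"])
    show "inn0 y v i \<in> carrier (ixN i)" for i
      using that modfam_ops(1)[OF ixs.N, of i] by (auto simp: inn0_def ixN0)
  qed (auto simp: inn0_def supp_def)
  show ?thesis
    unfolding ixs.pres_def
  proof (intro conjI ballI J0 A inn)
    fix y s assume y: "y \<in> (cone :: ('x \<times> real) set)" and s: "s \<in> sec ixN"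
    show "out0 y s \<in> carrier (A y)" using sec_carrier[OF s, of "(0, 0, y)"] y by (simp add: out0_def ixN0)
    show "inn0 y (out0 y s) = restr ixN (ixs.fib J0 y) s"
      by (auto simp: inn0_def out0_def restr_def fib[OF y] fun_eq_iff)
    fix t show "out0 y (sadd ixN s t) = out0 y s \<oplus>\<^bsub>A y\<^esub> out0 y t"
      using y by (simp add: out0_def sadd_def ixN0)
  next
    fix y a s assume "y \<in> (cone :: ('x \<times> real) set)"
    then show "out0 y (smul ixN a s) = a \<odot>\<^bsub>A y\<^esub> out0 y s" by (simp add: out0_def smul_def ixN0)
  next
    fix y v show "out0 y (inn0 y v) = v" by (simp add: out0_def inn0_def)
  next
    fix g y s show "out0 (act_cone (act_bar D) g y) s = out0 y (s \<circ> ix_act g)"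
      by (simp add: out0_def ix_act_def)
  qed
qed

lemma mor_A:
  assumes \<phi>: "\<phi> \<in> O_homs R D A A"
    and T: "\<And>s. s \<in> sec ixN \<Longrightarrow> T s = diag {0} (diag {0} (opr A \<phi>)) s"
  shows "ixs.mor A inn0 out0 T = \<phi>"
proof -
  have "out0 y (T (inn0 x v)) = \<phi> x y v" if x: "x \<in> cone" and y: "y \<in> cone" and v: "v \<in> carrier (A x)" for x y v
  proof -
    interpret P: presented D setp R ixN ix_pos ix_key ix_act ixI \<iota> J0 A inn0 out0
      by (rule ixs.presented[OF pres_A])
    have s: "inn0 x v \<in> sec ixN" by (rule P.inn_sec[OF x v])
    define t where "t = (\<lambda>i. inn0 x v (0, 0, i))"
    have t: "t \<in> sec N0" unfolding t_def using sec_slice[OF sec_slice[OF s[unfolded ixN_def], of 0], of 0] .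
    have "out0 y (T (inn0 x v)) = opr A \<phi> t y" by (simp add: T[OF s] out0_def diag_def t_def)
    also have "\<dots> = \<phi> x y v"
      by (rule opr_single[OF \<phi> x v y t]) (auto simp: t_def inn0_def supp_def ixN_def)
    finally show ?thesis .
  qed
  then have e: "ixs.mor A inn0 out0 T = (\<lambda>x\<in>cone. \<lambda>y\<in>cone. \<lambda>v\<in>carrier (A x). \<phi> x y v)"
    unfolding ixs.mor_def by (intro restrict_ext) simp
  have "\<phi> \<in> (\<Pi>\<^sub>E x\<in>cone. \<Pi>\<^sub>E y\<in>cone. lin_maps R (A x) (A y))"
    using \<phi> by (auto simp: O_homs_def geom_mor_def)
  moreover have "(\<lambda>v\<in>carrier (A x). \<phi> x y v) = \<phi> x y" if "x \<in> cone" "y \<in> cone" for x y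
    using hom_lin[OF \<phi> that] by (auto simp: lin_maps_def PiE_restrict)
  ultimately have "(\<lambda>x\<in>cone. \<lambda>y\<in>cone. \<lambda>v\<in>carrier (A x). \<phi> x y v) = \<phi>"
    by (intro PiE_ext[of _ cone "\<lambda>x. UNIV"] PiE_ext[of _ cone "\<lambda>y. UNIV"]) (auto simp: PiE_iff extensional_def fun_eq_iff)
  then show ?thesis using e by simp
qed

end

section \<open>Squeezing\<close>

definition near :: "real \<Rightarrow> real \<Rightarrow> bool" where
  "near r x \<longleftrightarrow> (\<exists>k::int. \<bar>x - of_int k\<bar> \<le> r)"

lemma near_triangle: "near r x \<Longrightarrow> \<bar>x - y\<bar> \<le> d \<Longrightarrow> near (r + d) y"
proof -
  assume "near r x" and d: "\<bar>x - y\<bar> \<le> d"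
  then obtain k :: int where "\<bar>x - of_int k\<bar> \<le> r" by (auto simp: near_def)
  then have "\<bar>y - of_int k\<bar> \<le> r + d" using d by linarith
  then show ?thesis by (auto simp: near_def)
qed

lemma near_add_int: "near r x \<Longrightarrow> near r (of_int n + x)"
proof -
  assume "near r x"
  then obtain k :: int where "\<bar>x - of_int k\<bar> \<le> r" by (auto simp: near_def)
  then show ?thesis unfolding near_def by (intro exI[of _ "n + k"]) simp
qed

lemma near_int_diff: "near r x \<Longrightarrow> near r (of_int n - x)"
proof -
  assume "near r x"
  then obtain k :: int where "\<bar>x - of_int k\<bar> \<le> r" by (auto simp: near_def)
  then have "\<bar>of_int n - x - of_int (n - k)\<bar> \<le> r" unfolding of_int_diff by linarith
  then show ?thesis unfolding near_def by blast
qed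

text \<open>1/3 + 1/6 = 1/2 is the distance from an integer to the boundary of the cell around
  it.\<close>

lemma near_same_cell_half:
  assumes "near (1/3) x" "\<bar>x - y\<bar> < 1/6"
  shows "same_cell (1/2) x y"
proof -
  obtain k :: int where "\<bar>x - of_int k\<bar> \<le> 1/3" using assms(1) by (auto simp: near_def)
  then have "x - of_int k \<le> 1/3" "of_int k - x \<le> 1/3" by linarith+
  moreover have "x - y < 1/6" "y - x < 1/6" using assms(2) by linarith+
  ultimately show ?thesis by (intro same_cellI[of "k - 1"]) simp_all
qed

text \<open>The boundary consists of the integers, and both of them next to \<open>x\<close> are
  farther away than 1/5.\<close>

lemma not_near_same_cell:
  assumes "\<not> near (1/5) x" "\<bar>x - y\<bar> \<le> 1/5"
  shows "same_cell 0 x y"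
proof -
  let ?k = "\<lfloor>x\<rfloor>"
  have "\<bar>x - of_int ?k\<bar> > 1/5" "\<bar>x - of_int (?k + 1)\<bar> > 1/5"
    using assms(1) unfolding near_def by (metis not_le)+
  moreover have "of_int ?k \<le> x" "x < of_int ?k + 1" by linarith+
  ultimately have "of_int ?k < x - 1/5" "x + 1/5 < of_int ?k + 1" by linarith+
  moreover have "x - y \<le> 1/5" "y - x \<le> 1/5" using assms(2) by linarith+
  ultimately show ?thesis by (intro same_cellI[of ?k]) linarith+
qed

lemma locally_finite_relpow: "locally_finite E \<Longrightarrow> locally_finite (E ^^ n)"
  by (induction n) (auto intro: locally_finite_Id locally_finite_comp)

lemma locally_finite_spread: "locally_finite E \<Longrightarrow> locally_finite (spread d n E)"
proof -
  assume "locally_finite E"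
  then have E: "locally_finite (E ^^ n)" by (rule locally_finite_relpow)
  have "finite (spread d n E `` {(k, i)})" "finite ((spread d n E)\<inverse> `` {(k, i)})" for k i
  proof -
    have "spread d n E `` {(k, i)} \<subseteq> {k - d..k + d} \<times> (E ^^ n) `` {i}"
      "(spread d n E)\<inverse> `` {(k, i)} \<subseteq> {k - d..k + d} \<times> (E ^^ n)\<inverse> `` {i}"
      by (auto simp: spread_def)
    then show "finite (spread d n E `` {(k, i)})" "finite ((spread d n E)\<inverse> `` {(k, i)})"
      using E unfolding locally_finite_def by (meson finite_SigmaI finite_atLeastAtMost_int finite_subset)+
  qed
  then show ?thesis by (auto simp: locally_finite_def)
qed

lemma locally_finite_diag:
  assumes "locally_finite E"
  shows "locally_finite {((k, i), (k', j)). k' = k \<and> (k \<in> S \<and> (i, j) \<in> E \<or> i = j)}" (is "locally_finite ?E")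
proof -
  have "finite (?E `` {(k, i)})" "finite (?E\<inverse> `` {(k, i)})" for k i
  proof -
    have "?E `` {(k, i)} \<subseteq> {k} \<times> (insert i (E `` {i}))" "?E\<inverse> `` {(k, i)} \<subseteq> {k} \<times> (insert i (E\<inverse> `` {i}))" by auto
    then show "finite (?E `` {(k, i)})" "finite (?E\<inverse> `` {(k, i)})"
      using assms unfolding locally_finite_def by (meson finite_SigmaI finite.intros finite_subset)+
  qed
  then show ?thesis by (auto simp: locally_finite_def)
qed

lemma locally_finite_swap:
  assumes "\<And>k. \<sigma> (\<sigma> k) = k"
  shows "locally_finite {((k, i), (k', j)). i = j \<and> (k' = k \<or> k' = \<sigma> k)}" (is "locally_finite ?E")
proof -
  have "finite (?E `` {(k, i)})" "finite (?E\<inverse> `` {(k, i)})" for k i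
  proof -
    have "?E `` {(k, i)} \<subseteq> {k, \<sigma> k} \<times> {i}" "?E\<inverse> `` {(k, i)} \<subseteq> {k, \<sigma> k} \<times> {i}" using assms by auto
    then show "finite (?E `` {(k, i)})" "finite (?E\<inverse> `` {(k, i)})" by (meson finite_SigmaI finite.intros finite_subset)+
  qed
  then show ?thesis by (auto simp: locally_finite_def)
qed

section \<open>Killing an operator that respects cells\<close>

context line_module
begin

abbreviation "NB \<equiv> liftN N0 :: int \<times> 'x \<times> real \<Rightarrow> ('r, 'm) module"
abbreviation "HB \<equiv> liftH H0 :: (int \<times> 'x \<times> real \<Rightarrow> int \<times> 'x \<times> real) set"

definition posB :: "int \<times> 'x \<times> real \<Rightarrow> 'x \<times> real" where
  "posB = (\<lambda>(n, y). shift D setp (1/2) n y)"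

definition IB :: "(int \<times> 'x \<times> real) set" where
  "IB = UNIV \<times> cone"

definition relB :: "((int \<times> 'x \<times> real) \<times> (int \<times> 'x \<times> real)) set \<Rightarrow> ((real \<times> real) \<times> (real \<times> real)) set" where
  "relB E = (\<lambda>(i, j). (cone_line D (posB i), cone_line D (posB j))) ` E"

lemma supp_IB: "s \<in> sec NB \<Longrightarrow> supp NB s \<subseteq> IB"
  using triv_N0 sec_carrier[of s NB] by (fastforce simp: supp_def IB_def)

lemma relB_comp: "relB (E O F) \<subseteq> relB E O relB F"
  unfolding relB_def by force

lemma posB_IB: "i \<in> IB \<Longrightarrow> posB i \<in> cone"
  by (auto simp: IB_def posB_def intro: shift_cone)

lemma line_rel_relpow: "line_rel (E ^^ n) \<subseteq> line_rel E ^^ n"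
proof (induction n)
  case (Suc n)
  have "line_rel (E ^^ n O E) \<subseteq> line_rel (E ^^ n) O line_rel E" unfolding line_rel_def by force
  then show ?case using Suc by auto
qed (auto simp: line_rel_def cone_line_def)

lemma ctrl_relpow: "ctrl Q \<Longrightarrow> ctrl (Q ^^ n)"
  by (induction n) (auto intro: ctrl_Id ctrl_comp)

lemma cone_line_shift:
  "cone_line D (shift D setp a k y) =
     (contract a (snd y / (snd y + \<bar>of_int k\<bar>)) (proj D (fst y)), snd y + \<bar>of_int k\<bar>)"
  by (simp add: cone_line_def proj_shift)

text \<open>The absolute values of two copy numbers differ by at most the distance of the copies, so
  \<open>ctrl_contract\<close> applies. It serves the inner copies with \<open>a = 1/2\<close> and
  the outer ones with either kind of cell.\<close>

lemma ctrl_shift: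
  assumes "ctrl Q" and "\<And>p q. (p, q) \<in> X \<Longrightarrow> \<exists>k y l z. p = cone_line D (shift D setp a k y) \<and> q = cone_line D (shift D setp a l z) \<and>
     y \<in> cone \<and> z \<in> cone \<and> (cone_line D y, cone_line D z) \<in> Q \<and> \<bar>k - l\<bar> \<le> d \<and>
     (same_cell a (proj D (fst y)) (proj D (fst z)) \<or> proj D (fst y) = proj D (fst z))"
  shows "ctrl X"
proof (rule ctrl_subset[OF ctrl_contract[of "Q \<inter> (UNIV \<times> {1..}) \<times> (UNIV \<times> {1..})" a "of_int d"]])
  let ?Q = "Q \<inter> (UNIV \<times> {1..}) \<times> (UNIV \<times> {1..})"
  show "ctrl ?Q" by (rule ctrl_subset[OF assms(1)]) auto
  show "X \<subseteq> {((contract a (t / (t + n)) x, t + n), (contract a (t' / (t' + n')) x', t' + n')) | x t x' t' n n'.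
    ((x, t), (x', t')) \<in> ?Q \<and> 0 \<le> n \<and> 0 \<le> n' \<and> \<bar>n - n'\<bar> \<le> of_int d \<and> (same_cell a x x' \<or> x = x')}"
  proof
    fix w assume "w \<in> X"
    moreover obtain p q where w: "w = (p, q)" by (cases w)
    ultimately obtain k y l z where *: "p = cone_line D (shift D setp a k y)" "q = cone_line D (shift D setp a l z)"
      "y \<in> cone" "z \<in> cone" "(cone_line D y, cone_line D z) \<in> Q" "\<bar>k - l\<bar> \<le> d"
      "same_cell a (proj D (fst y)) (proj D (fst z)) \<or> proj D (fst y) = proj D (fst z)"
      using assms(2) by blast
    have "\<bar>\<bar>k\<bar> - \<bar>l\<bar>\<bar> \<le> d" using *(6) by linarith
    then have d: "\<bar>\<bar>real_of_int k\<bar> - \<bar>real_of_int l\<bar>\<bar> \<le> of_int d" by linarith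
    define x t n where xt: "x = proj D (fst y)" "t = snd y" "n = \<bar>real_of_int k\<bar>"
    define x' t' n' where xt': "x' = proj D (fst z)" "t' = snd z" "n' = \<bar>real_of_int l\<bar>"
    have 1: "w = ((contract a (t / (t + n)) x, t + n), (contract a (t' / (t' + n')) x', t' + n'))"
      by (simp add: w *(1,2) cone_line_shift xt xt')
    have 2: "((x, t), (x', t')) \<in> ?Q"
      using *(3-5) by (simp add: cone_iff cone_line_def xt xt')
    have 3: "0 \<le> n" "0 \<le> n'" "\<bar>n - n'\<bar> \<le> of_int d" using d by (simp_all add: xt xt')
    have 4: "same_cell a x x' \<or> x = x'" using *(7) by (simp add: xt xt')
    show "w \<in> {((contract a (t / (t + n)) x, t + n), (contract a (t' / (t' + n')) x', t' + n')) | x t x' t' n n'.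
      ((x, t), (x', t')) \<in> ?Q \<and> 0 \<le> n \<and> 0 \<le> n' \<and> \<bar>n - n'\<bar> \<le> of_int d \<and> (same_cell a x x' \<or> x = x')}"
      by (rule CollectI, rule exI[of _ x], rule exI[of _ t], rule exI[of _ x'], rule exI[of _ t'],
          rule exI[of _ n], rule exI[of _ n'], intro conjI 1 2 3 4)
  qed
qed auto

text \<open>By the last hypothesis \<open>w\<close> stays inside the cells to whose centres the copies with index of sign
  \<open>c\<close> are contracted, so that it can be repeated along these copies.\<close>

lemma null_swindle:
  assumes c: "c = 1 \<or> c = -1" and Z: "ixs.pres ixI Z inn out"
    and w: "local_op R NB HB w E" and w': "local_op R NB HB w' E" and inv: "inverse_ops NB w w'"
    and E: "E \<subseteq> IB \<times> IB" "locally_finite E" "ctrl (relB E)"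
    and cells: "\<And>i j. (i, j) \<in> E \<Longrightarrow> i = j \<or> same_cell (cell c) (proj D (fst (posB i))) (proj D (fst (posB j)))"
  shows "null (O_cat R D) (ixs.gen Z inn out (diag {0} w))" and "ixs.units (diag {0} w) (diag {0} w')"
proof -
  have NB: "modfam R NB" by (intro modfam_liftN modfam_N0)
  \<comment> \<open>On the half-line of sign \<open>c\<close> all copies use one kind of cell; copy
    0 fits either kind because it is not shifted.\<close>
  have pos: "ix_pos (m, i) = shift D setp (cell c) m (posB i)" if "0 \<le> c * m" "i \<in> IB" for m i
  proof (cases "m = 0")
    case True
    then show ?thesis using that posB_IB[OF that(2)] by (cases i) (simp add: ix_pos_def posB_def)
  next
    case False
    then have "0 \<le> m \<longleftrightarrow> 0 \<le> c" using that(1) c by auto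
    then have "cell m = cell c" by (simp add: cell_def)
    then show ?thesis by (cases i) (simp add: ix_pos_def posB_def)
  qed
  have IB: "(m, i) \<in> ixI \<longleftrightarrow> i \<in> IB" for m i by (cases i) (simp add: ixI_def IB_def)
  \<comment> \<open>Only copies of sign \<open>c\<close> may carry \<open>u\<close>: the other ones
    are contracted to the centres of cells that \<open>u\<close> may cross.\<close>
  have good_diag: "ixs.good (diag S u)" if u: "local_op R NB HB u E" and S: "S \<subseteq> {m. 0 \<le> c * m}" for S u
  proof (rule ixs.goodI)
    show "local_op R ixN ixs.H (diag S u) {((k, i), (k', j)). k' = k \<and> (k \<in> S \<and> (i, j) \<in> E \<or> i = j)}" (is "local_op _ _ _ _ ?E")
      unfolding ixH ixN_def by (rule local_op_diag[OF NB u])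
    show "locally_finite ?E" by (rule locally_finite_diag[OF E(2)])
    let ?X = "(\<lambda>((m, i), (m', j)). (cone_line D (shift D setp (cell c) m (posB i)), cone_line D (shift D setp (cell c) m' (posB j)))) `
      {((m, i), (m', j)). m' = m \<and> (i, j) \<in> E}"
    have "ctrl ?X"
    proof (rule ctrl_shift[OF E(3), of _ "cell c" 0])
      fix p q assume "(p, q) \<in> ?X"
      then obtain m i j where *: "p = cone_line D (shift D setp (cell c) m (posB i))" "q = cone_line D (shift D setp (cell c) m (posB j))" "(i, j) \<in> E"
        by auto
      have "i \<in> IB" "j \<in> IB" using * E(1) by auto
      moreover have "(cone_line D (posB i), cone_line D (posB j)) \<in> relB E" using *(3) by (force simp: relB_def)
      ultimately show "\<exists>k y l z. p = cone_line D (shift D setp (cell c) k y) \<and> q = cone_line D (shift D setp (cell c) l z) \<and>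
         y \<in> cone \<and> z \<in> cone \<and> (cone_line D y, cone_line D z) \<in> relB E \<and> \<bar>k - l\<bar> \<le> 0 \<and>
         (same_cell (cell c) (proj D (fst y)) (proj D (fst z)) \<or> proj D (fst y) = proj D (fst z))"
        using * cells[OF *(3)] posB_IB
        by - (rule exI[of _ m], rule exI[of _ "posB i"], rule exI[of _ m], rule exI[of _ "posB j"], auto)
    qed
    moreover have "ixs.pos_rel ?E \<subseteq> ?X \<union> Relation.Id"
    proof
      fix z assume "z \<in> ixs.pos_rel ?E"
      then obtain k i j where *: "z = (cone_line D (ix_pos (k, i)), cone_line D (ix_pos (k, j)))"
        "k \<in> S \<and> (i, j) \<in> E \<or> i = j" unfolding ixs.pos_rel_def by auto
      show "z \<in> ?X \<union> Relation.Id"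
      proof (cases "i = j")
        case False
        then have e: "k \<in> S" "(i, j) \<in> E" using *(2) by auto
        then have "0 \<le> c * k" "i \<in> IB" "j \<in> IB" using S E(1) by auto
        then have "z = (cone_line D (shift D setp (cell c) k (posB i)), cone_line D (shift D setp (cell c) k (posB j)))"
          using *(1) by (simp add: pos)
        then have "z \<in> ?X" using e by (intro image_eqI[of _ _ "((k, i), (k, j))"]) auto
        then show ?thesis by blast
      qed (use * in auto)
    qed
    ultimately show "ctrl (ixs.pos_rel ?E)" by (meson ctrl_Id ctrl_Un ctrl_subset)
  qed
  have units_diag: "ixs.units (diag S w) (diag S w')" if "S \<subseteq> {m. 0 \<le> c * m}" for S
    unfolding ixs.units_def using good_diag[OF w that] good_diag[OF w' that] inverse_ops_diag[OF inv, of S]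
    by (simp add: ixN_def)
  have units_swap: "ixs.units (swap_on \<sigma> UNIV) (swap_on \<sigma> UNIV)"
    if \<sigma>: "\<And>k. \<sigma> (\<sigma> k) = k" and near: "\<And>k. \<bar>k - \<sigma> k\<bar> \<le> 1" and side: "\<And>k. \<sigma> k = k \<or> 0 \<le> c * k \<and> 0 \<le> c * \<sigma> k" for \<sigma>
  proof -
    have "ixs.good (swap_on \<sigma> UNIV)"
    proof (rule ixs.goodI)
      show "local_op R ixN ixs.H (swap_on \<sigma> UNIV) {((k, i), (k', j)). i = j \<and> (k' = k \<or> k' = \<sigma> k)}" (is "local_op _ _ _ _ ?E")
        unfolding ixH ixN_def by (rule local_op_swap_on[OF \<sigma>]) simp
      show "locally_finite ?E" by (rule locally_finite_swap[OF \<sigma>])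
      let ?X = "(\<lambda>((m, i), (m', j)). (cone_line D (shift D setp (cell c) m (posB i)), cone_line D (shift D setp (cell c) m' (posB j)))) `
        {((m, i), (m', j)). i = j \<and> i \<in> IB \<and> \<bar>m - m'\<bar> \<le> 1}"
      have "ctrl ?X"
      \<comment> \<open>A swap joins copies of one and the same point, so before the shift there is
        no displacement and afterwards the heights differ by at most 1.\<close>
      proof (rule ctrl_shift[OF ctrl_Id, of _ "cell c" 1])
        fix p q assume "(p, q) \<in> ?X"
        then obtain m m' i where *: "p = cone_line D (shift D setp (cell c) m (posB i))" "q = cone_line D (shift D setp (cell c) m' (posB i))"
          "i \<in> IB" "\<bar>m - m'\<bar> \<le> 1" by auto
        then show "\<exists>k y l z. p = cone_line D (shift D setp (cell c) k y) \<and> q = cone_line D (shift D setp (cell c) l z) \<and>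
           y \<in> cone \<and> z \<in> cone \<and> (cone_line D y, cone_line D z) \<in> Relation.Id \<and> \<bar>k - l\<bar> \<le> 1 \<and>
           (same_cell (cell c) (proj D (fst y)) (proj D (fst z)) \<or> proj D (fst y) = proj D (fst z))"
          using posB_IB by - (rule exI[of _ m], rule exI[of _ "posB i"], rule exI[of _ m'], rule exI[of _ "posB i"], auto)
      qed
      moreover have "ixs.pos_rel ?E \<subseteq> ?X \<union> Relation.Id"
      proof
        fix z assume "z \<in> ixs.pos_rel ?E"
        then obtain k k' i where *: "z = (cone_line D (ix_pos (k, i)), cone_line D (ix_pos (k', i)))" "(k, i) \<in> ixI"
          "k' = k \<or> k' = \<sigma> k" unfolding ixs.pos_rel_def by auto
        show "z \<in> ?X \<union> Relation.Id"
        proof (cases "k' = k")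
          case False
          then have "k' = \<sigma> k" "0 \<le> c * k" "0 \<le> c * k'" "i \<in> IB" using *(2,3) side[of k] by (auto simp: IB)
          then have "z = (cone_line D (shift D setp (cell c) k (posB i)), cone_line D (shift D setp (cell c) k' (posB i)))"
            using *(1) by (simp add: pos)
          then have "z \<in> ?X" using \<open>i \<in> IB\<close> near[of k] \<open>k' = \<sigma> k\<close> by (intro image_eqI[of _ _ "((k, i), (k', i))"]) auto
          then show ?thesis by blast
        qed (use * in auto)
      qed
      ultimately show "ctrl (ixs.pos_rel ?E)" by (meson ctrl_Id ctrl_Un ctrl_subset)
    qed
    then show ?thesis using inverse_ops_swap_on[OF \<sigma>] by (simp add: ixs.units_def)
  qed
  have side: "swap1 c k = k \<or> 0 \<le> c * k \<and> 0 \<le> c * swap1 c k" "swap2 c k = k \<or> 0 \<le> c * k \<and> 0 \<le> c * swap2 c k" for k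
    using c by (auto simp: swap1_def swap2_def; presburger)+
  have S: "evens c \<subseteq> {m. 0 \<le> c * m}" "odds c \<subseteq> {m. 0 \<le> c * m}" by (auto simp: evens_def odds_def)
  note sw1 = units_swap[OF swap12(1)[OF c] swap12(3)[OF c] side(1)]
  note sw2 = units_swap[OF swap12(2)[OF c] swap12(4)[OF c] side(2)]
  note d1 = units_diag[OF S(1)] and d2 = units_diag[OF S(2)]
  \<comment> \<open>Along the outer copies the diagonal operators and full swaps are morphisms
    themselves, so each half of the swindle is a commutator in the automorphism group of one
    object.\<close>
  have "null (O_cat R D) (ixs.gen Z inn out (swap_comm (evens c) (swap1 c) UNIV w w'))"
    using ixs.null_gen_commutator[OF Z d1 sw1] by (simp add: swap_comm_def[abs_def])
  moreover have "null (O_cat R D) (ixs.gen Z inn out (swap_comm (odds c) (swap2 c) UNIV w w'))"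
    using ixs.null_gen_commutator[OF Z d2 sw2] by (simp add: swap_comm_def[abs_def])
  moreover have u1: "ixs.units (swap_comm (evens c) (swap1 c) UNIV w w') (\<lambda>s. swap_on (swap1 c) UNIV (diag (evens c) w (swap_on (swap1 c) UNIV (diag (evens c) w' s))))"
    using ixs.units_comp[OF d1 ixs.units_comp[OF sw1 ixs.units_comp[OF ixs.units_sym[OF d1] sw1]]] by (simp add: swap_comm_def[abs_def])
  moreover have u2: "ixs.units (swap_comm (odds c) (swap2 c) UNIV w w') (\<lambda>s. swap_on (swap2 c) UNIV (diag (odds c) w (swap_on (swap2 c) UNIV (diag (odds c) w' s))))"
    using ixs.units_comp[OF d2 ixs.units_comp[OF sw2 ixs.units_comp[OF ixs.units_sym[OF d2] sw2]]] by (simp add: swap_comm_def[abs_def])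
  ultimately have n: "null (O_cat R D) (ixs.gen Z inn out (swindle c UNIV w w'))"
    using ixs.null_gen_comp2[OF Z u1 u2] by (simp add: swindle_def[abs_def])
  show u0: "ixs.units (diag {0} w) (diag {0} w')" by (rule units_diag) simp
  interpret W: local_iso R NB HB w w' "E \<union> Relation.Id"
    using NB inv local_op_mono[OF w, of "E \<union> Relation.Id"] local_op_mono[OF w', of "E \<union> Relation.Id"]
    by (simp add: local_iso_def)
  have "ixs.gen Z inn out (swindle c UNIV w w') = ixs.gen Z inn out (diag {0} w)"
  proof (rule ixs.gen_cong[OF Z])
    show "ixs.good (swindle c UNIV w w')"
      using ixs.units_comp[OF u1 u2] by (simp add: swindle_def[abs_def] ixs.units_def)
    show "ixs.good (diag {0} w)" using u0 by (simp add: ixs.units_def)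
    show "swindle c UNIV w w' s = diag {0} w s" if "s \<in> sec ixN" for s
      using W.swindle_UNIV[OF c] that by (simp add: ixN_def)
  qed
  then show "null (O_cat R D) (ixs.gen Z inn out (diag {0} w))" using n by simp
qed

end

section \<open>Splitting the automorphism\<close>

context line_module
begin

abbreviation px :: "'x \<times> real \<Rightarrow> real" where "px y \<equiv> proj D (fst y)"

lemma near_act: "g \<in> carrier (grp D) \<Longrightarrow> near r (px (act_cone (act_bar D) g y)) \<longleftrightarrow> near r (px y)"
proof -
  assume g: "g \<in> carrier (grp D)"
  obtain n :: int where n: "(\<forall>x. act_line D g x = of_int n + x) \<or> (\<forall>x. act_line D g x = of_int n - x)"
    using act_line[OF g] by blast
  have eq: "of_int (- n) + (of_int n + x) = x" "of_int n - (of_int n - x) = x" for x :: real by simp_all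
  have "near r (act_line D g x) \<longleftrightarrow> near r x" for x
    using n
  proof
    assume "\<forall>x. act_line D g x = of_int n + x"
    then have x: "act_line D g x = of_int n + x" ..
    show ?thesis unfolding x using near_add_int[of r x n] near_add_int[of r "of_int n + x" "- n", unfolded eq] by (rule iffI[rotated])
  next
    assume "\<forall>x. act_line D g x = of_int n - x"
    then have x: "act_line D g x = of_int n - x" ..
    show ?thesis unfolding x using near_int_diff[of r x n] near_int_diff[of r "of_int n - x" n, unfolded eq] by (rule iffI[rotated])
  qed
  then show ?thesis by (simp add: act_cone_def proj_act)
qed

lemma relBE:
  assumes "(p, q) \<in> relB X"
  obtains i j where "(i, j) \<in> X" "p = cone_line D (posB i)" "q = cone_line D (posB j)"
proof -
  obtain w where w: "w \<in> X" "(p, q) = (\<lambda>(i, j). (cone_line D (posB i), cone_line D (posB j))) w"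
    using assms unfolding relB_def by (rule imageE)
  obtain i j where "w = (i, j)" by (cases w)
  then show thesis using w that[of i j] by simp
qed

lemma relB_Un_Id: "X \<subseteq> Y \<union> Relation.Id \<Longrightarrow> relB X \<subseteq> relB Y \<union> Relation.Id"
proof -
  assume "X \<subseteq> Y \<union> Relation.Id"
  then have "relB X \<subseteq> relB Y \<union> relB Relation.Id" unfolding relB_def by blast
  moreover have "relB Relation.Id \<subseteq> Relation.Id" unfolding relB_def by (intro image_subsetI) (auto simp: cone_line_def)
  ultimately show ?thesis by blast
qed

lemma px_posB: "px (posB (n, y)) = contract (1/2) (snd y / (snd y + \<bar>of_int n\<bar>)) (px y)"
  by (simp add: posB_def proj_shift)

text \<open>The contraction maps every cell into itself by whatever factor, so points of one cell
  stay together even on different copies.\<close>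

lemma posB_half_cell:
  assumes "y \<in> cone" "z \<in> cone" "same_cell (1/2) (px y) (px z)"
  shows "same_cell (1/2) (px (posB (n, y))) (px (posB (m, z)))"
proof -
  have "same_cell (1/2) (px y) (px (posB (n, y)))"
    unfolding px_posB using assms by (intro contract_cell shift_factor) (auto simp: same_cell_def)
  moreover have "same_cell (1/2) (px z) (px (posB (m, z)))"
    unfolding px_posB using assms by (intro contract_cell shift_factor) (auto simp: same_cell_def)
  ultimately show ?thesis using assms(3) by (simp add: same_cell_def)
qed

text \<open>Here the inner contraction pulls towards the boundary of the cells in question; by
  \<open>contract_half_cell\<close> it never reaches it.\<close>

lemma posB_integer_cell:
  assumes "y \<in> cone" "z \<in> cone" "same_cell 0 (px y) (px z)"
  shows "same_cell 0 (px (posB (n, y))) (px (posB (m, z)))"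
proof -
  have "same_cell 0 (px y) (px (posB (n, y)))"
    unfolding px_posB using assms by (intro contract_half_cell shift_factor) (auto simp: same_cell_def)
  moreover have "same_cell 0 (px z) (px (posB (m, z)))"
    unfolding px_posB using assms by (intro contract_half_cell shift_factor) (auto simp: same_cell_def)
  ultimately show ?thesis using assms(3) by (simp add: same_cell_def)
qed

theorem K1_class_trivial:
  assumes ab: "inverse_mors (O_cat R D) A \<alpha> \<beta>"
    and small: "controlled D (1/30) A A \<alpha>" "controlled D (1/30) A A \<beta>"
  shows "K1_class (O_cat R D) A \<alpha> = \<one>\<^bsub>K1 (O_cat R D)\<^esub>"
proof -
  let ?\<C> = "O_cat R D"
  have al: "\<alpha> \<in> O_homs R D A A" and be: "\<beta> \<in> O_homs R D A A"
    and comp: "mor_comp cone_top A A A \<alpha> \<beta> = mor_id cone_top A" "mor_comp cone_top A A A \<beta> \<alpha> = mor_id cone_top A"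
    using ab by (simp_all add: inverse_mors_def O_cat_def)
  define \<theta> where "\<theta> = opr A \<alpha>"
  define \<theta>' where "\<theta>' = opr A \<beta>"
  \<comment> \<open>One reflexive relation for \<alpha> and its inverse, as \<open>local_iso\<close>
    requires.\<close>
  define E where "E = msupp \<alpha> \<union> msupp \<beta> \<union> Relation.Id"
  have inv0: "inverse_ops N0 \<theta> \<theta>'"
    using opr_comp[OF al be comp(2)] opr_comp[OF be al comp(1)] by (simp add: inverse_ops_def \<theta>_def \<theta>'_def)
  interpret L: local_iso R N0 H0 \<theta> \<theta>' E
    using modfam_N0 inv0 local_op_mono[OF local_op_opr[OF al], of E] local_op_mono[OF local_op_opr[OF be], of E]
    by (simp add: local_iso_def \<theta>_def \<theta>'_def E_def le_supI1)
  have E_dist: "\<bar>px i - px j\<bar> \<le> 1/30" if ij: "(i, j) \<in> E" for i j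
  proof -
    obtain x t y s where "i = (x, t)" "j = (y, s)" by (cases i, cases j)
    then show ?thesis using ij small by (auto simp: E_def controlled_def)
  qed
  have En_dist: "\<bar>px i - px j\<bar> \<le> real n / 30" if ij: "(i, j) \<in> E ^^ n" for i j n
    using ij
  proof (induction n arbitrary: j)
    case (Suc n)
    then obtain k where k: "(i, k) \<in> E ^^ n" "(k, j) \<in> E" by auto
    have "real (Suc n) / 30 = real n / 30 + 1/30" by simp
    then show ?case using Suc.IH[OF k(1)] E_dist[OF k(2)] by linarith
  qed auto
  have E_lf: "locally_finite E"
    unfolding E_def by (intro locally_finite_Un locally_finite_msupp al be locally_finite_Id)
  have "line_rel Relation.Id \<subseteq> Relation.Id" by (auto simp: line_rel_def cone_line_def)
  then have "line_rel E \<subseteq> line_rel (msupp \<alpha>) \<union> line_rel (msupp \<beta>) \<union> Relation.Id"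
    unfolding line_rel_def E_def image_Un by blast
  then have E_ctrl: "ctrl (line_rel E)"
    using ctrl_Un[OF ctrl_Un[OF ctrl_msupp[OF al] ctrl_msupp[OF be]] ctrl_Id] ctrl_subset by blast
  \<comment> \<open>The radius 3/10 lies one step of \<open>E\<close> inside 1/3 and three steps
    outside 1/5: 3/10 + 1/30 = 1/3 and 1/5 + 3/30 = 3/10.\<close>
  define F where "F = {y. near (3/10) (px y)}"
  have F: "\<forall>\<rho>\<in>H0. \<forall>i. \<rho> i \<in> F \<longleftrightarrow> i \<in> F" by (auto simp: H0_def F_def near_act)
  define u where "u = swindle 1 F \<theta> \<theta>'"
  obtain u' where u: "local_op R NB HB u (spread 4 4 E)" and u': "local_op R NB HB u' (spread 4 4 E)"
    and uu: "inverse_ops NB u u'"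
    using L.swindle_local[of 1 F, OF _ F] unfolding u_def by auto
  have NB: "modfam R NB" by (intro modfam_liftN modfam_N0)
  define Zout where "Zout = {y. \<not> near (1/3) (px y)}"
  define Zin where "Zin = {y. near (1/5) (px y)}"
  have out: "E `` Zout \<inter> F = {}"
  proof (intro equals0I)
    fix j assume "j \<in> E `` Zout \<inter> F"
    then obtain i where i: "(i, j) \<in> E" "\<not> near (1/3) (px i)" "near (3/10) (px j)" by (auto simp: Zout_def F_def)
    have "\<bar>px j - px i\<bar> \<le> 1/30" using E_dist[OF i(1)] by linarith
    from near_triangle[OF i(3) this] i(2) show False by simp
  qed
  have inside: "E `` E `` E `` Zin \<subseteq> F"
  proof
    fix j assume "j \<in> E `` E `` E `` Zin"
    then obtain i k l where i: "near (1/5) (px i)" "(i, k) \<in> E" "(k, l) \<in> E" "(l, j) \<in> E" by (auto simp: Zin_def)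
    have "\<bar>px i - px j\<bar> \<le> 1/10" using E_dist[OF i(2)] E_dist[OF i(3)] E_dist[OF i(4)] by linarith
    from near_triangle[OF i(1) this] show "j \<in> F" by (simp add: F_def)
  qed
  have u_out: "u s = s" if "s \<in> sec NB" "supp NB s \<subseteq> UNIV \<times> Zout" for s
    using L.swindle_outside[of 1, OF _ that out] by (simp add: u_def)
  have u'_out: "u' s = s" if "s \<in> sec NB" "supp NB s \<subseteq> UNIV \<times> Zout" for s
    using u_out[OF that] uu that(1) unfolding inverse_ops_def by metis
  define a where "a = diag {0::int} \<theta>"
  define a' where "a' = diag {0::int} \<theta>'"
  have aa: "inverse_ops NB a a'" unfolding a_def a'_def by (rule inverse_ops_diag[OF inv0])
  have u_in: "u s = a s" if "s \<in> sec NB" "supp NB s \<subseteq> UNIV \<times> Zin" for s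
    using L.swindle_inside[of 1, OF _ that inside] by (simp add: u_def a_def)
  \<comment> \<open>By itself \<open>spread 4 4 E\<close> may cross the boundary of the cells and is
    then not controlled along the copies; its part starting over \<open>Zout\<close> is replaced by
    the diagonal.\<close>
  define Eu where "Eu = {(i, j). i = j \<or> i \<notin> UNIV \<times> Zout \<and> (i, j) \<in> spread 4 4 E} \<inter> IB \<times> IB"
  define Ea where "Ea = {((k, i), (k', j)). k' = k \<and> (k \<in> {0::int} \<and> (i, j) \<in> E \<or> i = j)} \<inter> IB \<times> IB"
  have lu: "local_op R NB HB u Eu" and lu': "local_op R NB HB u' Eu"
    unfolding Eu_def
    by (rule local_op_restrict[OF local_op_fix[OF NB u u_out] supp_IB]; assumption)
       (rule local_op_restrict[OF local_op_fix[OF NB u' u'_out] supp_IB]; assumption)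
  have la: "local_op R NB HB a Ea" and la': "local_op R NB HB a' Ea"
    unfolding Ea_def a_def a'_def
    by (rule local_op_restrict[OF local_op_diag[OF modfam_N0 L.op] supp_IB]; assumption)
       (rule local_op_restrict[OF local_op_diag[OF modfam_N0 L.op'] supp_IB]; assumption)
  define v where "v = (\<lambda>s. u' (a s))"
  define v' where "v' = (\<lambda>s. a' (u s))"
  have vv: "inverse_ops NB v v'"
    unfolding v_def v'_def
    by (rule inverse_ops_comp[OF local_opD(1)[OF la] local_opD(1)[OF lu] inverse_ops_sym[OF uu] aa])
  have v_in: "v s = s" "v' s = s" if "s \<in> sec NB" "supp NB s \<subseteq> UNIV \<times> Zin" for s
    using u_in[OF that] uu aa that(1) unfolding v_def v'_def inverse_ops_def by metis+
  \<comment> \<open>\<open>v\<close> applies \<open>a\<close> first and \<open>v'\<close> applies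
    \<open>u\<close> first; one relation has to serve both.\<close>
  define G where "G = Ea O Eu \<union> Eu O Ea"
  define Ev where "Ev = {(i, j). i = j \<or> i \<notin> UNIV \<times> Zin \<and> (i, j) \<in> G} \<inter> IB \<times> IB"
  have lv0: "local_op R NB HB v G" "local_op R NB HB v' G"
    unfolding v_def v'_def G_def
    by (rule local_op_mono[OF local_op_comp[OF la lu']], simp) (rule local_op_mono[OF local_op_comp[OF lu la']], simp)
  have lv: "local_op R NB HB v Ev" and lv': "local_op R NB HB v' Ev"
    unfolding Ev_def
    by (rule local_op_restrict[OF local_op_fix[OF NB lv0(1) v_in(1)] supp_IB]; assumption)
       (rule local_op_restrict[OF local_op_fix[OF NB lv0(2) v_in(2)] supp_IB]; assumption)
  have Eu_lf: "locally_finite Eu"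
    by (rule locally_finite_subset[OF locally_finite_Un[OF locally_finite_Id locally_finite_spread[OF E_lf, of 4 4]]])
       (auto simp: Eu_def)
  have Ea_lf: "locally_finite Ea"
    unfolding Ea_def by (rule locally_finite_subset[OF locally_finite_diag[OF E_lf, of "{0}"]]) auto
  have Ev_lf: "locally_finite Ev"
    by (rule locally_finite_subset[OF locally_finite_Un[OF locally_finite_Id locally_finite_Un[OF
          locally_finite_comp[OF Ea_lf Eu_lf] locally_finite_comp[OF Eu_lf Ea_lf]]]]) (auto simp: Ev_def G_def)
  have Eu_pair: "i = j \<or> (\<exists>n y m z. i = (n, y) \<and> j = (m, z) \<and> y \<in> cone \<and> z \<in> cone \<and> \<bar>n - m\<bar> \<le> 4 \<and>
      (y, z) \<in> E ^^ 4 \<and> \<bar>px y - px z\<bar> \<le> 4/30 \<and> same_cell (1/2) (px y) (px z))" if ij: "(i, j) \<in> Eu" for i j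
  proof (cases "i = j")
    case False
    obtain n y m z where nm: "i = (n, y)" "j = (m, z)" by (cases i, cases j)
    have *: "y \<in> cone" "z \<in> cone" "near (1/3) (px y)" "\<bar>n - m\<bar> \<le> 4" "(y, z) \<in> E ^^ 4"
      using ij False by (auto simp: Eu_def nm Zout_def IB_def spread_def)
    \<comment> \<open>Four steps of 1/30 stay below the 1/6 that separates distance 1/3 from
      distance 1/2.\<close>
    have d: "\<bar>px y - px z\<bar> \<le> 4/30" using En_dist[OF *(5)] by simp
    then have "same_cell (1/2) (px y) (px z)" by (intro near_same_cell_half *(3)) linarith
    then show ?thesis using * d nm by blast
  qed simp
  have Eu_cells: "i = j \<or> same_cell (cell 1) (px (posB i)) (px (posB j))" if ij: "(i, j) \<in> Eu" for i j
  proof (cases "i = j")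
    case False
    then obtain n y m z where nm: "i = (n, y)" "j = (m, z)" "y \<in> cone" "z \<in> cone" "same_cell (1/2) (px y) (px z)"
      using Eu_pair[OF ij] by blast
    then show ?thesis using posB_half_cell[OF nm(3-5), of n m] by (simp add: cell_def)
  qed simp
  \<comment> \<open>Before the shift these pairs are controlled by \<open>E ^^ 4\<close>. Distinct
    ends lie over one cell on copies at most 4 apart, so the shift preserves control.\<close>
  have Eu_ctrl: "ctrl (relB Eu)"
  proof -
    let ?X = "relB {(i, j) \<in> Eu. i \<noteq> j}"
    have "ctrl (line_rel (E ^^ 4))" by (rule ctrl_subset[OF ctrl_relpow[OF E_ctrl] line_rel_relpow])
    then have "ctrl ?X"
    proof (rule ctrl_shift[of _ _ "1/2" 4])
      fix p q assume "(p, q) \<in> ?X"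
      then obtain i j where "(i, j) \<in> {(i, j) \<in> Eu. i \<noteq> j}" "p = cone_line D (posB i)" "q = cone_line D (posB j)"
        by (rule relBE)
      then have ij: "(i, j) \<in> Eu" "i \<noteq> j" "p = cone_line D (posB i)" "q = cone_line D (posB j)" by simp_all
      obtain n y m z where nm: "i = (n, y)" "j = (m, z)" "y \<in> cone" "z \<in> cone" "\<bar>n - m\<bar> \<le> 4"
        "(y, z) \<in> E ^^ 4" "same_cell (1/2) (px y) (px z)" using Eu_pair[OF ij(1)] ij(2) by blast
      have "(cone_line D y, cone_line D z) \<in> line_rel (E ^^ 4)" using nm(6) by (force simp: line_rel_def)
      then show "\<exists>k y l z. p = cone_line D (shift D setp (1/2) k y) \<and> q = cone_line D (shift D setp (1/2) l z) \<and>
          y \<in> cone \<and> z \<in> cone \<and> (cone_line D y, cone_line D z) \<in> line_rel (E ^^ 4) \<and> \<bar>k - l\<bar> \<le> 4 \<and>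
          (same_cell (1/2) (px y) (px z) \<or> px y = px z)"
        using ij nm by - (rule exI[of _ n], rule exI[of _ y], rule exI[of _ m], rule exI[of _ z], simp add: posB_def)
    qed
    moreover have "relB Eu \<subseteq> ?X \<union> Relation.Id" by (rule relB_Un_Id) blast
    ultimately show ?thesis by (meson ctrl_Id ctrl_Un ctrl_subset)
  qed
  \<comment> \<open>\<open>a\<close> moves points only on inner copy 0, which is not contracted, so
    crossing a boundary does no harm.\<close>
  have Ea_ctrl: "ctrl (relB Ea)"
  proof -
    have "relB Ea \<subseteq> line_rel E \<union> Relation.Id"
    proof
      fix w assume "w \<in> relB Ea"
      moreover obtain p q where pq: "w = (p, q)" by (cases w)
      ultimately obtain i j where ij: "(i, j) \<in> Ea" "p = cone_line D (posB i)" "q = cone_line D (posB j)"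
        by (metis relBE)
      obtain k y k' z where "i = (k, y)" "j = (k', z)" by (cases i, cases j)
      then have *: "w = (cone_line D (posB (k, y)), cone_line D (posB (k, z)))"
        "y \<in> cone" "z \<in> cone" "k = 0 \<and> (y, z) \<in> E \<or> y = z"
        using ij pq by (auto simp: Ea_def IB_def)
      show "w \<in> line_rel E \<union> Relation.Id"
      proof (cases "y = z")
        case False
        then have "w = (cone_line D y, cone_line D z)" "(y, z) \<in> E" using * by (auto simp: posB_def)
        then show ?thesis by (force simp: line_rel_def)
      qed (use *(1) in simp)
    qed
    then show ?thesis using ctrl_Un[OF E_ctrl ctrl_Id] ctrl_subset by blast
  qed
  have Ev_ctrl: "ctrl (relB Ev)"
  proof -
    have 1: "relB Ev \<subseteq> relB G \<union> Relation.Id" by (rule relB_Un_Id) (unfold Ev_def, blast)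
    have 2: "relB G \<subseteq> (relB Ea O relB Eu) \<union> (relB Eu O relB Ea)"
      using relB_comp[of Ea Eu] relB_comp[of Eu Ea] unfolding G_def relB_def image_Un by blast
    show ?thesis
      by (rule ctrl_subset[OF ctrl_Un[OF ctrl_Un[OF ctrl_comp[OF Ea_ctrl Eu_ctrl] ctrl_comp[OF Eu_ctrl Ea_ctrl]] ctrl_Id]])
         (rule order_trans[OF 1 Un_mono[OF 2 order_refl]])
  qed
  have Ev_cells: "i = j \<or> same_cell (cell (- 1)) (px (posB i)) (px (posB j))" if ij: "(i, j) \<in> Ev" for i j
  proof (cases "i = j")
    case False
    obtain n y m z where nm: "i = (n, y)" "j = (m, z)" by (cases i, cases j)
    have *: "y \<in> cone" "z \<in> cone" "\<not> near (1/5) (px y)" "(i, j) \<in> G"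
      using ij False by (auto simp: Ev_def nm Zin_def IB_def)
    have Ea_d: "\<bar>px (snd p) - px (snd q)\<bar> \<le> 1/30" if pq: "(p, q) \<in> Ea" for p q
      using pq E_dist by (cases p, cases q) (auto simp: Ea_def)
    have Eu_d: "\<bar>px (snd p) - px (snd q)\<bar> \<le> 4/30" if pq: "(p, q) \<in> Eu" for p q
    proof (cases "p = q")
      case False
      then obtain n y m z where nm: "p = (n, y)" "q = (m, z)" "\<bar>px y - px z\<bar> \<le> 4/30"
        using Eu_pair[OF pq] by blast
      then show ?thesis by simp
    qed simp
    \<comment> \<open>1/30 from \<open>a\<close> and 4/30 from \<open>u\<close> or its inverse give
      1/6.\<close>
    have "\<bar>px (snd i) - px (snd j)\<bar> \<le> 1/5"
      using *(4) unfolding G_def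
    proof (elim UnE)
      assume "(i, j) \<in> Ea O Eu"
      then obtain k where k: "(i, k) \<in> Ea" "(k, j) \<in> Eu" by blast
      show ?thesis using Ea_d[OF k(1)] Eu_d[OF k(2)] by linarith
    next
      assume "(i, j) \<in> Eu O Ea"
      then obtain k where k: "(i, k) \<in> Eu" "(k, j) \<in> Ea" by blast
      show ?thesis using Eu_d[OF k(1)] Ea_d[OF k(2)] by linarith
    qed
    then have "same_cell 0 (px y) (px z)" by (intro not_near_same_cell *(3)) (simp add: nm)
    then show ?thesis using posB_integer_cell[OF *(1,2)] by (simp add: nm cell_def)
  qed simp
  have "ixs.invariant ixI" by (auto simp: ixs.invariant_def ixs.act_I)
  from ixs.pres_std[OF this] obtain Z inn out where Z: "ixs.pres ixI Z inn out" by blast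
  have IB: "Eu \<subseteq> IB \<times> IB" "Ev \<subseteq> IB \<times> IB" by (auto simp: Eu_def Ev_def)
  \<comment> \<open>\<open>u\<close> is killed along the outer copies of positive sign and
    \<open>v\<close> along those of negative sign.\<close>
  note nu = null_swindle[of 1, OF _ Z lu lu' uu IB(1) Eu_lf Eu_ctrl Eu_cells]
  note nv = null_swindle[of "-1", OF _ Z lv lv' vv IB(2) Ev_lf Ev_ctrl Ev_cells]
  have n: "null ?\<C> (ixs.gen Z inn out (diag {0} u))" "ixs.units (diag {0} u) (diag {0} u')"
    "null ?\<C> (ixs.gen Z inn out (diag {0} v))" "ixs.units (diag {0} v) (diag {0} v')"
    using nu nv by simp_all
  define T where "T = (\<lambda>s. diag {0::int} u (diag {0} v s))"
  have uT: "ixs.units T (\<lambda>s. diag {0} v' (diag {0} u' s))" unfolding T_def by (rule ixs.units_comp[OF n(2,4)])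
  have nT: "null ?\<C> (ixs.gen Z inn out T)" unfolding T_def by (rule ixs.null_gen_comp2[OF Z n(2,4,1,3)])
  \<comment> \<open>On outer copy 0 the product of \<open>u\<close> and \<open>v\<close> is
    \<open>a\<close>, so only the copy with both indices 0 is affected.\<close>
  have T: "T s = diag {0} (diag {0} \<theta>) s" if s: "s \<in> sec ixN" for s
  proof
    fix p :: "int \<times> int \<times> 'x \<times> real"
    obtain k i where p: "p = (k, i)" by (cases p)
    have sl: "(\<lambda>i. s (k, i)) \<in> sec NB" using sec_slice[OF s[unfolded ixN_def]] .
    have "u (v (\<lambda>i. s (k, i))) = a (\<lambda>i. s (k, i))"
      using uu local_op_sec[OF la sl] by (simp add: v_def inverse_ops_def)
    then show "T s p = diag {0} (diag {0} \<theta>) s p" by (auto simp: T_def diag_def p a_def)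
  qed
  have mA: "ixs.mor A inn0 out0 T = \<alpha>" by (rule mor_A[OF al]) (simp add: T \<theta>_def)
  have aut: "(A, ixs.mor A inn0 out0 T) \<in> Auts ?\<C>" unfolding mA using ab by (auto simp: Auts_def)
  have "null ?\<C> (ixs.gen Z inn out T - frag_of (A, ixs.mor A inn0 out0 T))"
  proof (rule ixs.null_summand[OF Z pres_A uT aut])
    fix s assume s: "s \<in> sec ixN" "supp ixN s \<subseteq> J0"
    show "supp ixN (T s) \<subseteq> J0"
    proof
      fix p assume p: "p \<in> supp ixN (T s)"
      obtain m n y where mn: "p = (m, n, y)" by (cases p)
      have "p \<in> ixI" using p ixs.supp_I[OF ixs.good_sec[OF _ s(1)], of T] uT by (auto simp: ixs.units_def)
      then have y: "y \<in> cone" by (simp add: ixI_def mn)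
      show "p \<in> J0"
      proof (cases "m = 0 \<and> n = 0")
        case False
        then have "T s p = s p" by (auto simp: T[OF s(1)] diag_def mn)
        then show ?thesis using p s(2) by (auto simp: supp_def)
      qed (simp add: J0_def mn y)
    qed
  next
    fix s assume s: "s \<in> sec ixN"
    show "restr ixN (ixI - J0) (T s) = restr ixN (ixI - J0) s"
    proof (rule restr_cong)
      fix p assume p: "p \<in> ixI - J0"
      obtain m n y where mn: "p = (m, n, y)" by (cases p)
      have "m \<noteq> 0 \<or> n \<noteq> 0" using p by (auto simp: J0_def ixI_def mn)
      then show "T s p = s p" by (auto simp: T[OF s] diag_def mn)
    qed
  qed
  from null_diff[OF nT this] have "null ?\<C> (frag_of (A, \<alpha>))" by (simp add: mA)
  then show ?thesis by (rule K1_class_null)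
qed

end

section \<open>The two groups\<close>

lemma line_data_cyclic: "line_data cyclic_line (\<lambda>x r. r)"
proof (rule line_data.intro)
  show "group_action (grp cyclic_line) UNIV (act_bar cyclic_line)" by (rule cyclic_line_actions)
  show "\<exists>n::int. (\<forall>x. act_line cyclic_line g x = of_int n + x) \<or> (\<forall>x. act_line cyclic_line g x = of_int n - x)" for g
    by (rule exI[of _ g]) (simp add: cyclic_line_def)
  show "\<exists>g\<in>carrier (grp cyclic_line). \<forall>x. act_line cyclic_line g x = x + of_int n" for n
    by (rule bexI[of _ n]) (simp_all add: cyclic_line_def)
  show "continuous_on UNIV (proj cyclic_line)" by (simp add: cyclic_line_def)
  show "compact (proj cyclic_line -` {a..b})" for a b by (simp add: cyclic_line_def)
qed (simp_all add: cyclic_line_def)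

lemma line_data_dihedral: "line_data dihedral_line (\<lambda>x r. (fst x, r))"
proof (rule line_data.intro)
  show "group_action (grp dihedral_line) UNIV (act_bar dihedral_line)" by (rule dihedral_line_actions)
  show "\<exists>n::int. (\<forall>x. act_line dihedral_line g x = of_int n + x) \<or> (\<forall>x. act_line dihedral_line g x = of_int n - x)" for g
    by (cases g; rule exI[of _ "fst g"]) (auto simp: dihedral_line_def dihedral_act_def)
  show "\<exists>g\<in>carrier (grp dihedral_line). \<forall>x. act_line dihedral_line g x = x + of_int n" for n
    by (rule bexI[of _ "(n, False)"]) (simp_all add: dihedral_line_def dihedral_act_def)
  show "continuous_on UNIV (proj dihedral_line)" by (simp add: dihedral_line_def continuous_on_snd)
  have "proj dihedral_line -` {a..b} = UNIV \<times> {a..b}" for a b by (auto simp: dihedral_line_def)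
  then show "compact (proj dihedral_line -` {a..b})" for a b
    by (simp add: compact_Times finite_imp_compact)
qed (auto simp: dihedral_line_def)

theorem theorem1p4:
  fixes R :: "('r, 'k) ring_scheme"
  assumes "ring R"
    and "\<exists>\<iota> :: 'r list \<Rightarrow> 'm. inj_on \<iota> (lists (carrier R))"
  shows "(\<forall>A \<alpha>. eps_automorphism R cyclic_line (1/30) (A :: real \<times> real \<Rightarrow> ('r, 'm) module) \<alpha> \<longrightarrow>
            K1_class (O_cat R cyclic_line) A \<alpha> = \<one>\<^bsub>K1 (O_cat R cyclic_line)\<^esub>) \<and>
         (\<forall>A \<alpha>. eps_automorphism R dihedral_line (1/30) (A :: (bool \<times> real) \<times> real \<Rightarrow> ('r, 'm) module) \<alpha> \<longrightarrow>
            K1_class (O_cat R dihedral_line) A \<alpha> = \<one>\<^bsub>K1 (O_cat R dihedral_line)\<^esub>)"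
proof -
  obtain \<iota> :: "'r list \<Rightarrow> 'm" where \<iota>: "inj_on \<iota> (lists (carrier R))" using assms(2) by blast
  have trivial: "K1_class (O_cat R D) A \<alpha> = \<one>\<^bsub>K1 (O_cat R D)\<^esub>"
    if D: "line_data D setp" and eps: "eps_automorphism R D (1/30) A \<alpha>"
    for D :: "('g, 'x::topological_space) line_space" and setp and A :: "'x \<times> real \<Rightarrow> ('r, 'm) module" and \<alpha>
  proof -
    obtain \<beta> where \<beta>: "inverse_mors (O_cat R D) A \<alpha> \<beta>" "controlled D (1/30) A A \<alpha>" "controlled D (1/30) A A \<beta>"
      using eps by (auto simp: eps_automorphism_def)
    then have "A \<in> O_objs R D" by (simp add: inverse_mors_def O_cat_def)
    then have "line_module D setp R A \<iota>"
      by (intro line_module.intro line_module_axioms.intro D assms(1) \<iota>)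
    then show ?thesis using \<beta> by (rule line_module.K1_class_trivial)
  qed
  show ?thesis using trivial[OF line_data_cyclic] trivial[OF line_data_dihedral] by blast
qed

end
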